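(* Let $\Lambda$ be a self-conformal set in $\mathbb{R}^n$, i.e. the attractor of a conformal $C^{1+\theta}$ IFS $\mathcal{F}$ on $\mathbb{R}^n$ (no separation condition is assumed). The collection of all Gibbs measures on $\Lambda$ is relative dimension separable (with respect to the Euclidean metric). Consequently, for every $1\le d<n$, for almost every $V\in\mathrm{Gr}(d,n)$, $$\dim_H P_V\mu=\min\{d,\dim_H\mu\}\quad\text{simultaneously for all Gibbs measures }\mu\text{ on }\Lambda,$$ i.e. the set of $V\in\mathrm{Gr}(d,n)$ for which the equality fails for at least one Gibbs measure $\mu$ on $\Lambda$ has measure zero.
   Context: Conformal IFS: let $V_0\subset\mathbb{R}^n$ be a compact connected set with $V_0=\overline{\mathrm{Int}(V_0)}$. A map $f:V_0\to V_0$ is conformal $C^{1+\theta}$ if it extends to a diffeomorphism $f:W\to W$ of an open connected set $W\supset V_0$ such that for every $x\in V_0$ the differential $f'(x)=D_xf$ is a non-singular similitude and $V_0\ni x\mapsto D_xf$ is $\theta$-Hölder for some $\theta>0$. A conformal $C^{1+\theta}$ IFS is a collection $\mathcal{F}=(f_i)_{i\in\mathcal{A}}$ ($\mathcal{A}$ finite) of conformal $C^{1+\theta}$ maps $f_i:V_0\to V_0$ with $0<\|f_i'(x)\|<1$ for every $x\in V_0$. Let $\Sigma=\mathcal{A}^{\mathbb{N}}$ with left shift $\sigma$, and let $\Pi_{\mathcal{F}}:\Sigma\to V_0$, $\Pi_{\mathcal{F}}(\omega)=\lim_{n\to\infty}f_{\omega_1}\circ\cdots\circ f_{\omega_n}(x)$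 (any $x\in V_0$). The attractor is $\Lambda=\Pi_{\mathcal{F}}(\Sigma)$. Gibbs measures: a shift-invariant ergodic Borel probability measure $\mu$ on $\Sigma$ is a Gibbs measure of a continuous potential $\phi:\Sigma\to\mathbb{R}$ if there exist $P\in\mathbb{R}$ and $C\ge1$ such that $C^{-1}\le\frac{\mu([\omega|_n])}{\exp(-Pn+\sum_{k=0}^{n-1}\phi(\sigma^k\omega))}\le C$ for all $\omega\in\Sigma$, $n\in\mathbb{N}$, where $[\omega|_n]$ is the cylinder of sequences agreeing with $\omega$ in the first $n$ coordinates. A Gibbs measure on $\Lambda$ is a push-forward $\Pi_{\mathcal{F}}\mu$, where $\mu$ is a Gibbs measure of a Hölder continuous potential (Hölder with respect to a metric $\gamma^{|\omega\wedge\tau|}$, $\gamma\in(0,1)$, where $|\omega\wedge\tau|$ is the length of the longest common prefix). $\mathrm{Gr}(d,n)$ is the Grassmannian of $d$-dimensional linear subspaces of $\mathbb{R}^n$, with its unique orthogonally invariant Borel probability measure ("almost every" refers to it); $P_V$ is the orthogonal projection onto $V$ and $P_V\mu$ the push-forward. For a finite Borel measure $\mu$, with $\underline d(\mu,x)=\liminf_{r\to0}\frac{\log\mu(B(x,r))}{\log r}$, let $\underline{\dim}_H\mu=\operatorname{ess\,inf}_{x\sim\mu}\underline d(\mu,x)$, $\overline{\dim}_H\mu=\operatorname{ess\,sup}_{x\sim\mu}\underline d(\mu,x)$; if they coincide the common value is $\dim_H\mu$. For finite Borel measures $\mu,\nu$ on a metric space $(X,\rho)$, $\dim(\mu\|\nu,\rho)$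 is the infimum of all $\varepsilon>0$ such that $$-\varepsilon<\operatorname*{ess\,inf}_{x\sim\mu}\liminf_{r\to0}\frac{\log\frac{\mu(B(x,r))}{\nu(B(x,r))}}{\log r}\le\operatorname*{ess\,sup}_{x\sim\mu}\limsup_{r\to0}\frac{\log\frac{\mu(B(x,r))}{\nu(B(x,r))}}{\log r}<\varepsilon,$$ with $\log\frac{\mu(B(x,r))}{0}=+\infty$ if $\mu(B(x,r))>0$. A collection $\mathcal{M}$ of finite Borel measures on $(X,\rho)$ is relative dimension separable if there is a countable set $\mathcal{V}$ of finite Borel measures on $X$ such that for every $\mu\in\mathcal{M}$, $\varepsilon>0$ there is $\nu\in\mathcal{V}$ with $\dim(\mu\|\nu,\rho)<\varepsilon$. *)

theory Defs
  imports "HOL-Probability.Probability"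
begin

section \<open>Conformal iterated function systems\<close>

definition C1_on :: "('v::euclidean_space) set \<Rightarrow> ('v \<Rightarrow> 'v) \<Rightarrow> bool" where
  "C1_on W g \<longleftrightarrow> (\<exists>D :: 'v \<Rightarrow> 'v \<Rightarrow>\<^sub>L 'v.
      (\<forall>x\<in>W. (g has_derivative blinfun_apply (D x)) (at x)) \<and> continuous_on W D)"

definition C1_diffeomorphism :: "('v::euclidean_space) set \<Rightarrow> 'v set \<Rightarrow> ('v \<Rightarrow> 'v) \<Rightarrow> bool" where
  "C1_diffeomorphism W W' g \<longleftrightarrow>
     bij_betw g W W' \<and> C1_on W g \<and> C1_on W' (inv_into W g)"

definition nonsingular_similitude :: "('v::euclidean_space \<Rightarrow> 'v) \<Rightarrow> bool" where
  "nonsingular_similitude L \<longleftrightarrow> linear L \<and> (\<exists>c>0. \<forall>v. norm (L v) = c * norm v)"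

text \<open>
  The map \<open>f\<close> is conformal \<open>C\<^sup>1\<^sup>+\<^sup>\<theta>\<close> on \<open>V0\<close> and \<open>D x\<close> is its differential at \<open>x \<in> V0\<close>, that is, the
  derivative at \<open>x\<close> of an extension \<open>g\<close>. If \<open>V0\<close> is the closure of its interior, then the values of
  \<open>D\<close> on \<open>V0\<close> are determined by \<open>f\<close> (by continuity from the interior). Only the values of \<open>f\<close> on
  \<open>V0\<close> matter. The norm of a bounded linear function is the operator norm.
\<close>

definition conformal_map_on ::
    "('v::euclidean_space) set \<Rightarrow> ('v \<Rightarrow> 'v) \<Rightarrow> ('v \<Rightarrow> 'v \<Rightarrow>\<^sub>L 'v) \<Rightarrow> bool" where
  "conformal_map_on V0 f D \<longleftrightarrow>
     f ` V0 \<subseteq> V0 \<and>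
     (\<exists>W g. open W \<and> connected W \<and> V0 \<subseteq> W \<and> C1_diffeomorphism W W g \<and>
        (\<forall>x\<in>V0. g x = f x \<and> (g has_derivative blinfun_apply (D x)) (at x))) \<and>
     (\<forall>x\<in>V0. nonsingular_similitude (blinfun_apply (D x))) \<and>
     (\<exists>\<theta>>0. \<exists>C. \<forall>x\<in>V0. \<forall>y\<in>V0. norm (D x - D y) \<le> C * dist x y powr \<theta>)"

text \<open>The alphabet is the finite type \<open>'a\<close>.\<close>

definition conformal_IFS ::
    "('v::euclidean_space) set \<Rightarrow> ('a::finite \<Rightarrow> 'v \<Rightarrow> 'v) \<Rightarrow> bool" where
  "conformal_IFS V0 f \<longleftrightarrow>
     compact V0 \<and> connected V0 \<and> V0 \<noteq> {} \<and> V0 = closure (interior V0) \<and>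
     (\<forall>i. \<exists>D. conformal_map_on V0 (f i) D \<and> (\<forall>x\<in>V0. 0 < norm (D x) \<and> norm (D x) < 1))"

text \<open>
  Sequences are indexed from 0, so \<open>foldr f (map \<omega> [0..<n]) x\<close> is
  \<open>f (\<omega> 0) (f (\<omega> 1) (\<dots> (f (\<omega> (n - 1)) x)))\<close>. The limit does not depend on \<open>x \<in> V0\<close>.
\<close>

definition coding_map ::
    "('v::euclidean_space) set \<Rightarrow> ('a::finite \<Rightarrow> 'v \<Rightarrow> 'v) \<Rightarrow> (nat \<Rightarrow> 'a) \<Rightarrow> 'v" where
  "coding_map V0 f \<omega> =
     (THE p. \<forall>x\<in>V0. (\<lambda>n. foldr f (map \<omega> [0..<n]) x) \<longlonglongrightarrow> p)"

definition attractor :: "('v::euclidean_space) set \<Rightarrow> ('a::finite \<Rightarrow> 'v \<Rightarrow> 'v) \<Rightarrow> 'v set" where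
  "attractor V0 f = range (coding_map V0 f)"


section \<open>Gibbs measures\<close>

text \<open>
  The alphabet being finite and discrete, the product \<open>\<sigma>\<close>-algebra on sequences is the Borel
  \<open>\<sigma>\<close>-algebra of the product topology.
\<close>

definition seq_space :: "(nat \<Rightarrow> 'a::finite) measure" where
  "seq_space = (\<Pi>\<^sub>M k\<in>UNIV. count_space UNIV)"

definition shift :: "(nat \<Rightarrow> 'a) \<Rightarrow> nat \<Rightarrow> 'a" where
  "shift \<omega> = (\<lambda>k. \<omega> (Suc k))"

definition cylinder :: "(nat \<Rightarrow> 'a) \<Rightarrow> nat \<Rightarrow> (nat \<Rightarrow> 'a) set" where
  "cylinder \<omega> n = {\<tau>. \<forall>k<n. \<tau> k = \<omega> k}"

text \<open>For distinct sequences the length of the longest common prefix is the first index at which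
  they differ.\<close>

definition seq_dist :: "real \<Rightarrow> (nat \<Rightarrow> 'a) \<Rightarrow> (nat \<Rightarrow> 'a) \<Rightarrow> real" where
  "seq_dist \<gamma> \<omega> \<tau> = (if \<omega> = \<tau> then 0 else \<gamma> ^ (LEAST k. \<omega> k \<noteq> \<tau> k))"

definition holder_potential :: "((nat \<Rightarrow> 'a::finite) \<Rightarrow> real) \<Rightarrow> bool" where
  "holder_potential \<phi> \<longleftrightarrow> (\<exists>\<gamma> \<alpha> C. 0 < \<gamma> \<and> \<gamma> < 1 \<and> 0 < \<alpha> \<and>
     (\<forall>\<omega> \<tau>. \<bar>\<phi> \<omega> - \<phi> \<tau>\<bar> \<le> C * seq_dist \<gamma> \<omega> \<tau> powr \<alpha>))"

definition gibbs_measure ::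
    "((nat \<Rightarrow> 'a::finite) \<Rightarrow> real) \<Rightarrow> (nat \<Rightarrow> 'a) measure \<Rightarrow> bool" where
  "gibbs_measure \<phi> \<mu> \<longleftrightarrow>
     sets \<mu> = sets seq_space \<and> prob_space \<mu> \<and>
     distr \<mu> \<mu> shift = \<mu> \<and>
     (\<forall>B\<in>sets \<mu>. shift -` B = B \<longrightarrow> measure \<mu> B = 0 \<or> measure \<mu> B = 1) \<and>
     (\<exists>P C. 1 \<le> C \<and> (\<forall>\<omega> n.
        (let q = measure \<mu> (cylinder \<omega> n) /
                 exp (- P * real n + (\<Sum>k<n. \<phi> ((shift ^^ k) \<omega>)))
         in inverse C \<le> q \<and> q \<le> C)))"

definition gibbs_measures_on_attractor ::
    "('v::euclidean_space) set \<Rightarrow> ('a::finite \<Rightarrow> 'v \<Rightarrow> 'v) \<Rightarrow> 'v measure set" where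
  "gibbs_measures_on_attractor V0 f =
     {distr \<mu> borel (coding_map V0 f) | \<mu> \<phi>. holder_potential \<phi> \<and> gibbs_measure \<phi> \<mu>}"


section \<open>Dimension of measures\<close>

text \<open>
  Logarithm of a non-negative number with \<open>elog 0 = -\<infinity>\<close>. The second function is the logarithm of a
  quotient, with the convention that it is \<open>\<infinity>\<close> if only the denominator vanishes.
\<close>

definition elog :: "real \<Rightarrow> ereal" where
  "elog a = (if a \<le> 0 then - \<infinity> else ereal (ln a))"

definition elog_quotient :: "real \<Rightarrow> real \<Rightarrow> ereal" where
  "elog_quotient a b = (if b = 0 \<and> 0 < a then \<infinity> else elog (a / b))"

text \<open>
  Essential supremum and infimum as limits along the almost-everywhere filter. On measurable
  functions the former is \<^const>\<open>esssup\<close>, which is \<open>top\<close> by convention on the others.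
\<close>

definition ess_sup :: "'x measure \<Rightarrow> ('x \<Rightarrow> ereal) \<Rightarrow> ereal" where
  "ess_sup \<mu> g = Limsup (ae_filter \<mu>) g"

definition ess_inf :: "'x measure \<Rightarrow> ('x \<Rightarrow> ereal) \<Rightarrow> ereal" where
  "ess_inf \<mu> g = Liminf (ae_filter \<mu>) g"

definition lower_local_dim :: "('x::metric_space) measure \<Rightarrow> 'x \<Rightarrow> ereal" where
  "lower_local_dim \<mu> x =
     Liminf (at_right 0) (\<lambda>r. elog (measure \<mu> (ball x r)) / ereal (ln r))"

definition lower_dim_H :: "('x::metric_space) measure \<Rightarrow> ereal" where
  "lower_dim_H \<mu> = ess_inf \<mu> (lower_local_dim \<mu>)"

definition upper_dim_H :: "('x::metric_space) measure \<Rightarrow> ereal" where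
  "upper_dim_H \<mu> = ess_sup \<mu> (lower_local_dim \<mu>)"

text \<open>\<open>dim\<^sub>H \<mu>\<close> exists and equals \<open>s\<close>.\<close>

definition has_dim_H :: "('x::metric_space) measure \<Rightarrow> ereal \<Rightarrow> bool" where
  "has_dim_H \<mu> s \<longleftrightarrow> lower_dim_H \<mu> = s \<and> upper_dim_H \<mu> = s"

definition relative_dim :: "('x::metric_space) measure \<Rightarrow> 'x measure \<Rightarrow> ereal" where
  "relative_dim \<mu> \<nu> =
     (let q = (\<lambda>x r. elog_quotient (measure \<mu> (ball x r)) (measure \<nu> (ball x r)) / ereal (ln r));
          lo = ess_inf \<mu> (\<lambda>x. Liminf (at_right 0) (q x));
          hi = ess_sup \<mu> (\<lambda>x. Limsup (at_right 0) (q x))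
      in Inf {ereal \<epsilon> | \<epsilon>. 0 < \<epsilon> \<and> - ereal \<epsilon> < lo \<and> lo \<le> hi \<and> hi < ereal \<epsilon>})"

text \<open>
  Finite Borel measures on a Borel subset \<open>X\<close> of a metric space are represented by the finite Borel
  measures on the whole space that are carried by \<open>X\<close>.
\<close>

definition finite_borel_measures_on :: "('x::metric_space) set \<Rightarrow> 'x measure set" where
  "finite_borel_measures_on X = {\<mu>. sets \<mu> = sets borel \<and> finite_measure \<mu> \<and> (AE x in \<mu>. x \<in> X)}"

definition relative_dimension_separable :: "('x::metric_space) set \<Rightarrow> 'x measure set \<Rightarrow> bool" where
  "relative_dimension_separable X M \<longleftrightarrow>
     M \<subseteq> finite_borel_measures_on X \<and>
     (\<exists>N. countable N \<and> N \<subseteq> finite_borel_measures_on X \<and>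
        (\<forall>\<mu>\<in>M. \<forall>\<epsilon>>0. \<exists>\<nu>\<in>N. relative_dim \<mu> \<nu> < ereal \<epsilon>))"


section \<open>Orthogonal projections and the Grassmannian\<close>

definition orth_proj :: "('v::euclidean_space) set \<Rightarrow> 'v \<Rightarrow> 'v" where
  "orth_proj V x = (THE y. y \<in> V \<and> (\<forall>v\<in>V. (x - y) \<bullet> v = 0))"

definition Grassmannian :: "nat \<Rightarrow> ('v::euclidean_space) set set" where
  "Grassmannian d = {V. subspace V \<and> dim V = d}"

text \<open>
  The topology of the Grassmannian is that of the metric \<open>\<parallel>P\<^sub>V - P\<^sub>W\<parallel>\<close> (operator norm), so its Borel
  sets are the preimages of Borel sets under the embedding \<open>V \<mapsto> P\<^sub>V\<close>.
\<close>

definition Grassmannian_borel :: "nat \<Rightarrow> ('v::euclidean_space) set measure" where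
  "Grassmannian_borel d = vimage_algebra (Grassmannian d) (\<lambda>V. Blinfun (orth_proj V)) borel"

text \<open>The measure \<open>\<gamma>\<close> is the orthogonally invariant Borel probability measure on the
  Grassmannian (there is exactly one if \<open>d\<close> is at most the dimension of the space).\<close>

definition Grassmannian_invariant_measure ::
    "nat \<Rightarrow> ('v::euclidean_space) set measure \<Rightarrow> bool" where
  "Grassmannian_invariant_measure d \<gamma> \<longleftrightarrow>
     sets \<gamma> = sets (Grassmannian_borel d) \<and> prob_space \<gamma> \<and>
     (\<forall>T. orthogonal_transformation T \<longrightarrow> distr \<gamma> \<gamma> (\<lambda>V. T ` V) = \<gamma>)"

end

theory Submission
  imports Defs
begin

text \<open>
  Approximate potentials by elements of a countable set and fix one Gibbs measure for each of these,
  if there is one. Every Gibbs measure \<open>\<mu>\<close> then has a partner \<open>\<nu>\<close> in a countable family such that the masses of every cylinder of length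
  \<open>n\<close> differ at most by a factor \<open>C * b ^ n\<close>, with \<open>b > 1\<close> as close to 1 as desired. Cylinders of length
  about \<open>log (1 / r)\<close> have diameter below \<open>r\<close>, so the projected measures satisfy
  \<open>\<mu> (B(x, r)) \<le> r powr -\<epsilon> * \<nu> (B(x, 2 * r))\<close> up to a constant and vice versa, without any separation
  condition. As \<open>\<mu> (B(x, 2 * r)) \<le> r powr -\<epsilon> * \<mu> (B(x, r))\<close> for small \<open>r\<close> and \<open>\<mu>\<close>-almost every \<open>x\<close>, this
  yields relative dimension separability.

  For a single measure \<open>\<nu>\<close> the average over \<open>V\<close> of \<open>\<integral>\<^bsub>A\<^esub> \<nu> {y. |P\<^sub>V (x - y)| < r} d\<nu>(x)\<close> is at most a constant times
  \<open>r powr t\<close>, if \<open>t < d\<close> and \<open>\<nu> (B(x, r')) \<le> K * r' powr t\<close> for \<open>x \<in> A\<close> and \<open>r' \<ge> r\<close>. Hence almost every \<open>V\<close> is good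
  for all \<open>\<nu>\<close> in the countable family and all rational parameters at once. The measures \<open>\<mu>\<close> and \<open>\<nu>\<close> may
  be mutually singular, but these integrals at scale \<open>r\<close> only see cylinders of length about
  \<open>log (1 / r)\<close>, so the bounds carry over from \<open>\<nu>\<close> to \<open>\<mu>\<close> with a small loss in the exponent. The lower
  local dimension of \<open>\<mu>\<close> is constant almost everywhere by ergodicity.
\<close>

section \<open>Cylinders and Gibbs measures\<close>

text \<open>Dimension is handled through \<open>frost \<nu> a x\<close>, a power bound at dyadic
  radii where \<open>a = 2 powr - u\<close> stands for the exponent \<open>u\<close>; small losses
  in the exponent become factors \<open>b > 1\<close> in the base. The obstacle is the order of
  quantifiers: \<open>V\<close> is fixed before \<mu>, and there are uncountably many \<mu>. A bound
  at all scales cannot be passed from \<mu> to \<nu>, since \<nu> may give no mass to the points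
  where \<mu> satisfies it. What passes is a bound with fixed constant on scales down to
  \<open>(1/2) ^ m\<close>, for all points within about \<open>(1/2) ^ m\<close> of a good one.
  Hence \<open>frost_upto\<close> is truncated and the comparison \<open>scale_dominated\<close> is
  blurred. The upper bounds for projections hold for every \<open>V\<close>: the projection is
  1-Lipschitz, so it does not raise the lower local dimension, and a finite measure on a bounded
  part of a d-dimensional subspace has lower local dimension at most d almost everywhere, by
  counting grid cells. Ergodicity acts one exponent at a time: \<open>frost\<close> holds almost
  everywhere or almost nowhere, and the dimension is the supremum of the exponents of the first
  kind.\<close>

lemma self_in_cylinder [simp]: "\<omega> \<in> cylinder \<omega> n"
  by (simp add: cylinder_def)

lemma cylinder_eq: "\<tau> \<in> cylinder \<omega> n \<Longrightarrow> cylinder \<tau> n = cylinder \<omega> n"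
  by (auto simp: cylinder_def)

lemma cylinder_antimono: "m \<le> n \<Longrightarrow> cylinder \<omega> n \<subseteq> cylinder \<omega> m"
  by (auto simp: cylinder_def)

lemma finite_cylinders: "finite (range (\<lambda>\<omega> :: nat \<Rightarrow> 'a::finite. cylinder \<omega> n))"
proof -
  have "range (\<lambda>\<omega> :: nat \<Rightarrow> 'a. cylinder \<omega> n)
      \<subseteq> (\<lambda>w. {\<tau>. map \<tau> [0..<n] = w}) ` {w. set w \<subseteq> UNIV \<and> length w = n}"
  proof (intro subsetI, elim rangeE)
    fix Q and \<omega> :: "nat \<Rightarrow> 'a" assume Q: "Q = cylinder \<omega> n"
    have "Q = {\<tau>. map \<tau> [0..<n] = map \<omega> [0..<n]}"
      by (auto simp: Q cylinder_def)
    then show "Q \<in> (\<lambda>w. {\<tau>. map \<tau> [0..<n] = w}) ` {w. set w \<subseteq> UNIV \<and> length w = n}"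
      by (rule image_eqI[of _ _ "map \<omega> [0..<n]"]) simp
  qed
  moreover have "finite {w :: 'a list. set w \<subseteq> UNIV \<and> length w = n}"
    by (rule finite_lists_length_eq) simp
  ultimately show ?thesis
    by (meson finite_imageI finite_subset)
qed

lemma space_seq_space [simp]: "space seq_space = UNIV"
  by (simp add: seq_space_def space_PiM)

lemma seq_space_component [measurable]:
  "(\<lambda>\<omega> :: nat \<Rightarrow> 'a::finite. \<omega> k) \<in> measurable seq_space (count_space UNIV)"
  unfolding seq_space_def by measurable

lemma shift_measurable [measurable]:
  "(shift :: (nat \<Rightarrow> 'a::finite) \<Rightarrow> _) \<in> measurable seq_space seq_space"
  unfolding seq_space_def shift_def by (rule measurable_PiM_single') auto

lemma cylinder_in_sets [measurable]: "cylinder (\<omega> :: nat \<Rightarrow> 'a::finite) n \<in> sets seq_space"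
proof -
  have "cylinder \<omega> n = {\<tau> \<in> space seq_space. \<forall>k\<in>{..<n}. \<tau> k = \<omega> k}"
    by (auto simp: cylinder_def)
  also have "\<dots> \<in> sets seq_space"
    by measurable
  finally show ?thesis .
qed

text \<open>Each level has finitely many cylinders, so the union of all cylinders inside
  \<open>U\<close> is a countable one. This is measurability of open sets in the product
  topology.\<close>

lemma cylinder_open_in_sets:
  fixes U :: "(nat \<Rightarrow> 'a::finite) set"
  assumes "\<And>\<omega>. \<omega> \<in> U \<Longrightarrow> \<exists>n. cylinder \<omega> n \<subseteq> U"
  shows "U \<in> sets seq_space"
proof -
  have "U = (\<Union>n. \<Union>{Q \<in> range (\<lambda>\<omega>. cylinder \<omega> n). Q \<subseteq> U})"
    using assms by fastforce
  also have "\<dots> \<in> sets seq_space"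
    by (intro sets.countable_UN' sets.finite_Union) (auto simp: finite_cylinders)
  finally show ?thesis .
qed

lemma nn_integral_cylinder_constant:
  fixes \<mu> :: "(nat \<Rightarrow> 'a::finite) measure" and S :: "(nat \<Rightarrow> 'a) set \<Rightarrow> ennreal"
  assumes "sets \<mu> = sets seq_space"
  shows "(\<integral>\<^sup>+\<omega>. S (cylinder \<omega> n) \<partial>\<mu>) = (\<Sum>Q\<in>range (\<lambda>\<omega>. cylinder \<omega> n). S Q * emeasure \<mu> Q)"
proof -
  let ?P = "range (\<lambda>\<omega> :: nat \<Rightarrow> 'a. cylinder \<omega> n)"
  have "S (cylinder \<omega> n) = (\<Sum>Q\<in>?P. S Q * indicator Q \<omega>)" for \<omega>
  proof -
    have "(\<Sum>Q\<in>?P. S Q * indicator Q \<omega>) = (\<Sum>Q\<in>?P. if Q = cylinder \<omega> n then S Q else 0)"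
      by (rule sum.cong) (auto simp: indicator_def dest: cylinder_eq)
    then show ?thesis
      by (simp add: finite_cylinders)
  qed
  then have "(\<integral>\<^sup>+\<omega>. S (cylinder \<omega> n) \<partial>\<mu>) = (\<integral>\<^sup>+\<omega>. (\<Sum>Q\<in>?P. S Q * indicator Q \<omega>) \<partial>\<mu>)"
    by simp
  also have "\<dots> = (\<Sum>Q\<in>?P. \<integral>\<^sup>+\<omega>. S Q * indicator Q \<omega> \<partial>\<mu>)"
    by (rule nn_integral_sum) (use assms in auto)
  also have "\<dots> = (\<Sum>Q\<in>?P. S Q * emeasure \<mu> Q)"
  proof (rule sum.cong[OF refl])
    fix Q assume "Q \<in> ?P"
    then have "Q \<in> sets \<mu>"
      using assms cylinder_in_sets by blast
    then show "(\<integral>\<^sup>+\<omega>. S Q * indicator Q \<omega> \<partial>\<mu>) = S Q * emeasure \<mu> Q"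
      by (rule nn_integral_cmult_indicator)
  qed
  finally show ?thesis .
qed

text \<open>The supremum of \<open>h\<close> over a cylinder lies between \<open>h\<close> and
  \<open>h'\<close> and is constant on cylinders, so its integral is a finite sum of weighted
  cylinder masses that can be compared term by term.\<close>

lemma nn_integral_cylinder_le:
  fixes \<mu> \<nu> :: "(nat \<Rightarrow> 'a::finite) measure" and h h' :: "(nat \<Rightarrow> 'a) \<Rightarrow> ennreal"
  assumes \<mu>: "sets \<mu> = sets seq_space"
    and \<nu>: "sets \<nu> = sets seq_space"
    and le: "\<And>\<omega>. emeasure \<mu> (cylinder \<omega> n) \<le> c * emeasure \<nu> (cylinder \<omega> n)"
    and h: "\<And>\<omega> \<tau>. \<tau> \<in> cylinder \<omega> n \<Longrightarrow> h \<omega> \<le> h' \<tau>"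
  shows "(\<integral>\<^sup>+\<omega>. h \<omega> \<partial>\<mu>) \<le> c * (\<integral>\<^sup>+\<omega>. h' \<omega> \<partial>\<nu>)"
proof -
  let ?P = "range (\<lambda>\<omega> :: nat \<Rightarrow> 'a. cylinder \<omega> n)"
  let ?S = "\<lambda>Q. SUP \<tau>\<in>Q. h \<tau>"
  have "(\<integral>\<^sup>+\<omega>. h \<omega> \<partial>\<mu>) \<le> (\<integral>\<^sup>+\<omega>. ?S (cylinder \<omega> n) \<partial>\<mu>)"
    by (intro nn_integral_mono SUP_upper) auto
  also have "\<dots> = (\<Sum>Q\<in>?P. ?S Q * emeasure \<mu> Q)"
    by (rule nn_integral_cylinder_constant[OF \<mu>])
  also have "\<dots> \<le> (\<Sum>Q\<in>?P. ?S Q * (c * emeasure \<nu> Q))"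
    by (intro sum_mono mult_left_mono) (use le in auto)
  also have "\<dots> = c * (\<Sum>Q\<in>?P. ?S Q * emeasure \<nu> Q)"
    by (simp add: sum_distrib_left mult_ac)
  also have "(\<Sum>Q\<in>?P. ?S Q * emeasure \<nu> Q) = (\<integral>\<^sup>+\<omega>. ?S (cylinder \<omega> n) \<partial>\<nu>)"
    by (rule nn_integral_cylinder_constant[OF \<nu>, symmetric])
  also have "c * \<dots> \<le> c * (\<integral>\<^sup>+\<omega>. h' \<omega> \<partial>\<nu>)"
  proof (intro mult_left_mono nn_integral_mono SUP_least)
    fix \<omega> \<tau> :: "nat \<Rightarrow> 'a" assume "\<tau> \<in> cylinder \<omega> n"
    then show "h \<tau> \<le> h' \<omega>"
      using h[of \<omega> \<tau>] cylinder_eq[of \<tau> \<omega> n] self_in_cylinder[of \<omega> n] by simp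
  qed auto
  finally show ?thesis .
qed

lemma emeasure_cylinder_le:
  fixes \<mu> \<nu> :: "(nat \<Rightarrow> 'a::finite) measure"
  assumes \<mu>: "sets \<mu> = sets seq_space"
    and \<nu>: "sets \<nu> = sets seq_space"
    and le: "\<And>\<omega>. emeasure \<mu> (cylinder \<omega> n) \<le> c * emeasure \<nu> (cylinder \<omega> n)"
    and A: "A \<in> sets seq_space" "A' \<in> sets seq_space" "\<And>\<omega>. \<omega> \<in> A \<Longrightarrow> cylinder \<omega> n \<subseteq> A'"
  shows "emeasure \<mu> A \<le> c * emeasure \<nu> A'"
proof -
  have "(\<integral>\<^sup>+\<omega>. indicator A \<omega> \<partial>\<mu>) \<le> c * (\<integral>\<^sup>+\<omega>. indicator A' \<omega> \<partial>\<nu>)"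
    by (rule nn_integral_cylinder_le[OF \<mu> \<nu> le]) (use A(3) in \<open>auto simp: indicator_def\<close>)
  then show ?thesis
    using A(1,2) \<mu> \<nu> by simp
qed

text \<open>Here \<open>c\<close> does not depend on \<open>n\<close>, so no blurring remains:
  exhaust \<open>A\<close> from inside by unions of cylinders of length \<open>n\<close> and let
  \<open>n\<close> grow.\<close>

lemma emeasure_cylinder_open_le:
  fixes \<mu> \<nu> :: "(nat \<Rightarrow> 'a::finite) measure"
  assumes \<mu>: "sets \<mu> = sets seq_space"
    and \<nu>: "sets \<nu> = sets seq_space"
    and le: "\<And>\<omega> n. emeasure \<mu> (cylinder \<omega> n) \<le> c * emeasure \<nu> (cylinder \<omega> n)"
    and A: "\<And>\<omega>. \<omega> \<in> A \<Longrightarrow> \<exists>n. cylinder \<omega> n \<subseteq> A"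
  shows "emeasure \<mu> A \<le> c * emeasure \<nu> A"
proof -
  define B where "B n = {\<omega>. cylinder \<omega> n \<subseteq> A}" for n
  have B: "B n \<in> sets seq_space" for n
    by (rule cylinder_open_in_sets) (use cylinder_eq in \<open>fastforce simp: B_def\<close>)
  have A': "A \<in> sets seq_space"
    by (rule cylinder_open_in_sets[OF A])
  have "A = (\<Union>n. B n)"
    using A self_in_cylinder by (fastforce simp: B_def)
  moreover have "incseq B"
    using cylinder_antimono by (fastforce simp: incseq_def B_def)
  ultimately have "emeasure \<mu> A = (SUP n. emeasure \<mu> (B n))"
    using SUP_emeasure_incseq[of B \<mu>] B \<mu> by (metis image_subset_iff)
  also have "\<dots> \<le> c * emeasure \<nu> A"
  proof (rule SUP_least)
    fix n
    show "emeasure \<mu> (B n) \<le> c * emeasure \<nu> A"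
      by (rule emeasure_cylinder_le[OF \<mu> \<nu> le B A']) (auto simp: B_def)
  qed
  finally show ?thesis .
qed

section \<open>Gibbs measures: comparison on cylinders, separability, consequences of
  ergodicity\<close>

definition gibbs_class :: "(nat \<Rightarrow> 'a::finite) measure set" where
  "gibbs_class = {\<mu>. \<exists>\<phi>. holder_potential \<phi> \<and> gibbs_measure \<phi> \<mu>}"

lemma gibbs_classD:
  assumes "\<mu> \<in> gibbs_class"
  shows "sets \<mu> = sets seq_space" "prob_space \<mu>" "distr \<mu> \<mu> shift = \<mu>"
    "B \<in> sets \<mu> \<Longrightarrow> shift -` B = B \<Longrightarrow> measure \<mu> B = 0 \<or> measure \<mu> B = 1"
  using assms by (auto simp: gibbs_class_def gibbs_measure_def)

text \<open>Uniform continuity on the sequence space, with cylinders in place of small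
  distances.\<close>

definition uniform_potential :: "((nat \<Rightarrow> 'a) \<Rightarrow> real) \<Rightarrow> bool" where
  "uniform_potential \<psi> \<longleftrightarrow> (\<forall>\<epsilon>>0. \<exists>m. \<forall>\<omega> \<tau>. \<tau> \<in> cylinder \<omega> m \<longrightarrow> \<bar>\<psi> \<omega> - \<psi> \<tau>\<bar> \<le> \<epsilon>)"

definition birkhoff_sum :: "((nat \<Rightarrow> 'a) \<Rightarrow> real) \<Rightarrow> nat \<Rightarrow> (nat \<Rightarrow> 'a) \<Rightarrow> real" where
  "birkhoff_sum \<psi> n \<omega> = (\<Sum>k<n. \<psi> ((shift ^^ k) \<omega>))"

text \<open>The Gibbs inequality with the pressure absorbed into the potential: \<psi> stands for
  \<open>\<phi> - P\<close>.\<close>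

definition gibbs_bound :: "(nat \<Rightarrow> 'a) measure \<Rightarrow> ((nat \<Rightarrow> 'a) \<Rightarrow> real) \<Rightarrow> real \<Rightarrow> bool" where
  "gibbs_bound \<mu> \<psi> C \<longleftrightarrow> 1 \<le> C \<and> (\<forall>\<omega> n.
     measure \<mu> (cylinder \<omega> n) \<le> C * exp (birkhoff_sum \<psi> n \<omega>) \<and>
     exp (birkhoff_sum \<psi> n \<omega>) \<le> C * measure \<mu> (cylinder \<omega> n))"

lemma holder_potential_uniform:
  fixes \<phi> :: "(nat \<Rightarrow> 'a::finite) \<Rightarrow> real"
  assumes "holder_potential \<phi>"
  shows "uniform_potential \<phi>"
  unfolding uniform_potential_def
proof (intro allI impI)
  fix \<epsilon> :: real assume "\<epsilon> > 0"
  obtain \<gamma> \<alpha> C where \<gamma>: "0 < \<gamma>" "\<gamma> < 1" "0 < \<alpha>"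
    and C: "\<And>\<omega> \<tau>. \<bar>\<phi> \<omega> - \<phi> \<tau>\<bar> \<le> C * seq_dist \<gamma> \<omega> \<tau> powr \<alpha>"
    using assms unfolding holder_potential_def by blast
  have "\<gamma> powr \<alpha> < 1"
    using powr_less_mono2[of \<alpha> \<gamma> 1] \<gamma> by simp
  then have "(\<lambda>m. \<bar>C\<bar> * (\<gamma> powr \<alpha>) ^ m) \<longlonglongrightarrow> \<bar>C\<bar> * 0"
    using \<gamma> by (intro tendsto_mult tendsto_const LIMSEQ_realpow_zero) auto
  then have "\<forall>\<^sub>F m in sequentially. \<bar>C\<bar> * (\<gamma> powr \<alpha>) ^ m < \<epsilon>"
    using \<open>\<epsilon> > 0\<close> by (intro order_tendstoD) auto
  then obtain m where m: "\<bar>C\<bar> * (\<gamma> powr \<alpha>) ^ m < \<epsilon>"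
    by (auto simp: eventually_sequentially)
  show "\<exists>m. \<forall>\<omega> \<tau>. \<tau> \<in> cylinder \<omega> m \<longrightarrow> \<bar>\<phi> \<omega> - \<phi> \<tau>\<bar> \<le> \<epsilon>"
  proof (intro exI allI impI)
    fix \<omega> \<tau> :: "nat \<Rightarrow> 'a" assume \<tau>: "\<tau> \<in> cylinder \<omega> m"
    have "seq_dist \<gamma> \<omega> \<tau> \<le> \<gamma> ^ m"
    proof (cases "\<omega> = \<tau>")
      case False
      then have "\<exists>k. \<omega> k \<noteq> \<tau> k" by auto
      then have "\<omega> (LEAST k. \<omega> k \<noteq> \<tau> k) \<noteq> \<tau> (LEAST k. \<omega> k \<noteq> \<tau> k)"
        by (rule LeastI_ex)
      then have "m \<le> (LEAST k. \<omega> k \<noteq> \<tau> k)"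
        using \<tau> by (intro leI notI) (auto simp: cylinder_def)
      then show ?thesis
        using False \<gamma> by (simp add: seq_dist_def power_decreasing)
    qed (use \<gamma> in \<open>simp add: seq_dist_def\<close>)
    moreover have "0 \<le> seq_dist \<gamma> \<omega> \<tau>"
      using \<gamma> by (simp add: seq_dist_def)
    ultimately have "seq_dist \<gamma> \<omega> \<tau> powr \<alpha> \<le> (\<gamma> ^ m) powr \<alpha>"
      using \<gamma> by (intro powr_mono2) auto
    also have "\<dots> = (\<gamma> powr \<alpha>) ^ m"
      using \<gamma> by (simp add: powr_powr mult.commute flip: powr_realpow)
    finally have "\<bar>C\<bar> * seq_dist \<gamma> \<omega> \<tau> powr \<alpha> \<le> \<bar>C\<bar> * (\<gamma> powr \<alpha>) ^ m"
      by (intro mult_left_mono) auto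
    moreover have "C * seq_dist \<gamma> \<omega> \<tau> powr \<alpha> \<le> \<bar>C\<bar> * seq_dist \<gamma> \<omega> \<tau> powr \<alpha>"
      by (intro mult_right_mono) auto
    ultimately show "\<bar>\<phi> \<omega> - \<phi> \<tau>\<bar> \<le> \<epsilon>"
      using C[of \<omega> \<tau>] m by linarith
  qed
qed

lemma gibbs_class_bound:
  assumes "\<mu> \<in> gibbs_class"
  shows "\<exists>\<psi> C. uniform_potential \<psi> \<and> gibbs_bound \<mu> \<psi> C"
proof -
  obtain \<phi> where \<phi>: "holder_potential \<phi>" "gibbs_measure \<phi> \<mu>"
    using assms by (auto simp: gibbs_class_def)
  let ?q = "\<lambda>P \<omega> n. measure \<mu> (cylinder \<omega> n) /
    exp (- P * real n + (\<Sum>k<n. \<phi> ((shift ^^ k) \<omega>)))"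
  have "\<exists>P C. 1 \<le> C \<and> (\<forall>\<omega> n. inverse C \<le> ?q P \<omega> n \<and> ?q P \<omega> n \<le> C)"
    using \<phi>(2) unfolding gibbs_measure_def Let_def by (elim conjE)
  then obtain P C where C: "1 \<le> C" and q: "\<And>\<omega> n. inverse C \<le> ?q P \<omega> n \<and> ?q P \<omega> n \<le> C"
    by auto
  have s: "- P * real n + (\<Sum>k<n. \<phi> ((shift ^^ k) \<omega>)) = (\<Sum>k<n. \<phi> ((shift ^^ k) \<omega>) - P)" for n \<omega>
    by (simp add: sum_subtractf)
  have "uniform_potential (\<lambda>\<omega>. \<phi> \<omega> - P)"
    using holder_potential_uniform[OF \<phi>(1)] by (simp add: uniform_potential_def)
  moreover have "gibbs_bound \<mu> (\<lambda>\<omega>. \<phi> \<omega> - P) C"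
    using q C unfolding gibbs_bound_def birkhoff_sum_def s by (simp add: field_simps)
  ultimately show ?thesis by blast
qed

lemma gibbs_class_full_support:
  assumes "\<mu> \<in> gibbs_class"
  shows "measure \<mu> (cylinder \<omega> n) > 0"
proof -
  obtain \<psi> C where "gibbs_bound \<mu> \<psi> C"
    using gibbs_class_bound[OF assms] by blast
  then have "1 \<le> C" "exp (birkhoff_sum \<psi> n \<omega>) \<le> C * measure \<mu> (cylinder \<omega> n)"
    by (auto simp: gibbs_bound_def)
  then have "0 < C * measure \<mu> (cylinder \<omega> n)"
    using exp_gt_zero less_le_trans by blast
  with \<open>1 \<le> C\<close> show ?thesis
    by (simp add: zero_less_mult_iff)
qed

definition cylinder_comparable :: "real \<Rightarrow> (nat \<Rightarrow> 'a) measure \<Rightarrow> (nat \<Rightarrow> 'a) measure \<Rightarrow> bool" where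
  "cylinder_comparable b \<mu> \<nu> \<longleftrightarrow> (\<exists>C>0. \<forall>\<omega> n.
     measure \<mu> (cylinder \<omega> n) \<le> C * b ^ n * measure \<nu> (cylinder \<omega> n) \<and>
     measure \<nu> (cylinder \<omega> n) \<le> C * b ^ n * measure \<mu> (cylinder \<omega> n))"

text \<open>An error of \<open>ln b\<close> per step adds up to \<open>n * ln b\<close> along an
  orbit segment of length \<open>n\<close>, that is, to a factor \<open>b ^ n\<close>.\<close>

lemma gibbs_bound_le:
  assumes "gibbs_bound \<mu> \<psi> C" "gibbs_bound \<nu> \<psi>' C'" "\<And>\<omega>. \<bar>\<psi> \<omega> - \<psi>' \<omega>\<bar> \<le> ln b" "b > 0"
  shows "measure \<mu> (cylinder \<omega> n) \<le> (C * C') * b ^ n * measure \<nu> (cylinder \<omega> n)"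
proof -
  let ?S = "\<lambda>\<psi>. birkhoff_sum \<psi> n \<omega>"
  have C: "C \<ge> 1" "C' \<ge> 1"
    using assms by (auto simp: gibbs_bound_def)
  have "?S \<psi> \<le> (\<Sum>k<n. ln b + \<psi>' ((shift ^^ k) \<omega>))"
  unfolding birkhoff_sum_def
  proof (rule sum_mono)
    fix k
    show "\<psi> ((shift ^^ k) \<omega>) \<le> ln b + \<psi>' ((shift ^^ k) \<omega>)"
      using assms(3)[of "(shift ^^ k) \<omega>"] by linarith
  qed
  also have "\<dots> = n * ln b + ?S \<psi>'"
    by (simp add: birkhoff_sum_def sum.distrib)
  finally have "exp (?S \<psi>) \<le> exp (n * ln b) * exp (?S \<psi>')"
    by (simp flip: exp_add)
  also have "exp (n * ln b) = b ^ n"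
    using \<open>b > 0\<close> by (simp add: exp_of_nat_mult)
  finally have *: "exp (?S \<psi>) \<le> b ^ n * exp (?S \<psi>')" .
  have "measure \<mu> (cylinder \<omega> n) \<le> C * exp (?S \<psi>)"
    using assms(1) by (simp add: gibbs_bound_def)
  also have "\<dots> \<le> C * (b ^ n * exp (?S \<psi>'))"
    using * C by (intro mult_left_mono) auto
  also have "\<dots> \<le> C * (b ^ n * (C' * measure \<nu> (cylinder \<omega> n)))"
    using assms(2,4) C by (intro mult_left_mono) (auto simp: gibbs_bound_def)
  finally show ?thesis
    by (simp add: mult_ac)
qed

text \<open>Potentials are encoded up to an error \<open>3 / k\<close> by the finite set of pairs consisting of a word
  \<open>w\<close> and the integer part of \<open>k\<close> times the value at an extension of \<open>w\<close>.\<close>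

lemma gibbs_class_separable:
  "\<exists>N \<subseteq> (gibbs_class :: (nat \<Rightarrow> 'a::finite) measure set). countable N \<and>
     (\<forall>\<mu>\<in>gibbs_class. \<forall>b>1. \<exists>\<nu>\<in>N. cylinder_comparable b \<mu> \<nu>)"
proof -
  let ?G = "gibbs_class :: (nat \<Rightarrow> 'a) measure set"
  have "\<forall>\<mu>\<in>?G. \<exists>\<psi>. uniform_potential \<psi> \<and> (\<exists>C. gibbs_bound \<mu> \<psi> C)"
    using gibbs_class_bound by blast
  then obtain \<psi> where \<psi>: "\<And>\<mu>. \<mu> \<in> ?G \<Longrightarrow> uniform_potential (\<psi> \<mu>)"
      "\<And>\<mu>. \<mu> \<in> ?G \<Longrightarrow> \<exists>C. gibbs_bound \<mu> (\<psi> \<mu>) C"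
    by metis
  have "\<forall>\<mu>\<in>?G. \<forall>k. \<exists>m. \<forall>\<omega> \<tau>. \<tau> \<in> cylinder \<omega> m \<longrightarrow> \<bar>\<psi> \<mu> \<omega> - \<psi> \<mu> \<tau>\<bar> \<le> 1 / real (Suc k)"
    using \<psi>(1) unfolding uniform_potential_def by simp
  then obtain m where m: "\<And>\<mu> k \<omega> \<tau>. \<mu> \<in> ?G \<Longrightarrow> \<tau> \<in> cylinder \<omega> (m \<mu> k) \<Longrightarrow>
      \<bar>\<psi> \<mu> \<omega> - \<psi> \<mu> \<tau>\<bar> \<le> 1 / real (Suc k)"
    by metis
  \<comment> \<open>Any fixed continuation would do: \<open>ext w\<close> is a sample point in the
    cylinder of the word \<open>w\<close>.\<close>
  define ext :: "'a list \<Rightarrow> nat \<Rightarrow> 'a" where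
    "ext w = (\<lambda>i. if i < length w then w ! i else undefined)" for w
  \<comment> \<open>All words in the code have length \<open>m \<mu> k\<close>, so the code
    determines this length. Measures with equal codes therefore have potentials of small oscillation
    on the same cylinders.\<close>
  define code where "code k \<mu> = (\<lambda>w. (w, \<lfloor>real (Suc k) * \<psi> \<mu> (ext w)\<rfloor>)) ` {w. length w = m \<mu> k}"
    for k \<mu>
  have "finite (code k \<mu>)" for k \<mu>
    using finite_lists_length_eq[of "UNIV :: 'a set"] by (simp add: code_def)
  then have "code k ` ?G \<subseteq> {A. finite A}" for k
    by auto
  then have cnt: "countable (code k ` ?G)" for k
    using countable_subset countable_Collect_finite by blast
  define N where "N = (\<Union>k. inv_into ?G (code k) ` (code k ` ?G))"
  have "countable N"
    unfolding N_def using cnt by auto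
  moreover have "N \<subseteq> ?G"
    unfolding N_def by (auto intro: inv_into_into)
  moreover have "\<exists>\<nu>\<in>N. cylinder_comparable b \<mu> \<nu>" if \<mu>: "\<mu> \<in> ?G" and b: "b > 1" for \<mu> b
  proof -
    have "ln b > 0" using b by simp
    then have "3 / ln b > 0" by simp
    obtain k :: nat where "3 / ln b < real k"
      using reals_Archimedean2 by blast
    \<comment> \<open>Three errors of size \<open>1 / Suc k\<close> will add up: two oscillations
      within a cylinder and one from rounding.\<close>
    then have k: "3 / real (Suc k) \<le> ln b"
      using \<open>ln b > 0\<close> by (simp add: field_simps)
    define \<nu> where "\<nu> = inv_into ?G (code k) (code k \<mu>)"
    have \<nu>N: "\<nu> \<in> N"
      using \<mu> by (auto simp: N_def \<nu>_def)
    then have \<nu>: "\<nu> \<in> ?G"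
      using \<open>N \<subseteq> ?G\<close> by auto
    have eq: "code k \<nu> = code k \<mu>"
      unfolding \<nu>_def using \<mu> by (intro f_inv_into_f) auto
    have close: "\<bar>\<psi> \<mu> \<omega> - \<psi> \<nu> \<omega>\<bar> \<le> ln b" for \<omega>
    proof -
      define w where "w = map \<omega> [0..<m \<mu> k]"
      have "(w, \<lfloor>real (Suc k) * \<psi> \<mu> (ext w)\<rfloor>) \<in> code k \<nu>"
        unfolding eq by (auto simp: code_def w_def)
      then have fl: "\<lfloor>real (Suc k) * \<psi> \<mu> (ext w)\<rfloor> = \<lfloor>real (Suc k) * \<psi> \<nu> (ext w)\<rfloor>"
        and len: "m \<nu> k = m \<mu> k"
        by (auto simp: code_def w_def)
      have "\<bar>real (Suc k) * \<psi> \<mu> (ext w) - real (Suc k) * \<psi> \<nu> (ext w)\<bar> \<le> 1"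
        using fl by linarith
      then have "real (Suc k) * \<bar>\<psi> \<mu> (ext w) - \<psi> \<nu> (ext w)\<bar> \<le> 1"
        by (simp add: abs_mult flip: right_diff_distrib)
      then have "\<bar>\<psi> \<mu> (ext w) - \<psi> \<nu> (ext w)\<bar> \<le> 1 / real (Suc k)"
        by (simp add: field_simps)
      moreover have "ext w \<in> cylinder \<omega> (m \<mu> k)"
        by (auto simp: ext_def w_def cylinder_def)
      then have "\<bar>\<psi> \<mu> \<omega> - \<psi> \<mu> (ext w)\<bar> \<le> 1 / real (Suc k)"
          "\<bar>\<psi> \<nu> \<omega> - \<psi> \<nu> (ext w)\<bar> \<le> 1 / real (Suc k)"
        using m[OF \<mu>, of "ext w" \<omega> k] m[OF \<nu>, of "ext w" \<omega> k] len by auto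
      moreover have "3 / real (Suc k) = 1 / real (Suc k) + 1 / real (Suc k) + 1 / real (Suc k)"
        by simp
      ultimately show ?thesis
        using k by linarith
    qed
    obtain C C' where C: "gibbs_bound \<mu> (\<psi> \<mu>) C" "gibbs_bound \<nu> (\<psi> \<nu>) C'"
      using \<psi>(2) \<mu> \<nu> by meson
    then have "C * C' > 0"
      by (auto simp: gibbs_bound_def intro!: mult_pos_pos)
    moreover have "\<bar>\<psi> \<nu> \<omega> - \<psi> \<mu> \<omega>\<bar> \<le> ln b" for \<omega>
      using close[of \<omega>] by linarith
    ultimately have "cylinder_comparable b \<mu> \<nu>"
      unfolding cylinder_comparable_def
      using gibbs_bound_le[OF C close] gibbs_bound_le[OF C(2) C(1)] b
      by (intro exI[of _ "C * C'"]) (auto simp: mult.commute)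
    with \<nu>N show ?thesis by blast
  qed
  ultimately show ?thesis by blast
qed

text \<open>For some length, the oscillation is at most 1 on each of the finitely many
  cylinders.\<close>

lemma uniform_potential_bounded:
  fixes \<psi> :: "(nat \<Rightarrow> 'a::finite) \<Rightarrow> real"
  assumes "uniform_potential \<psi>"
  shows "\<exists>B. \<forall>\<omega>. \<bar>\<psi> \<omega>\<bar> \<le> B"
proof -
  obtain m where m: "\<And>\<omega> \<tau>. \<tau> \<in> cylinder \<omega> m \<Longrightarrow> \<bar>\<psi> \<omega> - \<psi> \<tau>\<bar> \<le> 1"
    using assms unfolding uniform_potential_def by (meson zero_less_one)
  let ?P = "range (\<lambda>\<omega> :: nat \<Rightarrow> 'a. cylinder \<omega> m)"
  define r where "r Q = \<bar>\<psi> (SOME \<omega>. \<omega> \<in> Q)\<bar>" for Q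
  have "\<bar>\<psi> \<omega>\<bar> \<le> 1 + (\<Sum>Q\<in>?P. r Q)" for \<omega>
  proof -
    have "(SOME \<tau>. \<tau> \<in> cylinder \<omega> m) \<in> cylinder \<omega> m"
      by (rule someI[of _ \<omega>]) simp
    from m[OF this] have "\<bar>\<psi> \<omega>\<bar> \<le> 1 + r (cylinder \<omega> m)"
      unfolding r_def by linarith
    also have "r (cylinder \<omega> m) \<le> (\<Sum>Q\<in>?P. r Q)"
      by (rule member_le_sum) (auto simp: r_def finite_cylinders)
    finally show ?thesis by simp
  qed
  then show ?thesis by blast
qed

text \<open>Prefixing a symbol adds one bounded term to the Birkhoff sum, so the prefixed cylinder
  keeps at least a fixed proportion of the mass. Open sets inherit this because the constant is the
  same for all lengths. Later \<open>A\<close> is the preimage of a ball.\<close>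

lemma gibbs_class_prepend:
  fixes i :: "'a::finite"
  assumes \<mu>: "\<mu> \<in> gibbs_class"
  shows "\<exists>C>0. \<forall>A. (\<forall>\<omega>\<in>A. \<exists>n. cylinder \<omega> n \<subseteq> A) \<longrightarrow>
    measure \<mu> A \<le> C * measure \<mu> {\<omega>. \<omega> 0 = i \<and> shift \<omega> \<in> A}"
proof -
  interpret prob_space \<mu> using gibbs_classD[OF \<mu>] by simp
  note sets = gibbs_classD(1)[OF \<mu>]
  have [measurable_cong]: "sets \<mu> = sets seq_space" by (rule sets)
  obtain \<psi> C where \<psi>: "uniform_potential \<psi>" and C: "gibbs_bound \<mu> \<psi> C"
    using gibbs_class_bound[OF \<mu>] by blast
  obtain B where B: "\<And>\<omega>. \<bar>\<psi> \<omega>\<bar> \<le> B"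
    using uniform_potential_bounded[OF \<psi>] by blast
  define I where "I = {\<omega> :: nat \<Rightarrow> 'a. \<omega> 0 = i}"
  have I: "I \<in> sets seq_space"
  proof -
    have "I = {\<omega> \<in> space seq_space. \<omega> 0 = i}" by (auto simp: I_def)
    also have "\<dots> \<in> sets seq_space" by measurable
    finally show ?thesis .
  qed
  \<comment> \<open>The measure \<open>A \<mapsto> \<mu> (i A)\<close>, realised as a push-forward
    so that the comparison on open sets applies to it.\<close>
  define \<nu> where "\<nu> = distr (restrict_space \<mu> I) seq_space shift"
  have \<nu>: "emeasure \<nu> A = emeasure \<mu> {\<omega>. \<omega> 0 = i \<and> shift \<omega> \<in> A}" if "A \<in> sets seq_space" for A
  proof -
    have m: "shift \<in> measurable (restrict_space \<mu> I) seq_space"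
      by (rule measurable_restrict_space1) measurable
    have sp: "space (restrict_space \<mu> I) = I"
      using sets_eq_imp_space_eq[OF sets] by (simp add: space_restrict_space)
    have "emeasure \<nu> A = emeasure (restrict_space \<mu> I) (shift -` A \<inter> I)"
      unfolding \<nu>_def using that m sp by (simp add: emeasure_distr)
    also have "\<dots> = emeasure \<mu> (shift -` A \<inter> I)"
      using I sets by (intro emeasure_restrict_space) (auto simp: sets_eq_imp_space_eq[OF sets])
    also have "shift -` A \<inter> I = {\<omega>. \<omega> 0 = i \<and> shift \<omega> \<in> A}"
      by (auto simp: I_def)
    finally show ?thesis .
  qed
  define c where "c = C * C * exp B"
  have "C \<ge> 1" using C by (simp add: gibbs_bound_def)
  have "c > 0" using \<open>C \<ge> 1\<close> by (simp add: c_def)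
  have cyl: "emeasure \<mu> (cylinder \<tau> n) \<le> ennreal c * emeasure \<nu> (cylinder \<tau> n)" for \<tau> n
  proof -
    let ?\<tau> = "\<lambda>k. case k of 0 \<Rightarrow> i | Suc j \<Rightarrow> \<tau> j"
    have sh: "shift ?\<tau> = \<tau>" by (auto simp: shift_def)
    have eq: "{\<omega>. \<omega> 0 = i \<and> shift \<omega> \<in> cylinder \<tau> n} = cylinder ?\<tau> (Suc n)"
      by (auto simp: cylinder_def shift_def less_Suc_eq_0_disj split: nat.splits)
    have pw: "(shift ^^ Suc k) ?\<tau> = (shift ^^ k) \<tau>" for k
      by (simp only: funpow_Suc_right o_apply sh)
    have "birkhoff_sum \<psi> (Suc n) ?\<tau> = \<psi> ?\<tau> + birkhoff_sum \<psi> n \<tau>"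
      unfolding birkhoff_sum_def sum.lessThan_Suc_shift pw by simp
    then have "birkhoff_sum \<psi> n \<tau> \<le> B + birkhoff_sum \<psi> (Suc n) ?\<tau>"
      using B[of ?\<tau>] by linarith
    then have *: "exp (birkhoff_sum \<psi> n \<tau>) \<le> exp B * exp (birkhoff_sum \<psi> (Suc n) ?\<tau>)"
      by (simp only: exp_add[symmetric] exp_le_cancel_iff)
    have "measure \<mu> (cylinder \<tau> n) \<le> C * exp (birkhoff_sum \<psi> n \<tau>)"
      using C by (simp add: gibbs_bound_def)
    also have "\<dots> \<le> C * (exp B * exp (birkhoff_sum \<psi> (Suc n) ?\<tau>))"
      using * \<open>C \<ge> 1\<close> by (intro mult_left_mono) auto
    also have "\<dots> \<le> C * (exp B * (C * measure \<mu> (cylinder ?\<tau> (Suc n))))"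
      using C \<open>C \<ge> 1\<close> by (intro mult_left_mono) (auto simp: gibbs_bound_def)
    finally have "measure \<mu> (cylinder \<tau> n) \<le> c * measure \<mu> (cylinder ?\<tau> (Suc n))"
      by (simp add: c_def mult_ac)
    then show ?thesis
      using \<open>c > 0\<close> by (simp add: \<nu> eq emeasure_eq_measure flip: ennreal_mult')
  qed
  have "measure \<mu> A \<le> c * measure \<mu> {\<omega>. \<omega> 0 = i \<and> shift \<omega> \<in> A}"
    if A: "\<forall>\<omega>\<in>A. \<exists>n. cylinder \<omega> n \<subseteq> A" for A
  proof -
    have "emeasure \<mu> A \<le> ennreal c * emeasure \<nu> A"
      by (rule emeasure_cylinder_open_le[OF sets _ cyl]) (use A in \<open>auto simp: \<nu>_def\<close>)
    moreover have "A \<in> sets seq_space"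
      using A by (intro cylinder_open_in_sets) auto
    ultimately show ?thesis
      using \<open>c > 0\<close> by (simp add: \<nu> emeasure_eq_measure flip: ennreal_mult')
  qed
  with \<open>c > 0\<close> show ?thesis by blast
qed

text \<open>The preimages of \<open>A\<close> under the iterates of the shift increase and all have
  the measure of \<open>A\<close>. Their union is invariant, and ergodicity applies to it.\<close>

lemma gibbs_class_subinvariant:
  assumes \<mu>: "\<mu> \<in> gibbs_class" and A: "A \<in> sets seq_space" "A \<subseteq> shift -` A"
  shows "measure \<mu> A = 0 \<or> measure \<mu> A = 1"
proof -
  interpret prob_space \<mu> using gibbs_classD[OF \<mu>] by simp
  note sets = gibbs_classD(1)[OF \<mu>]
  have space: "space \<mu> = UNIV" using sets_eq_imp_space_eq[OF sets] by simp
  have sh: "shift \<in> measurable \<mu> \<mu>"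
    using shift_measurable measurable_cong_sets[OF sets sets] by blast
  define B where "B n = (shift ^^ n) -` A" for n
  have B: "B n \<in> sets \<mu> \<and> measure \<mu> (B n) = measure \<mu> A" for n
  proof (induction n)
    case (Suc n)
    have eq: "B (Suc n) = shift -` B n \<inter> space \<mu>"
      by (auto simp: B_def space funpow_swap1)
    have "measure \<mu> (B n) = measure (distr \<mu> \<mu> shift) (B n)"
      using gibbs_classD(3)[OF \<mu>] by simp
    also have "\<dots> = measure \<mu> (B (Suc n))"
      unfolding eq using Suc sh by (intro measure_distr) auto
    finally show ?case
      using Suc eq measurable_sets[OF sh] by auto
  qed (use A sets in \<open>simp add: B_def\<close>)
  have "incseq B"
  proof (rule incseq_SucI)
    show "B n \<subseteq> B (Suc n)" for n
      using A(2) by (auto simp: B_def)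
  qed
  then have "(\<lambda>n. measure \<mu> (B n)) \<longlonglongrightarrow> measure \<mu> (\<Union>n. B n)"
    using B by (intro finite_Lim_measure_incseq) auto
  then have "measure \<mu> (\<Union>n. B n) = measure \<mu> A"
    using B by (simp add: LIMSEQ_const_iff)
  moreover have "shift -` (\<Union>n. B n) = (\<Union>n. B n)"
  proof -
    have "shift -` (\<Union>n. B n) = (\<Union>n. B (Suc n))"
      by (auto simp: B_def funpow_swap1)
    also have "\<dots> = (\<Union>n. B n)"
      using \<open>incseq B\<close> by (auto simp: incseq_Suc_iff)
    finally show ?thesis .
  qed
  then have "measure \<mu> (\<Union>n. B n) = 0 \<or> measure \<mu> (\<Union>n. B n) = 1"
    using B by (intro gibbs_classD(4)[OF \<mu>]) auto
  ultimately show ?thesis by simp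
qed


section \<open>The coding map of a conformal IFS\<close>

text \<open>By compactness the norm of the derivative stays below some \<rho> < 1 on a neighbourhood
  of \<open>V0\<close>, which contains all balls of some radius \<delta> about points of
  \<open>V0\<close>. Balls are convex, so the mean value inequality applies to the extension
  \<open>g\<close> even where a segment leaves \<open>V0\<close>.\<close>

lemma conformal_map_locally_contracting:
  assumes V0: "compact V0" "V0 \<noteq> {}" and f: "conformal_map_on V0 f D"
    and D: "\<And>x. x \<in> V0 \<Longrightarrow> norm (D x) < 1"
  shows "\<exists>\<delta>>0. \<exists>\<rho>. 0 < \<rho> \<and> \<rho> < 1 \<and>
    (\<forall>x\<in>V0. \<forall>y\<in>V0. dist x y < \<delta> \<longrightarrow> dist (f x) (f y) \<le> \<rho> * dist x y)"
proof -
  obtain W g where W: "open W" "V0 \<subseteq> W" "C1_on W g"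
    and g: "\<And>x. x \<in> V0 \<Longrightarrow> g x = f x"
      "\<And>x. x \<in> V0 \<Longrightarrow> (g has_derivative blinfun_apply (D x)) (at x)"
    using f unfolding conformal_map_on_def C1_diffeomorphism_def by blast
  obtain D' where D': "\<And>x. x \<in> W \<Longrightarrow> (g has_derivative blinfun_apply (D' x)) (at x)"
    and cont: "continuous_on W D'"
    using W(3) unfolding C1_on_def by blast
  \<comment> \<open>\<open>D\<close> describes the differential on \<open>V0\<close>,
    \<open>D'\<close> is continuous on all of \<open>W\<close>; uniqueness of derivatives passes the
    bound below 1 to \<open>D'\<close>.\<close>
  have eq: "D' x = D x" if "x \<in> V0" for x
    using has_derivative_unique[OF D' g(2)] that W(2)
    by (auto simp: blinfun_apply_inject)
  have "compact ((\<lambda>x. norm (D' x)) ` V0)"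
    using cont W(2) V0 by (intro compact_continuous_image continuous_on_norm) (auto intro: continuous_on_subset)
  then obtain x0 where x0: "x0 \<in> V0" "\<And>x. x \<in> V0 \<Longrightarrow> norm (D' x) \<le> norm (D' x0)"
    using compact_attains_sup[of "(\<lambda>x. norm (D' x)) ` V0"] V0 by auto
  \<comment> \<open>Halfway between the maximum over \<open>V0\<close> and 1, which leaves room for
    an open neighbourhood.\<close>
  define \<rho> where "\<rho> = (1 + norm (D' x0)) / 2"
  have "norm (D' x0) < 1" using eq x0(1) D by simp
  then have \<rho>: "0 < \<rho>" "\<rho> < 1" "norm (D' x0) < \<rho>"
    using norm_ge_zero[of "D' x0"] by (simp_all add: \<rho>_def del: norm_ge_zero)
  define U where "U = {x \<in> W. norm (D' x) < \<rho>}"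
  have "open U"
  proof -
    have "U = (\<lambda>x. norm (D' x)) -` {..<\<rho>} \<inter> W" by (auto simp: U_def)
    then show ?thesis
      using continuous_on_open_vimage[OF W(1), of "\<lambda>x. norm (D' x)"] cont
      by (auto intro: continuous_intros)
  qed
  moreover have "V0 \<subseteq> U"
    using x0(2) \<rho>(3) W(2) by (fastforce simp: U_def)
  ultimately obtain \<delta> where \<delta>: "\<delta> > 0" "(\<Union>x\<in>V0. ball x \<delta>) \<subseteq> U"
    using compact_subset_open_imp_ball_epsilon_subset V0(1) by blast
  have "dist (f x) (f y) \<le> \<rho> * dist x y" if "x \<in> V0" "y \<in> V0" "dist x y < \<delta>" for x y
  proof -
    have sub: "ball x \<delta> \<subseteq> U" using \<delta> that by auto
    have "norm (g y - g x) \<le> \<rho> * norm (y - x)"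
    proof (rule differentiable_bound[of "ball x \<delta>" g "\<lambda>x. blinfun_apply (D' x)"])
      show "(g has_derivative blinfun_apply (D' z)) (at z within ball x \<delta>)" if "z \<in> ball x \<delta>" for z
        using D'[of z] that sub unfolding U_def by (blast intro: has_derivative_at_withinI)
      show "onorm (blinfun_apply (D' z)) \<le> \<rho>" if "z \<in> ball x \<delta>" for z
        using that sub by (auto simp: U_def norm_blinfun.rep_eq[symmetric] less_imp_le)
    qed (use that \<delta> in auto)
    then show ?thesis
      using g(1) that by (simp add: dist_norm norm_minus_commute)
  qed
  with \<delta>(1) \<rho> show ?thesis by blast
qed

lemma conformal_IFS_locally_contracting:
  assumes "conformal_IFS V0 (f :: 'a::finite \<Rightarrow> 'v::euclidean_space \<Rightarrow> 'v)"
  shows "\<exists>\<delta>>0. \<exists>\<rho>. 0 < \<rho> \<and> \<rho> < 1 \<and>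
    (\<forall>i. \<forall>x\<in>V0. \<forall>y\<in>V0. dist x y < \<delta> \<longrightarrow> dist (f i x) (f i y) \<le> \<rho> * dist x y)"
proof -
  have "\<exists>\<delta>>0. \<exists>\<rho>. 0 < \<rho> \<and> \<rho> < 1 \<and>
    (\<forall>x\<in>V0. \<forall>y\<in>V0. dist x y < \<delta> \<longrightarrow> dist (f i x) (f i y) \<le> \<rho> * dist x y)" for i
    using assms conformal_map_locally_contracting unfolding conformal_IFS_def by metis
  then obtain \<delta> \<rho> where \<delta>: "\<And>i. \<delta> i > 0" and \<rho>: "\<And>i. 0 < \<rho> i \<and> \<rho> i < 1"
    and f: "\<And>i x y. x \<in> V0 \<Longrightarrow> y \<in> V0 \<Longrightarrow> dist x y < \<delta> i \<Longrightarrow> dist (f i x) (f i y) \<le> \<rho> i * dist x y"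
    by metis
  have "Min (range \<delta>) > 0" "0 < Max (range \<rho>)" "Max (range \<rho>) < 1"
    using \<delta> \<rho> by (auto simp: Max_gr_iff)
  moreover have "dist (f i x) (f i y) \<le> Max (range \<rho>) * dist x y"
    if "x \<in> V0" "y \<in> V0" "dist x y < Min (range \<delta>)" for i x y
  proof -
    have "dist (f i x) (f i y) \<le> \<rho> i * dist x y"
      using that by (intro f) auto
    also have "\<dots> \<le> Max (range \<rho>) * dist x y"
      by (intro mult_right_mono) auto
    finally show ?thesis .
  qed
  ultimately show ?thesis by blast
qed

lemma conformal_IFS_maps_to:
  assumes "conformal_IFS V0 f" "x \<in> V0"
  shows "foldr f w x \<in> V0"
proof -
  have "f i y \<in> V0" if "y \<in> V0" for i y
    using assms(1) that unfolding conformal_IFS_def conformal_map_on_def by blast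
  then show ?thesis
    by (induction w) (use assms(2) in auto)
qed

text \<open>As \<open>V0\<close> need not be convex, the maps contract only at small scales. The relation below is an
  equivalence relation with open classes, so connectedness turns this into a global bound.\<close>

lemma conformal_IFS_words_contracting:
  assumes ifs: "conformal_IFS V0 (f :: 'a::finite \<Rightarrow> 'v::euclidean_space \<Rightarrow> 'v)"
  shows "\<exists>M \<rho>. 0 < M \<and> 0 < \<rho> \<and> \<rho> < 1 \<and>
    (\<forall>w. \<forall>x\<in>V0. \<forall>y\<in>V0. dist (foldr f w x) (foldr f w y) \<le> M * \<rho> ^ length w)"
proof -
  obtain \<delta> \<rho> where \<delta>: "\<delta> > 0" and \<rho>: "0 < \<rho>" "\<rho> < 1"
    and f: "\<And>i x y. x \<in> V0 \<Longrightarrow> y \<in> V0 \<Longrightarrow> dist x y < \<delta> \<Longrightarrow> dist (f i x) (f i y) \<le> \<rho> * dist x y"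
    using conformal_IFS_locally_contracting[OF ifs] by blast
  have V0: "compact V0" "connected V0"
    using ifs by (auto simp: conformal_IFS_def)
  have loc: "dist (foldr f w x) (foldr f w y) \<le> \<delta> * \<rho> ^ length w"
    if "x \<in> V0" "y \<in> V0" "dist x y < \<delta>" for w x y
  proof -
    have "dist (foldr f w x) (foldr f w y) \<le> \<rho> ^ length w * dist x y"
    proof (induction w)
      case (Cons i w)
      \<comment> \<open>The images stay within distance \<delta>, so the local contraction can be
        applied again.\<close>
      have "\<rho> ^ length w * dist x y \<le> 1 * dist x y"
        using \<rho> by (intro mult_right_mono power_le_one) auto
      then have "dist (foldr f w x) (foldr f w y) < \<delta>"
        using Cons that by linarith
      then have "dist (foldr f (i # w) x) (foldr f (i # w) y) \<le> \<rho> * dist (foldr f w x) (foldr f w y)"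
        using f conformal_IFS_maps_to[OF ifs] that by simp
      also have "\<dots> \<le> \<rho> * (\<rho> ^ length w * dist x y)"
        using Cons \<rho> by (intro mult_left_mono) auto
      finally show ?case by (simp add: mult_ac)
    qed auto
    also have "\<dots> \<le> \<rho> ^ length w * \<delta>"
      using that \<rho> by (intro mult_left_mono) auto
    finally show ?thesis by (simp add: mult_ac)
  qed
  \<comment> \<open>The constant \<open>L\<close> may depend on the two points but not on the
    word.\<close>
  define E where "E x y \<longleftrightarrow> (\<exists>L. \<forall>w. dist (foldr f w x) (foldr f w y) \<le> L * \<rho> ^ length w)" for x y
  have E_trans: "E x z" if xyz: "E x y" "E y z" for x y z
  proof -
    obtain L L' where "\<And>w. dist (foldr f w x) (foldr f w y) \<le> L * \<rho> ^ length w"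
        "\<And>w. dist (foldr f w y) (foldr f w z) \<le> L' * \<rho> ^ length w"
      using xyz unfolding E_def by auto
    then have "dist (foldr f w x) (foldr f w z) \<le> (L + L') * \<rho> ^ length w" for w
      using dist_triangle[of "foldr f w x" "foldr f w z" "foldr f w y"]
      unfolding distrib_right by (meson add_mono order_trans)
    then show ?thesis unfolding E_def by blast
  qed
  have E_sym: "E y x" if "E x y" for x y
    using that by (auto simp: E_def dist_commute)
  have E: "E x y" if "x \<in> V0" "y \<in> V0" for x y
  proof (rule connected_equivalence_relation[OF V0(2) that, of E])
    fix a assume a: "a \<in> V0"
    show "\<exists>T. openin (top_of_set V0) T \<and> a \<in> T \<and> (\<forall>x\<in>T. E a x)"
    proof (intro exI conjI ballI)
      show "openin (top_of_set V0) (V0 \<inter> ball a \<delta>)" by auto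
      show "a \<in> V0 \<inter> ball a \<delta>" using a \<delta> by auto
      show "E a x" if "x \<in> V0 \<inter> ball a \<delta>" for x
        using loc[OF a] that unfolding E_def by auto
    qed
  qed (use E_sym E_trans in blast)+
  obtain Z where Z: "Z \<subseteq> V0" "finite Z" "V0 \<subseteq> (\<Union>z\<in>Z. ball z \<delta>)"
    by (rule compactE_image[OF V0(1), of V0 "\<lambda>z. ball z \<delta>"]) (use \<delta> in auto)
  have "\<forall>z\<in>Z. \<forall>z'\<in>Z. \<exists>L. \<forall>w. dist (foldr f w z) (foldr f w z') \<le> L * \<rho> ^ length w"
    using E Z(1) unfolding E_def by blast
  then obtain L where L: "\<And>z z' w. z \<in> Z \<Longrightarrow> z' \<in> Z \<Longrightarrow>
      dist (foldr f w z) (foldr f w z') \<le> L z z' * \<rho> ^ length w"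
    by metis
  \<comment> \<open>One step of size \<delta> at either end, from a point to the finite net, and the
    sum of all constants between net points as a crude common bound.\<close>
  define M where "M = 2 * \<delta> + (\<Sum>(z, z')\<in>Z \<times> Z. \<bar>L z z'\<bar>)"
  have "dist (foldr f w x) (foldr f w y) \<le> M * \<rho> ^ length w" if xy: "x \<in> V0" "y \<in> V0" for w x y
  proof -
    obtain z z' where z: "z \<in> Z" "dist x z < \<delta>" "z' \<in> Z" "dist z' y < \<delta>"
    proof -
      obtain z z' where "z \<in> Z" "x \<in> ball z \<delta>" "z' \<in> Z" "y \<in> ball z' \<delta>"
        using Z(3) xy by blast
      then show ?thesis
        using that by (simp add: dist_commute)
    qed
    have "L z z' \<le> (\<Sum>(z, z')\<in>Z \<times> Z. \<bar>L z z'\<bar>)"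
      using member_le_sum[of "(z, z')" "Z \<times> Z" "\<lambda>(z, z'). \<bar>L z z'\<bar>"] z Z(2) by auto
    then have "L z z' * \<rho> ^ length w \<le> (M - 2 * \<delta>) * \<rho> ^ length w"
      using \<rho> by (intro mult_right_mono) (auto simp: M_def)
    moreover have "dist (foldr f w x) (foldr f w z) \<le> \<delta> * \<rho> ^ length w"
        "dist (foldr f w z') (foldr f w y) \<le> \<delta> * \<rho> ^ length w"
      using loc z Z(1) xy by (auto simp: subset_iff)
    moreover have "dist (foldr f w x) (foldr f w y) \<le> dist (foldr f w x) (foldr f w z)
        + dist (foldr f w z) (foldr f w z') + dist (foldr f w z') (foldr f w y)"
      using dist_triangle[of "foldr f w x" "foldr f w y" "foldr f w z"]
        dist_triangle[of "foldr f w z" "foldr f w y" "foldr f w z'"] by linarith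
    ultimately show ?thesis
      using L[OF z(1,3), of w] by (simp add: algebra_simps)
  qed
  moreover have "M > 0"
    unfolding M_def using \<delta> by (intro add_pos_nonneg sum_nonneg) auto
  ultimately show ?thesis using \<rho> by blast
qed

lemma map_upt_Suc_shift: "map \<omega> [0..<Suc n] = \<omega> 0 # map (shift \<omega>) [0..<n]"
  by (simp add: upt_conv_Cons map_Suc_upt[symmetric] shift_def comp_def del: upt_Suc)

section \<open>The coding map: convergence, equivariance, modulus of continuity\<close>

context
  fixes V0 :: "('v::euclidean_space) set" and f :: "'a::finite \<Rightarrow> 'v \<Rightarrow> 'v"
  assumes ifs: "conformal_IFS V0 f"
begin

text \<open>After \<open>n\<close> letters every later iterate lies in the image of
  \<open>V0\<close> under the same first \<open>n\<close> maps, whose diameter decays geometrically.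
  Independence of the starting point makes the definite description in \<open>coding_map\<close>
  meaningful.\<close>

lemma coding_map_tendsto:
  assumes "x \<in> V0"
  shows "(\<lambda>n. foldr f (map \<omega> [0..<n]) x) \<longlonglongrightarrow> coding_map V0 f \<omega>"
proof -
  obtain M \<rho> where \<rho>: "0 < M" "0 < \<rho>" "\<rho> < 1"
    and M: "\<And>w x y. x \<in> V0 \<Longrightarrow> y \<in> V0 \<Longrightarrow> dist (foldr f w x) (foldr f w y) \<le> M * \<rho> ^ length w"
    using conformal_IFS_words_contracting[OF ifs] by blast
  have lim0: "(\<lambda>n. M * \<rho> ^ n) \<longlonglongrightarrow> 0"
    using tendsto_mult[OF tendsto_const LIMSEQ_realpow_zero, of \<rho> M] \<rho> by simp
  let ?s = "\<lambda>n x. foldr f (map \<omega> [0..<n]) x"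
  have step: "dist (?s m y) (?s n x) \<le> M * \<rho> ^ n" if "n \<le> m" "x \<in> V0" "y \<in> V0" for m n x y
  proof -
    have "[0..<m] = [0..<n] @ [n..<m]"
      using upt_add_eq_append[of 0 n "m - n"] that by simp
    then have "?s m y = ?s n (foldr f (map \<omega> [n..<m]) y)" by simp
    then show ?thesis
      using M[OF conformal_IFS_maps_to[OF ifs that(3), of "map \<omega> [n..<m]"] that(2), of "map \<omega> [0..<n]"] by simp
  qed
  have "Cauchy (\<lambda>n. ?s n x)"
  proof (rule metric_CauchyI)
    fix e :: real assume "e > 0"
    then obtain N where N: "M * \<rho> ^ N < e / 2"
      using order_tendstoD(2)[OF lim0, of "e / 2"] by (auto simp: eventually_sequentially)
    show "\<exists>N. \<forall>m\<ge>N. \<forall>n\<ge>N. dist (?s m x) (?s n x) < e"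
    proof (intro exI allI impI)
      fix m n assume "N \<le> m" "N \<le> n"
      then have "dist (?s m x) (?s N x) < e / 2" "dist (?s n x) (?s N x) < e / 2"
        using step[of N m x x] step[of N n x x] N assms by auto
      then show "dist (?s m x) (?s n x) < e"
        by (rule dist_triangle_half_l)
    qed
  qed
  then obtain p where p: "(\<lambda>n. ?s n x) \<longlonglongrightarrow> p"
    using Cauchy_convergent convergent_def by blast
  have "(\<lambda>n. ?s n y) \<longlonglongrightarrow> p" if "y \<in> V0" for y
  proof -
    have "(\<lambda>n. ?s n y - ?s n x) \<longlonglongrightarrow> 0"
    proof (rule Lim_null_comparison[OF always_eventually lim0], rule allI)
      show "norm (?s n y - ?s n x) \<le> M * \<rho> ^ n" for n
        using step[of n n x y] assms that by (simp add: dist_norm)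
    qed
    then show ?thesis
      by (rule Lim_transform[OF p])
  qed
  then have "coding_map V0 f \<omega> = p"
    unfolding coding_map_def using assms p by (intro the_equality) (auto dest: LIMSEQ_unique)
  with p show ?thesis by simp
qed

lemma coding_map_in: "coding_map V0 f \<omega> \<in> V0"
proof -
  obtain x where x: "x \<in> V0"
    using ifs by (auto simp: conformal_IFS_def)
  have "closed V0"
    using ifs by (simp add: conformal_IFS_def compact_imp_closed)
  then show ?thesis
    by (rule closed_sequentially[OF _ _ coding_map_tendsto[OF x]])
      (use conformal_IFS_maps_to[OF ifs x] in simp)
qed

text \<open>The local contraction supplies continuity of \<open>f (\<omega> 0)\<close> along points
  of \<open>V0\<close>, so the limit can be taken inside. This equivariance later carries ball
  estimates from \<omega> to \<open>shift \<omega>\<close>.\<close>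

lemma coding_map_shift: "coding_map V0 f \<omega> = f (\<omega> 0) (coding_map V0 f (shift \<omega>))"
proof -
  let ?\<Pi> = "coding_map V0 f"
  obtain x where x: "x \<in> V0"
    using ifs by (auto simp: conformal_IFS_def)
  obtain \<delta> \<rho> where \<delta>: "\<delta> > 0" and \<rho>: "0 < \<rho>" "\<rho> < 1"
    and f: "\<And>i x y. x \<in> V0 \<Longrightarrow> y \<in> V0 \<Longrightarrow> dist x y < \<delta> \<Longrightarrow> dist (f i x) (f i y) \<le> \<rho> * dist x y"
    using conformal_IFS_locally_contracting[OF ifs] by blast
  let ?s = "\<lambda>n. foldr f (map (shift \<omega>) [0..<n]) x"
  have lim: "(\<lambda>n. dist (?s n) (?\<Pi> (shift \<omega>))) \<longlonglongrightarrow> 0"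
    by (rule tendsto_dist_iff[THEN iffD1, OF coding_map_tendsto[OF x]])
  have "(\<lambda>n. dist (f (\<omega> 0) (?s n)) (f (\<omega> 0) (?\<Pi> (shift \<omega>)))) \<longlonglongrightarrow> 0"
  proof (rule Lim_null_comparison)
    have "\<forall>\<^sub>F n in sequentially. dist (?s n) (?\<Pi> (shift \<omega>)) < \<delta>"
      using order_tendstoD(2)[OF lim \<delta>] .
    then show "\<forall>\<^sub>F n in sequentially. norm (dist (f (\<omega> 0) (?s n)) (f (\<omega> 0) (?\<Pi> (shift \<omega>))))
        \<le> \<rho> * dist (?s n) (?\<Pi> (shift \<omega>))"
      by eventually_elim (use f conformal_IFS_maps_to[OF ifs x] coding_map_in in auto)
    show "(\<lambda>n. \<rho> * dist (?s n) (?\<Pi> (shift \<omega>))) \<longlonglongrightarrow> 0"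
      using tendsto_mult[OF tendsto_const lim, of \<rho>] by simp
  qed
  then have "(\<lambda>n. f (\<omega> 0) (?s n)) \<longlonglongrightarrow> f (\<omega> 0) (?\<Pi> (shift \<omega>))"
    by (rule tendsto_dist_iff[THEN iffD2])
  moreover have "(\<lambda>n. f (\<omega> 0) (?s n)) \<longlonglongrightarrow> ?\<Pi> \<omega>"
    using LIMSEQ_Suc[OF coding_map_tendsto[OF x, of \<omega>]] by (simp only: map_upt_Suc_shift foldr.simps comp_apply)
  ultimately show ?thesis
    by (rule LIMSEQ_unique[symmetric])
qed

text \<open>Diameters decay like \<open>M * \<rho> ^ n\<close>: take \<open>\<rho> ^ p < 1/2\<close>
  and let \<open>q\<close> absorb \<open>M\<close>. What matters is that the length is linear in
  \<open>m\<close>, so that an error \<open>b ^ n\<close> on cylinders becomes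
  \<open>b ^ (p * m + q)\<close>, a power of the radius with exponent as small as desired.\<close>

lemma coding_map_fine_cylinders:
  "\<exists>p q. \<forall>m \<omega> \<tau>. \<tau> \<in> cylinder \<omega> (p * m + q) \<longrightarrow>
     dist (coding_map V0 f \<omega>) (coding_map V0 f \<tau>) < (1/2) ^ m"
proof -
  obtain M \<rho> where \<rho>: "0 < M" "0 < \<rho>" "\<rho> < 1"
    and M: "\<And>w x y. x \<in> V0 \<Longrightarrow> y \<in> V0 \<Longrightarrow> dist (foldr f w x) (foldr f w y) \<le> M * \<rho> ^ length w"
    using conformal_IFS_words_contracting[OF ifs] by blast
  obtain x where x: "x \<in> V0"
    using ifs by (auto simp: conformal_IFS_def)
  have bound: "dist (coding_map V0 f \<omega>) (coding_map V0 f \<tau>) \<le> M * \<rho> ^ n"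
    if \<tau>: "\<tau> \<in> cylinder \<omega> n" for \<omega> \<tau> n
  proof (rule tendsto_upperbound[OF tendsto_dist[OF coding_map_tendsto[OF x] coding_map_tendsto[OF x]]])
    show "\<forall>\<^sub>F k in sequentially. dist (foldr f (map \<omega> [0..<k]) x) (foldr f (map \<tau> [0..<k]) x) \<le> M * \<rho> ^ n"
      unfolding eventually_sequentially
    proof (intro exI allI impI)
      fix k assume "n \<le> k"
      then have k: "[0..<k] = [0..<n] @ [n..<k]"
        using upt_add_eq_append[of 0 n "k - n"] by simp
      have eq: "map \<tau> [0..<n] = map \<omega> [0..<n]"
        using \<tau> by (simp add: cylinder_def)
      then show "dist (foldr f (map \<omega> [0..<k]) x) (foldr f (map \<tau> [0..<k]) x) \<le> M * \<rho> ^ n"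
        unfolding k map_append foldr_append o_apply eq using M[OF conformal_IFS_maps_to[OF ifs x, of "map \<omega> [n..<k]"]
            conformal_IFS_maps_to[OF ifs x, of "map \<tau> [n..<k]"], of "map \<omega> [0..<n]"] by simp
    qed
  qed simp
  obtain p where p: "\<rho> ^ p < 1/2"
    using real_arch_pow_inv[of "1/2" \<rho>] \<rho> by auto
  obtain q where q: "\<rho> ^ q < 1 / M"
    using real_arch_pow_inv[of "1 / M" \<rho>] \<rho> by auto
  have "dist (coding_map V0 f \<omega>) (coding_map V0 f \<tau>) < (1/2) ^ m"
    if \<tau>: "\<tau> \<in> cylinder \<omega> (p * m + q)" for m \<omega> \<tau>
  proof -
    have "M * \<rho> ^ q < 1"
      using q \<rho> by (simp add: field_simps)
    have "dist (coding_map V0 f \<omega>) (coding_map V0 f \<tau>) \<le> (M * \<rho> ^ q) * (\<rho> ^ p) ^ m"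
      using bound[OF \<tau>] by (simp add: power_add power_mult mult.assoc mult.commute[of "\<rho> ^ q"])
    also have "\<dots> < 1 * (\<rho> ^ p) ^ m"
      using \<open>M * \<rho> ^ q < 1\<close> \<rho> by (intro mult_strict_right_mono) auto
    also have "\<dots> \<le> (1/2) ^ m"
      using p \<rho> by (simp add: power_mono)
    finally show ?thesis .
  qed
  then show ?thesis by blast
qed

lemma coding_map_vimage_open:
  assumes "open U" "coding_map V0 f \<omega> \<in> U"
  shows "\<exists>n. cylinder \<omega> n \<subseteq> coding_map V0 f -` U"
proof -
  obtain p q where pq: "\<And>m \<omega> \<tau>. \<tau> \<in> cylinder \<omega> (p * m + q) \<Longrightarrow>
     dist (coding_map V0 f \<omega>) (coding_map V0 f \<tau>) < (1/2) ^ m"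
    using coding_map_fine_cylinders by blast
  obtain e where e: "e > 0" "ball (coding_map V0 f \<omega>) e \<subseteq> U"
    using assms openE by blast
  obtain m where "(1/2) ^ m < e"
    using real_arch_pow_inv[of e "1/2"] e by auto
  then have "cylinder \<omega> (p * m + q) \<subseteq> coding_map V0 f -` U"
    using pq[of _ \<omega> m] e(2) by fastforce
  then show ?thesis by blast
qed

lemma coding_map_measurable: "coding_map V0 f \<in> measurable seq_space borel"
  by (rule borel_measurableI) (use coding_map_vimage_open in \<open>auto intro!: cylinder_open_in_sets\<close>)

text \<open>Tychonoff: the coding map is continuous on a product of finite discrete spaces.
  Compactness makes the attractor bounded and Borel.\<close>

lemma compact_attractor: "compact (attractor V0 f)"
proof -
  let ?T = "product_topology (\<lambda>_ :: nat. discrete_topology (UNIV :: 'a set)) UNIV"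
  have comp: "compact_space ?T"
    by (simp add: compact_space_product_topology compact_space_discrete_topology)
  have top: "topspace ?T = UNIV" by simp
  have cyl: "openin ?T (cylinder \<omega> n)" for \<omega> n
  proof -
    have "cylinder \<omega> n = (\<Pi>\<^sub>E k\<in>UNIV. if k < n then {\<omega> k} else UNIV)"
      by (auto simp: cylinder_def PiE_def Pi_def split: if_splits)
    also have "openin ?T \<dots>"
    proof (rule product_topology_basis)
      have "{k. (if k < n then {\<omega> k} else UNIV) \<noteq> topspace (discrete_topology (UNIV :: 'a set))} \<subseteq> {..<n}"
        by auto
      then show "finite {k. (if k < n then {\<omega> k} else UNIV) \<noteq> topspace (discrete_topology (UNIV :: 'a set))}"
        using finite_subset by blast
    qed auto
    finally show ?thesis .
  qed
  have "continuous_map ?T euclidean (coding_map V0 f)"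
    unfolding continuous_map_def
  proof (intro conjI allI impI)
    fix U :: "'v set" assume "openin euclidean U"
    then have U: "open U" by simp
    show "openin ?T {x \<in> topspace ?T. coding_map V0 f x \<in> U}"
      unfolding openin_subopen[of ?T "{x \<in> topspace ?T. coding_map V0 f x \<in> U}"]
    proof
      fix \<omega> assume "\<omega> \<in> {x \<in> topspace ?T. coding_map V0 f x \<in> U}"
      then obtain n where "cylinder \<omega> n \<subseteq> coding_map V0 f -` U"
        using coding_map_vimage_open[OF U, of \<omega>] by auto
      then show "\<exists>T. openin ?T T \<and> \<omega> \<in> T \<and> T \<subseteq> {x \<in> topspace ?T. coding_map V0 f x \<in> U}"
        using cyl[of \<omega> n] by (intro exI[of _ "cylinder \<omega> n"]) auto
    qed
  qed auto
  then have "compactin euclidean (coding_map V0 f ` topspace ?T)"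
    using comp unfolding compact_space_def by (rule image_compactin[rotated])
  then show ?thesis
    by (simp add: attractor_def)
qed

end


section \<open>Power bounds for the measure of balls\<close>

text \<open>A Frostman condition at \<open>x\<close> whose constant may depend on \<open>x\<close>;
  for \<open>a = 2 powr - s\<close> the exponent is \<open>s\<close>. Countably many radii keep the
  set of such points Borel.\<close>

definition frost :: "'x::metric_space measure \<Rightarrow> real \<Rightarrow> 'x \<Rightarrow> bool" where
  "frost \<nu> a x \<longleftrightarrow> (\<exists>K. \<forall>m. measure \<nu> (ball x ((1/2) ^ m)) \<le> K * a ^ m)"

text \<open>Finitely many coarse scales are absorbed into the constant.\<close>

lemma frostI:
  assumes "a > 0" and "\<And>m. m \<ge> m0 \<Longrightarrow> measure \<nu> (ball x ((1/2) ^ m)) \<le> K * a ^ m"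
  shows "frost \<nu> a x"
proof -
  let ?r = "\<lambda>m. measure \<nu> (ball x ((1/2) ^ m)) / a ^ m"
  have "measure \<nu> (ball x ((1/2) ^ m)) \<le> (\<bar>K\<bar> + (\<Sum>j<m0. ?r j)) * a ^ m" for m
  proof (cases "m < m0")
    case True
    then have "?r m \<le> (\<Sum>j<m0. ?r j)"
      using assms(1) by (intro member_le_sum) auto
    then have "?r m \<le> \<bar>K\<bar> + (\<Sum>j<m0. ?r j)" by linarith
    then show ?thesis
      using assms(1) by (simp add: field_simps)
  next
    case False
    then have "measure \<nu> (ball x ((1/2) ^ m)) \<le> K * a ^ m"
      using assms(2) by simp
    also have "\<dots> \<le> (\<bar>K\<bar> + (\<Sum>j<m0. ?r j)) * a ^ m"
      using assms(1) by (intro mult_right_mono add_increasing2 sum_nonneg) auto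
    finally show ?thesis .
  qed
  then show ?thesis unfolding frost_def by blast
qed

lemma frost_mono:
  assumes "frost \<nu> a x" "0 < a" "a \<le> b"
  shows "frost \<nu> b x"
proof -
  obtain K where K: "\<And>m. measure \<nu> (ball x ((1/2) ^ m)) \<le> K * a ^ m"
    using assms(1) unfolding frost_def by blast
  have "0 \<le> K"
    using order_trans[OF measure_nonneg K[of 0]] by simp
  then have "K * a ^ m \<le> K * b ^ m" for m
    using assms by (intro mult_left_mono power_mono) auto
  then show ?thesis
    using K order_trans unfolding frost_def by blast
qed

lemma dyadic_scale:
  fixes r :: real
  assumes "0 < r" "r < 1"
  obtains m where "(1/2) ^ Suc m \<le> r" "r < (1/2) ^ m"
proof -
  obtain n where n: "(1/2) ^ n < r"
    using real_arch_pow_inv[of r "1/2"] assms by auto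
  define k where "k = (LEAST n. (1/2) ^ n \<le> r)"
  have k: "(1/2) ^ k \<le> r"
    unfolding k_def by (rule LeastI[of _ n]) (use n in simp)
  moreover have "k \<noteq> 0" using k assms by (intro notI) simp
  then obtain m where m: "k = Suc m" using not0_implies_Suc by blast
  then have "\<not> (1/2) ^ m \<le> r"
    using not_less_Least[of m "\<lambda>n. (1/2) ^ n \<le> r"] k_def by simp
  ultimately show ?thesis using that m by auto
qed

lemma eventually_const_div_ln:
  fixes C e :: real
  assumes "e > 0"
  shows "\<forall>\<^sub>F r in at_right 0. \<bar>C / ln r\<bar> < e"
proof -
  have "((\<lambda>r. C / ln r) \<longlongrightarrow> 0) (at_right 0)"
    using ln_at_0 by (intro tendsto_divide_0[OF tendsto_const]) (auto intro: filterlim_at_bot_imp_at_infinity)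
  from tendstoD[OF this assms] show ?thesis
    by (simp add: dist_real_def)
qed

lemma eventually_at_right_0_unit: "\<forall>\<^sub>F r :: real in at_right 0. 0 < r \<and> r < 1"
  by (rule eventually_at_rightI[of 0 1]) auto

lemma frost_imp_lower_local_dim:
  fixes \<nu> :: "'x::metric_space measure"
  assumes "finite_measure \<nu>" "sets \<nu> = sets borel" "frost \<nu> (2 powr - s) x"
  shows "ereal s \<le> lower_local_dim \<nu> x"
proof -
  interpret finite_measure \<nu> by fact
  obtain K where K: "\<And>m. measure \<nu> (ball x ((1/2) ^ m)) \<le> K * (2 powr - s) ^ m"
    using assms(3) unfolding frost_def by blast
  \<comment> \<open>The factor \<open>2 powr \<bar>s\<bar>\<close> pays for rounding
    \<open>r\<close> to a dyadic radius, for either sign of \<open>s\<close>; adding 1 makes the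
    constant positive, so that it has a logarithm.\<close>
  define K' where "K' = \<bar>K\<bar> * 2 powr \<bar>s\<bar> + 1"
  have "K' > 0" by (simp add: K'_def add_nonneg_pos)
  have bound: "measure \<nu> (ball x r) \<le> K' * r powr s" if "0 < r" "r < 1" for r
  proof -
    obtain m where m: "(1/2) ^ Suc m \<le> r" "r < (1/2) ^ m"
      using dyadic_scale[OF \<open>0 < r\<close> \<open>r < 1\<close>] .
    have "measure \<nu> (ball x r) \<le> measure \<nu> (ball x ((1/2) ^ m))"
      using m by (intro finite_measure_mono) (auto simp: assms(2))
    also have "\<dots> \<le> \<bar>K\<bar> * (2 powr - s) ^ m"
      using K[of m] by (smt (verit) mult_right_mono zero_le_power powr_ge_zero)
    also have "(2 powr - s) ^ m = ((1/2 :: real) ^ m) powr s"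
      by (simp add: powr_realpow[symmetric] powr_powr powr_minus_divide powr_divide powr_one_gt_zero_iff
          mult.commute)
    finally have 1: "measure \<nu> (ball x r) \<le> \<bar>K\<bar> * ((1/2 :: real) ^ m) powr s" .
    have "((1/2 :: real) ^ m) powr s \<le> 2 powr \<bar>s\<bar> * r powr s"
    proof (cases "s \<ge> 0")
      case True
      then have "((1/2 :: real) ^ m) powr s \<le> (2 * r) powr s"
        using m by (intro powr_mono2) auto
      then show ?thesis using True that by (simp add: powr_mult)
    next
      case False
      then have "((1/2 :: real) ^ m) powr s \<le> r powr s"
        using m that by (intro powr_mono2') auto
      also have "\<dots> \<le> 2 powr \<bar>s\<bar> * r powr s"
        using mult_right_mono[of 1 "2 powr \<bar>s\<bar>" "r powr s"] ge_one_powr_ge_zero[of 2 "\<bar>s\<bar>"] by simp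
      finally show ?thesis .
    qed
    then have "measure \<nu> (ball x r) \<le> \<bar>K\<bar> * (2 powr \<bar>s\<bar> * r powr s)"
      by (intro order_trans[OF 1] mult_left_mono) auto
    also have "\<dots> \<le> K' * r powr s"
      by (simp add: K'_def algebra_simps)
    finally show ?thesis .
  qed
  show ?thesis
    unfolding lower_local_dim_def le_Liminf_iff
  proof (intro allI impI)
    fix y :: ereal assume "y < ereal s"
    then obtain y' where y': "y < ereal y'" "y' < s"
      using ereal_dense2 by (metis less_ereal.simps(1) less_trans)
    have e: "s - y' > 0" using y' by simp
    show "\<forall>\<^sub>F r in at_right 0. y < elog (measure \<nu> (ball x r)) / ereal (ln r)"
      using eventually_const_div_ln[OF e, of "ln K'"] eventually_at_right_0_unit
    proof (eventually_elim)
      case (elim r)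
      then have r: "0 < r" "r < 1" and ln: "ln r < 0" by auto
      show ?case
      proof (cases "measure \<nu> (ball x r) > 0")
        case True
        then have "ln (measure \<nu> (ball x r)) \<le> ln (K' * r powr s)"
          using bound[OF r] by (intro ln_mono) auto
        also have "\<dots> = ln K' + s * ln r"
          using \<open>K' > 0\<close> r by (simp add: ln_mult ln_powr)
        finally have "ln (measure \<nu> (ball x r)) / ln r \<ge> (ln K' + s * ln r) / ln r"
          using ln by (intro divide_right_mono_neg) auto
        also have "(ln K' + s * ln r) / ln r = s + ln K' / ln r"
          using ln by (simp add: field_simps)
        finally have "ereal y' \<le> ereal (ln (measure \<nu> (ball x r)) / ln r)"
          using elim(1) unfolding abs_less_iff ereal_less_eq by linarith
        with y'(1) have "y < ereal (ln (measure \<nu> (ball x r)) / ln r)"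
          by (rule less_le_trans)
        then show ?thesis
          using True ln by (simp add: elog_def)
      next
        \<comment> \<open>A null ball: \<open>elog\<close> gives minus infinity, and division by the
          negative \<open>ln r\<close> turns it into plus infinity.\<close>
        case False
        then have "elog (measure \<nu> (ball x r)) / ereal (ln r) = \<infinity>"
          using ln by (simp add: elog_def divide_ereal_def)
        then show ?thesis using y' by auto
      qed
    qed
  qed
qed

text \<open>The strict inequality yields the bound with constant 1 at all small radii.\<close>

lemma lower_local_dim_imp_frost:
  assumes "ereal s < lower_local_dim \<nu> x"
  shows "frost \<nu> (2 powr - s) x"
proof -
  have "\<forall>\<^sub>F r in at_right 0. ereal s < elog (measure \<nu> (ball x r)) / ereal (ln r)"
    using assms unfolding lower_local_dim_def by (rule less_LiminfD)
  then obtain b where b: "b > 0"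
    "\<And>r. 0 < r \<Longrightarrow> r < b \<Longrightarrow> ereal s < elog (measure \<nu> (ball x r)) / ereal (ln r)"
    unfolding eventually_at_right_field by blast
  obtain m0 where m0: "(1/2) ^ m0 < b"
    using real_arch_pow_inv[of b "1/2"] b by auto
  show ?thesis
  \<comment> \<open>\<open>Suc\<close> keeps the radii at or below 1/2, so that \<open>ln r\<close>
    is negative.\<close>
  proof (rule frostI[where ?m0.0 = "Suc m0" and K = 1])
    fix m assume m: "Suc m0 \<le> m"
    define r :: real where "r = (1/2) ^ m"
    have "r \<le> (1/2) ^ m0" unfolding r_def using m by (intro power_decreasing) auto
    moreover have "r \<le> 1/2" unfolding r_def using m power_decreasing[of 1 m "1/2 :: real"] by simp
    moreover have "0 < r" by (simp add: r_def)
    ultimately have r: "0 < r" "r < b" "r < 1" using m0 by linarith+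
    then have ln: "ln r < 0" by simp
    show "measure \<nu> (ball x ((1/2) ^ m)) \<le> 1 * (2 powr - s) ^ m"
    proof (cases "measure \<nu> (ball x r) > 0")
      case True
      then have "s < ln (measure \<nu> (ball x r)) / ln r"
        using b(2)[OF r(1,2)] ln by (simp add: elog_def)
      then have "ln (measure \<nu> (ball x r)) < s * ln r"
        using ln by (simp add: field_simps)
      then have "measure \<nu> (ball x r) < exp (s * ln r)"
        using True by (metis exp_less_cancel_iff exp_ln)
      also have "\<dots> = (2 powr - s) ^ m"
      proof -
        have "s * ln r = real m * (- s * ln 2)"
          by (simp add: r_def ln_realpow ln_div)
        then show ?thesis
          by (simp only: exp_of_nat_mult) (simp add: powr_def)
      qed
      finally show ?thesis by (simp add: r_def)
    next
      case False
      then have "measure \<nu> (ball x r) = 0" using measure_nonneg[of \<nu> "ball x r"] by linarith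
      then show ?thesis by (simp add: r_def)
    qed
  qed simp
qed

lemma has_dim_HI:
  assumes "prob_space \<nu>" "AE x in \<nu>. lower_local_dim \<nu> x = s"
  shows "has_dim_H \<nu> s"
proof -
  have "ae_filter \<nu> \<noteq> bot" using assms(1) by (rule prob_space.ae_filter_bot)
  then show ?thesis
    unfolding has_dim_H_def lower_dim_H_def upper_dim_H_def ess_sup_def ess_inf_def
    using Liminf_eq[OF assms(2)] Limsup_eq[OF assms(2)] by (simp add: Liminf_const Limsup_const)
qed

text \<open>Borel-Cantelli by summation: the series of \<open>g m / a' ^ m\<close> has finite
  integral, so it is finite almost everywhere and bounds each of its terms. This turns bounds on
  averages into pointwise bounds, at the price of an arbitrarily small loss in the base.\<close>

lemma AE_geometric_bound:
  fixes g :: "nat \<Rightarrow> 'x \<Rightarrow> ennreal"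
  assumes g: "\<And>m. g m \<in> borel_measurable M" and a: "0 < a" "a < a'"
    and C: "\<And>m. (\<integral>\<^sup>+x. g m x \<partial>M) \<le> ennreal (C * a ^ m)"
  shows "AE x in M. \<exists>D\<ge>0. \<forall>m. g m x \<le> ennreal (D * a' ^ m)"
proof -
  define h where "h m x = ennreal ((1 / a') ^ m) * g m x" for m x
  have "(\<integral>\<^sup>+x. (\<Sum>m. h m x) \<partial>M) = (\<Sum>m. \<integral>\<^sup>+x. h m x \<partial>M)"
    unfolding h_def using g by (intro nn_integral_suminf) auto
  also have "\<dots> \<le> (\<Sum>m. ennreal (\<bar>C\<bar> * (a / a') ^ m))"
  proof (rule suminf_le)
    fix m
    have "(\<integral>\<^sup>+x. h m x \<partial>M) = ennreal ((1 / a') ^ m) * (\<integral>\<^sup>+x. g m x \<partial>M)"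
      unfolding h_def using g by (intro nn_integral_cmult) auto
    also have "\<dots> \<le> ennreal ((1 / a') ^ m) * ennreal (\<bar>C\<bar> * a ^ m)"
      using C[of m] a by (intro mult_left_mono order_trans[OF C] ennreal_leI mult_right_mono) auto
    also have "\<dots> = ennreal (\<bar>C\<bar> * (a / a') ^ m)"
      using a by (subst ennreal_mult'[symmetric]) (auto simp: power_divide)
    finally show "(\<integral>\<^sup>+x. h m x \<partial>M) \<le> ennreal (\<bar>C\<bar> * (a / a') ^ m)" .
  qed auto
  also have "\<dots> = ennreal (\<Sum>m. \<bar>C\<bar> * (a / a') ^ m)"
    using a by (intro suminf_ennreal2 summable_mult summable_geometric) auto
  finally have "(\<integral>\<^sup>+x. (\<Sum>m. h m x) \<partial>M) \<noteq> \<infinity>"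
    by (auto simp: top_unique)
  moreover have "(\<lambda>x. \<Sum>m. h m x) \<in> borel_measurable M"
    unfolding h_def using g by measurable
  ultimately have "AE x in M. (\<Sum>m. h m x) \<noteq> \<infinity>"
    by (intro nn_integral_PInf_AE)
  then show ?thesis
  proof eventually_elim
    case (elim x)
    then obtain D where D: "(\<Sum>m. h m x) = ennreal D" "D \<ge> 0"
      by (cases "\<Sum>m. h m x") auto
    have "g m x \<le> ennreal (D * a' ^ m)" for m
    proof -
      have "h m x \<le> (\<Sum>m. h m x)"
        using sum_le_suminf[of "\<lambda>m. h m x" "{m}"] by simp
      then have "ennreal (a' ^ m) * h m x \<le> ennreal (a' ^ m) * ennreal D"
        unfolding D(1) by (intro mult_left_mono) auto
      moreover have "ennreal (a' ^ m) * h m x = g m x"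
        unfolding h_def mult.assoc[symmetric]
        using a by (subst ennreal_mult'[symmetric]) (auto simp: power_divide)
      ultimately show ?thesis
        using D(2) a by (subst (asm) ennreal_mult'[symmetric]) (auto simp: mult.commute)
    qed
    with D(2) show ?case by blast
  qed
qed

section \<open>Measurability of ball masses and almost sure doubling\<close>

lemma dist_less_sets:
  fixes M N :: "'v::euclidean_space measure"
  assumes "sets M = sets borel" "sets N = sets borel"
  shows "{p. dist (fst p) (snd p) < r} \<in> sets (M \<Otimes>\<^sub>M N)"
proof -
  have "{p :: 'v \<times> 'v. dist (fst p) (snd p) < r} \<in> sets (borel \<Otimes>\<^sub>M borel)"
    unfolding borel_prod by (intro borel_open open_Collect_less continuous_intros)
  then show ?thesis using sets_pair_measure_cong[OF assms] by simp
qed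

lemma emeasure_ball_measurable:
  fixes \<nu> :: "'v::euclidean_space measure"
  assumes "finite_measure \<nu>" "sets \<nu> = sets borel"
  shows "(\<lambda>x. emeasure \<nu> (ball x r)) \<in> borel_measurable borel"
proof -
  interpret finite_measure \<nu> by fact
  have "{p. dist (fst p) (snd p) < r} \<in> sets (borel \<Otimes>\<^sub>M \<nu>)"
    using assms(2) by (intro dist_less_sets) simp_all
  from measurable_emeasure_Pair[OF this] show ?thesis
    by (simp add: ball_def vimage_def)
qed

lemma measure_ball_measurable:
  fixes \<nu> :: "'v::euclidean_space measure"
  assumes "finite_measure \<nu>" "sets \<nu> = sets borel"
  shows "(\<lambda>x. measure \<nu> (ball x r)) \<in> borel_measurable borel"
  unfolding measure_def using emeasure_ball_measurable[OF assms] by measurable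

lemma frost_sets:
  fixes \<nu> :: "'v::euclidean_space measure"
  assumes "finite_measure \<nu>" "sets \<nu> = sets borel" "a > 0"
  shows "{x. frost \<nu> a x} \<in> sets borel"
proof -
  note [measurable] = measure_ball_measurable[OF assms(1,2)]
  have "frost \<nu> a x \<longleftrightarrow> (\<exists>k::nat. \<forall>m. measure \<nu> (ball x ((1/2) ^ m)) \<le> real k * a ^ m)" for x
  proof
    assume "frost \<nu> a x"
    then obtain K where K: "\<And>m. measure \<nu> (ball x ((1/2) ^ m)) \<le> K * a ^ m"
      unfolding frost_def by blast
    obtain k :: nat where "K \<le> real k" using real_arch_simple by blast
    then have "K * a ^ m \<le> real k * a ^ m" for m
      using assms(3) by (intro mult_right_mono) auto
    then show "\<exists>k::nat. \<forall>m. measure \<nu> (ball x ((1/2) ^ m)) \<le> real k * a ^ m"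
      using K order_trans by blast
  qed (auto simp: frost_def)
  then have "{x. frost \<nu> a x} = {x \<in> space borel. \<exists>k::nat. \<forall>m. measure \<nu> (ball x ((1/2) ^ m)) \<le> real k * a ^ m}"
    by simp
  also have "\<dots> \<in> sets borel" by measurable
  finally show ?thesis .
qed

lemma ennreal_inverse_le_inverse: "a \<le> b \<Longrightarrow> inverse b \<le> inverse (a :: ennreal)"
proof (cases "a = 0 \<or> b = top")
  case False
  assume "a \<le> b"
  with False obtain r s where "a = ennreal r" "b = ennreal s" "0 < r" "r \<le> s"
    by (cases a; cases b) (auto simp: top_unique less_le)
  then show ?thesis by (simp add: inverse_ennreal)
qed auto

text \<open>The average of \<open>\<nu> (ball x (4 * r)) / \<nu> (ball x r)\<close> is bounded independently of \<open>r\<close>: exchange the order of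
  integration, and cover \<open>ball y (4 * r)\<close> by boundedly many balls of diameter \<open>r\<close>.\<close>

lemma nn_integral_ball_ratio_le:
  fixes \<nu> :: "'v::euclidean_space measure"
  assumes "finite_measure \<nu>" "sets \<nu> = sets borel"
  shows "\<exists>k::nat. \<forall>r>0. (\<integral>\<^sup>+x. inverse (emeasure \<nu> (ball x r)) * emeasure \<nu> (ball x (4 * r)) \<partial>\<nu>)
    \<le> of_nat k * emeasure \<nu> UNIV"
proof -
  interpret finite_measure \<nu> by fact
  have space: "space \<nu> = UNIV" using sets_eq_imp_space_eq[OF assms(2)] by simp
  have [measurable_cong]: "sets \<nu> = sets borel" by fact
  note [measurable] = emeasure_ball_measurable[OF assms]
  \<comment> \<open>A net at unit scale; scaled by \<open>r\<close> and moved to \<open>y\<close> it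
    covers the ball of radius \<open>4 * r\<close> about \<open>y\<close>, with a number of balls
    independent of \<open>r\<close> and \<open>y\<close>.\<close>
  obtain Z where Z: "finite Z" "cball (0 :: 'v) 4 \<subseteq> (\<Union>z\<in>Z. ball z (1/2))"
    by (rule compactE_image[of "cball (0 :: 'v) 4" UNIV "\<lambda>z. ball z (1/2)"])
      (auto intro!: exI[of "\<lambda>xa. dist xa x * 2 < 1" x for x])
  have "(\<integral>\<^sup>+x. inverse (emeasure \<nu> (ball x r)) * emeasure \<nu> (ball x (4 * r)) \<partial>\<nu>)
    \<le> of_nat (card Z) * emeasure \<nu> UNIV" if "r > 0" for r
  proof -
    interpret pair_sigma_finite \<nu> \<nu> ..
    let ?i = "\<lambda>x. inverse (emeasure \<nu> (ball x r))"
    let ?D = "{p :: 'v \<times> 'v. dist (fst p) (snd p) < 4 * r}"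
    have D: "?D \<in> sets (\<nu> \<Otimes>\<^sub>M \<nu>)"
      by (rule dist_less_sets[OF assms(2) assms(2)])
    have "(\<integral>\<^sup>+x. ?i x * emeasure \<nu> (ball x (4 * r)) \<partial>\<nu>) = (\<integral>\<^sup>+x. \<integral>\<^sup>+y. ?i x * indicator ?D (x, y) \<partial>\<nu> \<partial>\<nu>)"
    proof (rule nn_integral_cong)
      fix x :: 'v
      have "(\<integral>\<^sup>+y. ?i x * indicator ?D (x, y) \<partial>\<nu>) = (\<integral>\<^sup>+y. ?i x * indicator (ball x (4 * r)) y \<partial>\<nu>)"
        by (intro nn_integral_cong) (auto simp: indicator_def)
      also have "\<dots> = ?i x * emeasure \<nu> (ball x (4 * r))"
        by (rule nn_integral_cmult_indicator) (simp add: assms(2))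
      finally show "?i x * emeasure \<nu> (ball x (4 * r)) = (\<integral>\<^sup>+y. ?i x * indicator ?D (x, y) \<partial>\<nu>)" ..
    qed
    also have "\<dots> = (\<integral>\<^sup>+y. \<integral>\<^sup>+x. ?i x * indicator ?D (x, y) \<partial>\<nu> \<partial>\<nu>)"
      by (rule Fubini') (use D in measurable)
    also have "\<dots> \<le> (\<integral>\<^sup>+y. of_nat (card Z) \<partial>\<nu>)"
    proof (rule nn_integral_mono)
      fix y :: 'v
      let ?Q = "\<lambda>z. ball (y + r *\<^sub>R z) (r / 2)"
      have "(\<integral>\<^sup>+x. ?i x * indicator ?D (x, y) \<partial>\<nu>) \<le> (\<integral>\<^sup>+x. (\<Sum>z\<in>Z. inverse (emeasure \<nu> (?Q z)) * indicator (?Q z) x) \<partial>\<nu>)"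
      proof (rule nn_integral_mono)
        fix x :: 'v
        show "?i x * indicator ?D (x, y) \<le> (\<Sum>z\<in>Z. inverse (emeasure \<nu> (?Q z)) * indicator (?Q z) x)"
        proof (cases "dist x y < 4 * r")
          case True
          have "(x - y) /\<^sub>R r \<in> cball 0 4"
            unfolding mem_cball_0 norm_scaleR using True that
            by (simp add: dist_norm divide_inverse[symmetric] pos_divide_le_eq mult.commute[of "inverse r"])
          from subsetD[OF Z(2) this] obtain z where z: "z \<in> Z" "dist z ((x - y) /\<^sub>R r) < 1/2"
            unfolding UN_iff mem_ball by blast
          have "dist (y + r *\<^sub>R z) x = r * dist z ((x - y) /\<^sub>R r)"
          proof -
            have "y + r *\<^sub>R z - x = r *\<^sub>R (z - (x - y) /\<^sub>R r)"
              using that by (simp add: algebra_simps)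
            then show ?thesis using that by (simp add: dist_norm)
          qed
          then have xQ: "x \<in> ?Q z"
            using z(2) that by simp
          \<comment> \<open>A ball of radius \<open>r / 2\<close> containing \<open>x\<close> lies
            in the ball of radius \<open>r\<close> about \<open>x\<close>, so its reciprocal mass is
            the larger one. Integrated over that net ball, it contributes at most 1.\<close>
          then have "?Q z \<subseteq> ball x r"
            by (intro subsetI) (simp only: mem_ball, erule (1) dist_triangle_half_r)
          then have "?i x \<le> inverse (emeasure \<nu> (?Q z))"
            by (intro ennreal_inverse_le_inverse emeasure_mono) (auto simp: assms(2))
          also have "\<dots> = inverse (emeasure \<nu> (?Q z)) * indicator (?Q z) x"
            using xQ by simp
          also have "\<dots> \<le> (\<Sum>z\<in>Z. inverse (emeasure \<nu> (?Q z)) * indicator (?Q z) x)"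
            using z(1) Z(1) by (intro member_le_sum) auto
          finally show ?thesis using True by simp
        qed simp
      qed
      also have "\<dots> = (\<Sum>z\<in>Z. \<integral>\<^sup>+x. inverse (emeasure \<nu> (?Q z)) * indicator (?Q z) x \<partial>\<nu>)"
        by (intro nn_integral_sum borel_measurable_times_ennreal borel_measurable_const
            borel_measurable_indicator) (simp add: assms(2))
      also have "\<dots> = (\<Sum>z\<in>Z. inverse (emeasure \<nu> (?Q z)) * emeasure \<nu> (?Q z))"
        by (intro sum.cong refl nn_integral_cmult_indicator) (simp add: assms(2))
      also have "\<dots> \<le> (\<Sum>z\<in>Z. 1)"
      proof (rule sum_mono)
        fix z
        \<comment> \<open>For a null ball the reciprocal is \<open>top\<close>, but
          \<open>top * 0 = 0\<close> in \<open>ennreal\<close>.\<close>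
        show "inverse (emeasure \<nu> (?Q z)) * emeasure \<nu> (?Q z) \<le> 1"
        proof (cases "emeasure \<nu> (?Q z) = 0")
          case False
          have "emeasure \<nu> (?Q z) < top"
            using emeasure_finite[of "?Q z"] unfolding infinity_ennreal_def less_top .
          from ennreal_divide_self[OF False this] show ?thesis
            by (simp add: divide_ennreal_def mult.commute)
        qed simp
      qed
      finally show "(\<integral>\<^sup>+x. ?i x * indicator ?D (x, y) \<partial>\<nu>) \<le> of_nat (card Z)"
        by simp
    qed
    also have "\<dots> = of_nat (card Z) * emeasure \<nu> UNIV"
      by (simp add: space)
    finally show ?thesis .
  qed
  then show ?thesis by blast
qed

text \<open>The averaged ratio is bounded, so the geometric bound applies with base 1 and any larger
  \<open>b\<close>. The factor 4 leaves room for rounding to a dyadic radius and for the doubled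
  radius in \<open>scale_dominated_ball\<close>.\<close>

lemma AE_doubling:
  fixes \<nu> :: "'v::euclidean_space measure"
  assumes "finite_measure \<nu>" "sets \<nu> = sets borel" and b: "b > 1"
  shows "AE x in \<nu>. \<exists>K\<ge>0. \<forall>m. measure \<nu> (ball x (4 * (1/2) ^ m)) \<le> K * b ^ m * measure \<nu> (ball x ((1/2) ^ m))"
proof -
  interpret finite_measure \<nu> by fact
  have [measurable_cong]: "sets \<nu> = sets borel" by fact
  note [measurable] = emeasure_ball_measurable[OF assms(1,2)]
  obtain k :: nat where k: "\<And>r. r > 0 \<Longrightarrow>
    (\<integral>\<^sup>+x. inverse (emeasure \<nu> (ball x r)) * emeasure \<nu> (ball x (4 * r)) \<partial>\<nu>) \<le> of_nat k * emeasure \<nu> UNIV"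
    using nn_integral_ball_ratio_le[OF assms(1,2)] by blast
  have "AE x in \<nu>. \<exists>D\<ge>0. \<forall>m. inverse (emeasure \<nu> (ball x ((1/2) ^ m))) *
      emeasure \<nu> (ball x (4 * (1/2) ^ m)) \<le> ennreal (D * b ^ m)"
  proof (rule AE_geometric_bound[where a = 1 and C = "real k * measure \<nu> UNIV"])
    show "(\<integral>\<^sup>+x. inverse (emeasure \<nu> (ball x ((1/2) ^ m))) * emeasure \<nu> (ball x (4 * (1/2) ^ m)) \<partial>\<nu>)
         \<le> ennreal (real k * measure \<nu> UNIV * 1 ^ m)" for m
      using k[of "(1/2) ^ m"] by (simp add: emeasure_eq_measure ennreal_mult' ennreal_of_nat_eq_real_of_nat)
  qed (use b in auto)
  then show ?thesis
  proof eventually_elim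
    case (elim x)
    then obtain D where D: "D \<ge> 0" "\<And>m. inverse (emeasure \<nu> (ball x ((1/2) ^ m))) *
      emeasure \<nu> (ball x (4 * (1/2) ^ m)) \<le> ennreal (D * b ^ m)"
      by blast
    have "measure \<nu> (ball x (4 * (1/2) ^ m)) \<le> D * b ^ m * measure \<nu> (ball x ((1/2) ^ m))" for m
    proof -
      let ?e = "measure \<nu> (ball x ((1/2) ^ m))" and ?E = "measure \<nu> (ball x (4 * (1/2) ^ m))"
      have *: "inverse (ennreal ?e) * ennreal ?E \<le> ennreal (D * b ^ m)"
        using D(2)[of m] by (simp add: emeasure_eq_measure)
      show ?thesis
      proof (cases "?e = 0")
        case True
        \<comment> \<open>The reciprocal of a null mass is \<open>top\<close>, so the finite bound
          forces the larger ball to be null as well.\<close>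
        then have "?E = 0"
          using * by (cases "?E = 0") (auto simp: ennreal_top_mult top_unique)
        then show ?thesis using True by simp
      next
        case False
        then have "?e > 0" using measure_nonneg[of \<nu> "ball x ((1/2) ^ m)"] by linarith
        then have "ennreal (inverse ?e * ?E) \<le> ennreal (D * b ^ m)"
          using * by (simp add: inverse_ennreal ennreal_mult')
        then have "inverse ?e * ?E \<le> D * b ^ m"
          using D(1) b by (subst (asm) ennreal_le_iff) auto
        then show ?thesis using \<open>?e > 0\<close> by (simp add: field_simps)
      qed
    qed
    with D(1) show ?case by blast
  qed
qed


section \<open>Random projections\<close>

lemma orth_proj_eqI:
  assumes V: "subspace V" and y: "y \<in> V" "\<And>v. v \<in> V \<Longrightarrow> (x - y) \<bullet> v = 0"
  shows "orth_proj V x = y"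
  unfolding orth_proj_def
proof (rule the_equality)
  fix z assume z: "z \<in> V \<and> (\<forall>v\<in>V. (x - z) \<bullet> v = 0)"
  then have "z - y \<in> V" using V y(1) by (simp add: subspace_diff)
  then have "(z - y) \<bullet> (z - y) = 0"
    using z y(2)[of "z - y"] by (simp add: inner_diff_left)
  then show "z = y" by simp
qed (use y in auto)

lemma orth_proj_basis:
  fixes V :: "'v::euclidean_space set"
  assumes "subspace V"
  obtains B where "B \<subseteq> V" "finite B" "card B = dim V" "\<And>b. b \<in> B \<Longrightarrow> b \<bullet> b = 1"
    "\<And>b c. b \<in> B \<Longrightarrow> c \<in> B \<Longrightarrow> b \<noteq> c \<Longrightarrow> b \<bullet> c = 0"
    "\<And>x. orth_proj V x = (\<Sum>b\<in>B. (x \<bullet> b) *\<^sub>R b)"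
proof -
  obtain B where B: "B \<subseteq> V" "pairwise orthogonal B" "\<And>b. b \<in> B \<Longrightarrow> norm b = 1"
    "independent B" "card B = dim V" "span B = V"
    using orthonormal_basis_subspace[OF assms] by metis
  have fin: "finite B" using B(4) independent_imp_finite by blast
  have unit: "b \<bullet> b = 1" if "b \<in> B" for b
    using B(3)[OF that] by (simp add: norm_eq_1)
  have orth: "b \<bullet> c = 0" if "b \<in> B" "c \<in> B" "b \<noteq> c" for b c
    using B(2) that by (auto simp: pairwise_def orthogonal_def)
  have "orth_proj V x = (\<Sum>b\<in>B. (x \<bullet> b) *\<^sub>R b)" for x
  proof (rule orth_proj_eqI[OF assms])
    show "(\<Sum>b\<in>B. (x \<bullet> b) *\<^sub>R b) \<in> V"
      using B(1) assms by (intro subspace_sum subspace_scale) auto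
    fix v assume "v \<in> V"
    then have v: "v \<in> span B" using B(6) by simp
    have "(x - (\<Sum>b\<in>B. (x \<bullet> b) *\<^sub>R b)) \<bullet> c = 0" if c: "c \<in> B" for c
    proof -
      have "(\<Sum>b\<in>B. (x \<bullet> b) *\<^sub>R b) \<bullet> c = (\<Sum>b\<in>B. if b = c then x \<bullet> c else 0)"
        unfolding inner_sum_left by (rule sum.cong) (use unit orth c in auto)
      then show ?thesis using fin c by (simp add: inner_diff_left)
    qed
    then show "(x - (\<Sum>b\<in>B. (x \<bullet> b) *\<^sub>R b)) \<bullet> v = 0"
      using orthogonal_to_span[OF v] by (simp add: orthogonal_def)
  qed
  with B(1,5) fin unit orth show ?thesis using that by blast
qed

lemma linear_orth_proj:
  assumes "subspace (V :: 'v::euclidean_space set)"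
  shows "linear (orth_proj V)"
proof -
  obtain B where "\<And>x. orth_proj V x = (\<Sum>b\<in>B. (x \<bullet> b) *\<^sub>R b)"
    using orth_proj_basis[OF assms] by metis
  then have "orth_proj V = (\<lambda>x. \<Sum>b\<in>B. (x \<bullet> b) *\<^sub>R b)" by auto
  then show ?thesis
    by (auto intro!: linear_compose_sum linearI simp: inner_add_left algebra_simps)
qed

lemma continuous_on_orth_proj:
  "subspace (V :: 'v::euclidean_space set) \<Longrightarrow> continuous_on A (orth_proj V)"
  by (simp add: linear_orth_proj linear_continuous_on linear_linear)

lemma borel_measurable_orth_proj:
  fixes \<mu> :: "'v::euclidean_space measure"
  assumes "subspace V" "sets \<mu> = sets borel"
  shows "orth_proj V \<in> borel_measurable \<mu>"
proof -
  have "orth_proj V \<in> borel_measurable borel"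
    using assms(1) by (intro borel_measurable_continuous_onI continuous_on_orth_proj)
  then show ?thesis using measurable_cong_sets[OF assms(2) refl] by blast
qed

lemma orth_proj_props:
  assumes "subspace (V :: 'v::euclidean_space set)"
  shows "orth_proj V x \<in> V" "v \<in> V \<Longrightarrow> (x - orth_proj V x) \<bullet> v = 0"
proof -
  obtain B where B: "B \<subseteq> V" "finite B" "\<And>b. b \<in> B \<Longrightarrow> b \<bullet> b = 1"
    "\<And>b c. b \<in> B \<Longrightarrow> c \<in> B \<Longrightarrow> b \<noteq> c \<Longrightarrow> b \<bullet> c = 0"
    "\<And>x. orth_proj V x = (\<Sum>b\<in>B. (x \<bullet> b) *\<^sub>R b)"
    using orth_proj_basis[OF assms] by metis
  show "orth_proj V x \<in> V"
    unfolding B(5) using B(1) assms by (intro subspace_sum subspace_scale) auto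
  obtain y z where yz: "y \<in> span V" "\<And>w. w \<in> span V \<Longrightarrow> orthogonal z w" "x = y + z"
    using orthogonal_subspace_decomp_exists[of V x] by metis
  have "orth_proj V x = y"
    using yz assms by (intro orth_proj_eqI) (auto simp: orthogonal_def span_eq_iff[THEN iffD2])
  then show "(x - orth_proj V x) \<bullet> v = 0" if "v \<in> V"
    using yz that by (auto simp: orthogonal_def span_base)
qed

lemma norm_orth_proj_le:
  assumes "subspace (V :: 'v::euclidean_space set)"
  shows "norm (orth_proj V x) \<le> norm x"
proof -
  let ?y = "orth_proj V x"
  have "x \<bullet> ?y = ?y \<bullet> ?y"
    using orth_proj_props(2)[OF assms orth_proj_props(1)[OF assms], of x x] by (simp add: inner_diff_left)
  then have "norm ?y * norm ?y \<le> norm x * norm ?y"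
    using norm_cauchy_schwarz[of x ?y] by (simp add: power2_norm_eq_inner[symmetric] power2_eq_square)
  then show ?thesis
    by (cases "?y = 0") (auto simp: mult_le_cancel_right)
qed

lemma orth_proj_lipschitz:
  assumes "subspace (V :: 'v::euclidean_space set)"
  shows "dist (orth_proj V x) (orth_proj V y) \<le> dist x y"
  using norm_orth_proj_le[OF assms, of "x - y"] linear_diff[OF linear_orth_proj[OF assms], of x y]
  by (simp add: dist_norm)

lemma orth_proj_image:
  assumes T: "orthogonal_transformation T" and V: "subspace (V :: 'v::euclidean_space set)"
  shows "orth_proj (T ` V) (T x) = T (orth_proj V x)"
proof (rule orth_proj_eqI)
  have lin: "linear T" and inn: "\<And>x y. T x \<bullet> T y = x \<bullet> y"
    using T by (auto simp: orthogonal_transformation_def)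
  show "subspace (T ` V)" using lin V by (rule linear_subspace_image)
  show "T (orth_proj V x) \<in> T ` V" using orth_proj_props[OF V] by auto
  fix v assume "v \<in> T ` V"
  then obtain u where u: "u \<in> V" "v = T u" by auto
  then show "(T x - T (orth_proj V x)) \<bullet> v = 0"
    using orth_proj_props(2)[OF V u(1), of x] by (simp add: linear_diff[OF lin, symmetric] inn)
qed

text \<open>A slab around the orthogonal complement of \<open>V\<close> has about \<open>r powr -d\<close> disjoint translates along
  \<open>V\<close> by vectors of length at most 1.\<close>

lemma emeasure_slab_le:
  fixes V :: "'v::euclidean_space set"
  assumes V: "subspace V" "dim V = d" "d \<ge> 1" and r: "r > 0"
  shows "emeasure lborel {z \<in> ball 0 1. norm (orth_proj V z) < r}
    \<le> ennreal (measure lborel (ball (0::'v) 2) * (4 * real d * r) ^ d)"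
proof -
  let ?S = "{z \<in> ball 0 1. norm (orth_proj V z) < r}"
  let ?W = "measure lborel (ball (0::'v) 2)"
  have W: "emeasure lborel (ball (0::'v) 2) = ennreal ?W"
    by (intro emeasure_eq_ennreal_measure) (use emeasure_lborel_ball_finite[of "0::'v" 2] in \<open>simp add: less_top\<close>)
  note cont = continuous_on_orth_proj[OF V(1)]
  have S: "?S \<in> sets borel"
  proof -
    have "?S = ball 0 1 \<inter> {z. norm (orth_proj V z) < r}" by auto
    moreover have "open {z. norm (orth_proj V z) < r}"
      by (intro open_Collect_less continuous_intros cont)
    ultimately show ?thesis by auto
  qed
  have dr: "real d * r > 0" using V(3) r by simp
  show ?thesis
  proof (cases "2 * real d * r \<le> 1")
    \<comment> \<open>Wide slabs: the right-hand side is already at least the volume of the ball of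
      radius 2.\<close>
    case False
    then have ge1: "1 \<le> (4 * real d * r) ^ d" by (intro one_le_power) auto
    have "emeasure lborel ?S \<le> emeasure lborel (ball (0::'v) 2)"
      by (intro emeasure_mono) auto
    also have "\<dots> \<le> ennreal (?W * (4 * real d * r) ^ d)"
      unfolding W using ge1 by (intro ennreal_leI) (simp add: mult_le_cancel_left1)
    finally show ?thesis .
  next
    case True
    \<comment> \<open>Fewer than \<open>M\<close> grid steps of length \<open>2 * r\<close> in each
      of \<open>d\<close> directions give vectors of norm at most
      \<open>2 * d * r * M \<le> 1\<close>. As \<open>2 * d * r \<le> 1\<close>, rounding down loses
      at most a factor 2, whence the 4 in the bound.\<close>
    define M where "M = nat \<lfloor>1 / (2 * real d * r)\<rfloor>"
    have "1 \<le> 1 / (2 * real d * r)" using True dr by (simp add: field_simps)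
    then have M: "real M \<le> 1 / (2 * real d * r)" "1 / (2 * real d * r) < 2 * real M"
    proof -
      have "1 \<le> \<lfloor>1 / (2 * real d * r)\<rfloor>"
        using \<open>1 \<le> 1 / (2 * real d * r)\<close> unfolding le_floor_iff by simp
      moreover from this have "real M = of_int \<lfloor>1 / (2 * real d * r)\<rfloor>"
        unfolding M_def by linarith
      ultimately show "real M \<le> 1 / (2 * real d * r)" "1 / (2 * real d * r) < 2 * real M"
        by linarith+
    qed
    obtain B where B: "B \<subseteq> V" "finite B" "card B = dim V" "\<And>b. b \<in> B \<Longrightarrow> b \<bullet> b = 1"
      "\<And>b c. b \<in> B \<Longrightarrow> c \<in> B \<Longrightarrow> b \<noteq> c \<Longrightarrow> b \<bullet> c = 0"
      using orth_proj_basis[OF V(1)] by metis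
    \<comment> \<open>Spacing \<open>2 * r\<close>: the translated slabs project into open balls of
      radius \<open>r\<close> in \<open>V\<close> whose centres are at least \<open>2 * r\<close>
      apart, so they are disjoint.\<close>
    define v where "v k = (\<Sum>b\<in>B. (2 * r * real (k b)) *\<^sub>R b)" for k :: "'v \<Rightarrow> nat"
    let ?K = "B \<rightarrow>\<^sub>E {..<M}"
    have vV: "v k \<in> V" for k
      unfolding v_def using B(1) V(1) by (intro subspace_sum subspace_scale) auto
    have inn: "v k \<bullet> b = 2 * r * real (k b)" if "b \<in> B" for k b
    proof -
      have "v k \<bullet> b = (\<Sum>c\<in>B. if c = b then 2 * r * real (k b) else 0)"
        unfolding v_def inner_sum_left by (rule sum.cong) (use B(4,5) that in auto)
      then show ?thesis using B(2) that by simp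
    qed
    have proj: "orth_proj V (x + v k) = orth_proj V x + v k" for x k
    proof -
      have "orth_proj V (v k) = v k"
        by (rule orth_proj_eqI[OF V(1) vV]) simp
      then show ?thesis using linear_add[OF linear_orth_proj[OF V(1)]] by simp
    qed
    have small: "norm (v k) \<le> 1" if "k \<in> ?K" for k
    proof -
      have "norm (v k) \<le> (\<Sum>b\<in>B. 2 * r * real M)"
        unfolding v_def
      proof (rule order_trans[OF norm_sum], rule sum_mono)
        fix b assume "b \<in> B"
        then have "norm b = 1" "k b < M" using B(4) that by (auto simp: norm_eq_1 PiE_iff)
        then show "norm ((2 * r * real (k b)) *\<^sub>R b) \<le> 2 * r * real M" using r by simp
      qed
      also have "\<dots> = 2 * real d * r * real M" using B(3) V(2) by simp
      also have "\<dots> \<le> 1" using M(1) dr by (simp add: field_simps)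
      finally show ?thesis .
    qed
    define T where "T k = (+) (- v k) -` ?S" for k
    have T: "T k \<in> sets borel" "emeasure lborel (T k) = emeasure lborel ?S" for k
    proof -
      have "(+) (- v k) \<in> borel \<rightarrow>\<^sub>M borel" by measurable
      from measurable_sets[OF this S] show "T k \<in> sets borel" by (simp add: T_def)
      have "emeasure lborel ?S = emeasure (distr lborel borel ((+) (- v k))) ?S"
        by (simp add: lborel_distr_plus)
      also have "\<dots> = emeasure lborel (T k)"
        using S by (subst emeasure_distr) (auto simp: T_def)
      finally show "emeasure lborel (T k) = emeasure lborel ?S" by simp
    qed
    have disj: "disjoint_family_on T ?K"
      unfolding disjoint_family_on_def
    proof (intro ballI impI)
      fix k k' assume k: "k \<in> ?K" "k' \<in> ?K" "k \<noteq> k'"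
      then obtain b where b: "b \<in> B" "k b \<noteq> k' b" by (metis PiE_ext)
      show "T k \<inter> T k' = {}"
      proof (rule ccontr)
        assume "T k \<inter> T k' \<noteq> {}"
        then obtain z where z: "- v k + z \<in> ?S" "- v k' + z \<in> ?S" by (auto simp: T_def)
        have "orth_proj V z = orth_proj V (- v k + z) + v k" "orth_proj V z = orth_proj V (- v k' + z) + v k'"
          using proj[of "- v k + z" k] proj[of "- v k' + z" k'] by simp_all
        then have "v k - v k' = orth_proj V (- v k' + z) - orth_proj V (- v k + z)"
          by (simp add: algebra_simps)
        then have "norm (v k - v k') \<le> norm (orth_proj V (- v k' + z)) + norm (orth_proj V (- v k + z))"
          by (metis norm_triangle_ineq4)
        also have "\<dots> < 2 * r" using z by simp
        finally have "norm (v k - v k') < 2 * r" .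
        moreover have "\<bar>(v k - v k') \<bullet> b\<bar> \<le> norm (v k - v k') * norm b"
          by (rule Cauchy_Schwarz_ineq2)
        moreover have "norm b = 1" using B(4) b by (simp add: norm_eq_1)
        moreover have "(v k - v k') \<bullet> b = 2 * r * (real (k b) - real (k' b))"
          using inn b by (simp add: inner_diff_left algebra_simps)
        moreover have "1 \<le> \<bar>real (k b) - real (k' b)\<bar>" using b(2) by linarith
        then have "2 * r * 1 \<le> 2 * r * \<bar>real (k b) - real (k' b)\<bar>"
          using r by (intro mult_left_mono) auto
        ultimately show False
          using r by (simp add: abs_mult)
      qed
    qed
    have finK: "finite ?K" using B(2) by (intro finite_PiE) auto
    have "of_nat (card ?K) * emeasure lborel ?S = (\<Sum>k\<in>?K. emeasure lborel (T k))"
      by (simp add: T(2))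
    also have "\<dots> = emeasure lborel (\<Union>k\<in>?K. T k)"
      using T(1) by (intro sum_emeasure disj finK) auto
    also have "\<dots> \<le> emeasure lborel (ball (0::'v) 2)"
    proof (intro emeasure_mono UN_least subsetI)
      fix k z assume "k \<in> ?K" "z \<in> T k"
      then have "norm (- v k + z) < 1" "norm (v k) \<le> 1" using small by (auto simp: T_def)
      then show "z \<in> ball 0 2" using norm_triangle_ineq[of "- v k + z" "v k"] by simp
    qed simp
    finally have *: "of_nat (card ?K) * emeasure lborel ?S \<le> ennreal ?W" unfolding W .
    have cardK: "card ?K = M ^ d" using B(2,3) V(2) by (simp add: card_PiE)
    have "emeasure lborel ?S \<le> emeasure lborel (ball (0::'v) 2)" by (intro emeasure_mono) auto
    then obtain s where s: "emeasure lborel ?S = ennreal s" "s \<ge> 0"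
      unfolding W by (metis ennreal_cases ennreal_less_top not_le top.not_eq_extremum top_unique)
    have "real M ^ d * s \<le> ?W"
      using * s(2) unfolding cardK s(1) ennreal_of_nat_eq_real_of_nat
      by (simp add: ennreal_le_iff flip: ennreal_mult')
    have "1 \<le> 4 * real d * r * real M" using M(2) dr by (simp add: field_simps)
    then have "1 \<le> (4 * real d * r * real M) ^ d" by (rule one_le_power)
    then have "s \<le> (4 * real d * r * real M) ^ d * s" using s(2) by (simp add: mult_le_cancel_right1)
    also have "\<dots> = (4 * real d * r) ^ d * (real M ^ d * s)" by (simp add: power_mult_distrib)
    also have "\<dots> \<le> (4 * real d * r) ^ d * ?W"
      using \<open>real M ^ d * s \<le> ?W\<close> r by (intro mult_left_mono zero_le_power) auto
    finally show ?thesis unfolding s(1) by (intro ennreal_leI) (simp add: mult.commute)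
  qed
qed

section \<open>The invariant measure on the Grassmannian\<close>

context
  fixes \<gamma> :: "(real ^ 'n) set measure" and d :: nat
  assumes \<gamma>: "Grassmannian_invariant_measure d \<gamma>"
begin

lemma sets_Grassmannian: "sets \<gamma> = sets (Grassmannian_borel d)"
  using \<gamma> by (simp add: Grassmannian_invariant_measure_def)

lemma space_Grassmannian: "space \<gamma> = Grassmannian d"
  using sets_eq_imp_space_eq[OF sets_Grassmannian] by (simp add: Grassmannian_borel_def)

lemma prob_space_Grassmannian: "prob_space \<gamma>"
  using \<gamma> by (simp add: Grassmannian_invariant_measure_def)

lemma subspace_Grassmannian: "V \<in> space \<gamma> \<Longrightarrow> subspace V" "V \<in> space \<gamma> \<Longrightarrow> dim V = d"
  by (auto simp: space_Grassmannian Grassmannian_def)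

lemma blinfun_orth_proj_apply: "V \<in> space \<gamma> \<Longrightarrow> blinfun_apply (Blinfun (orth_proj V)) x = orth_proj V x"
  using linear_orth_proj[OF subspace_Grassmannian(1)]
  by (simp add: bounded_linear_Blinfun_apply linear_conv_bounded_linear)

lemma blinfun_orth_proj_measurable: "(\<lambda>V. Blinfun (orth_proj V)) \<in> borel_measurable \<gamma>"
  unfolding measurable_cong_sets[OF sets_Grassmannian refl] Grassmannian_borel_def
  by (rule measurable_vimage_algebra1) simp

lemma orth_proj_measurable: "(\<lambda>V. orth_proj V x) \<in> borel_measurable \<gamma>"
proof -
  have "(\<lambda>F :: (real ^ 'n) \<Rightarrow>\<^sub>L (real ^ 'n). blinfun_apply F x) \<in> borel_measurable borel"
    by (intro borel_measurable_continuous_onI continuous_intros)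
  from measurable_compose[OF blinfun_orth_proj_measurable this] show ?thesis
    by (rule measurable_cong[THEN iffD1, rotated]) (simp add: blinfun_orth_proj_apply)
qed

text \<open>For fixed \<open>V\<close> the projection is linear, so joint measurability reduces to
  the projections of finitely many basis vectors.\<close>

lemma orth_proj_measurable_pair [measurable]:
  assumes [measurable]: "f \<in> measurable M \<gamma>" "g \<in> borel_measurable M"
  shows "(\<lambda>x. orth_proj (f x) (g x)) \<in> borel_measurable M"
proof -
  have "orth_proj (f x) (g x) = (\<Sum>b\<in>Basis. (g x \<bullet> b) *\<^sub>R orth_proj (f x) b)" if "x \<in> space M" for x
  proof -
    have "f x \<in> space \<gamma>" using assms(1) that by (rule measurable_space)
    then have lin: "linear (orth_proj (f x))" by (intro linear_orth_proj subspace_Grassmannian)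
    have "orth_proj (f x) (g x) = orth_proj (f x) (\<Sum>b\<in>Basis. (g x \<bullet> b) *\<^sub>R b)"
      by (simp add: euclidean_representation)
    then show ?thesis by (simp only: linear_sum[OF lin] linear_scale[OF lin])
  qed
  moreover have "(\<lambda>x. \<Sum>b\<in>Basis. (g x \<bullet> b) *\<^sub>R orth_proj (f x) b) \<in> borel_measurable M"
    using measurable_compose[OF assms(1) orth_proj_measurable] by measurable
  ultimately show ?thesis by (subst measurable_cong) auto
qed

text \<open>In terms of projections, moving \<open>V\<close> by \<open>T\<close> is conjugation by
  \<open>T\<close>, a continuous map on operators.\<close>

lemma orthogonal_image_measurable:
  fixes T :: "real ^ 'n \<Rightarrow> real ^ 'n"
  assumes T: "orthogonal_transformation T"
  shows "(\<lambda>V. T ` V) \<in> measurable \<gamma> \<gamma>"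
proof -
  have lin: "linear T" using T by (simp add: orthogonal_transformation_linear)
  have bij: "bij T" using T by (rule orthogonal_transformation_bij)
  have Ti: "orthogonal_transformation (inv T)" using T by (rule orthogonal_transformation_inv)
  have dimT: "dim (T ` V) = dim V" for V
    using lin bij by (intro dim_image_eq) (auto simp: bij_def intro: inj_on_subset)
  have "(\<lambda>V. T ` V) \<in> measurable \<gamma> (Grassmannian_borel d)"
    unfolding Grassmannian_borel_def
  proof (rule measurable_vimage_algebra2)
    show "(\<lambda>V. T ` V) \<in> space \<gamma> \<rightarrow> Grassmannian d"
      using lin dimT by (auto simp: space_Grassmannian Grassmannian_def linear_subspace_image)
    let ?F = "\<lambda>F. Blinfun T o\<^sub>L F o\<^sub>L Blinfun (inv T)"
    have F: "?F \<in> borel_measurable borel"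
      by (intro borel_measurable_continuous_onI continuous_intros)
    have eq: "Blinfun (orth_proj (T ` V)) = ?F (Blinfun (orth_proj V))" if V: "V \<in> space \<gamma>" for V
    proof (rule blinfun_eqI)
      fix x
      have sub: "subspace V" "subspace (T ` V)"
        using subspace_Grassmannian(1)[OF V] lin by (auto simp: linear_subspace_image)
      have "T (orth_proj V (inv T x)) = orth_proj (T ` V) x"
        using orth_proj_image[OF T sub(1), of "inv T x"] bij by (simp add: bij_is_surj surj_f_inv_f)
      then show "blinfun_apply (Blinfun (orth_proj (T ` V))) x = blinfun_apply (?F (Blinfun (orth_proj V))) x"
        using linear_orth_proj[OF sub(1)] linear_orth_proj[OF sub(2)] lin
          orthogonal_transformation_linear[OF Ti]
        by (simp add: bounded_linear_Blinfun_apply linear_conv_bounded_linear)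
    qed
    show "(\<lambda>V. Blinfun (orth_proj (T ` V))) \<in> borel_measurable \<gamma>"
      using measurable_compose[OF blinfun_orth_proj_measurable F]
      by (rule measurable_cong[THEN iffD1, rotated]) (simp add: eq)
  qed
  then show ?thesis
    using measurable_cong_sets[OF refl sets_Grassmannian] by blast
qed

text \<open>Orthogonal transformations act transitively on spheres.\<close>

lemma emeasure_orth_proj_rotate:
  fixes z z' :: "real ^ 'n"
  assumes "norm z = norm z'"
  shows "emeasure \<gamma> {V \<in> space \<gamma>. norm (orth_proj V z) < r} = emeasure \<gamma> {V \<in> space \<gamma>. norm (orth_proj V z') < r}"
proof -
  let ?A = "\<lambda>z. {V \<in> space \<gamma>. norm (orth_proj V z) < r}"
  obtain T where T: "orthogonal_transformation T" "T z = z'"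
    using orthogonal_transformation_exists[OF assms] by blast
  have inv: "distr \<gamma> \<gamma> (\<lambda>V. T ` V) = \<gamma>"
    using \<gamma> T(1) by (simp add: Grassmannian_invariant_measure_def)
  note m = orthogonal_image_measurable[OF T(1)]
  have S: "?A z' \<in> sets \<gamma>"
    using orth_proj_measurable[of z'] by measurable
  have "emeasure \<gamma> (?A z')
      = emeasure (distr \<gamma> \<gamma> (\<lambda>V. T ` V)) (?A z')"
    by (simp add: inv)
  also have "\<dots> = emeasure \<gamma> ((\<lambda>V. T ` V) -` ?A z' \<inter> space \<gamma>)"
    by (rule emeasure_distr[OF m S])
  also have "(\<lambda>V. T ` V) -` ?A z' \<inter> space \<gamma>
      = ?A z"
  proof -
    have "norm (orth_proj (T ` V) z') = norm (orth_proj V z)" if "V \<in> space \<gamma>" for V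
      using orth_proj_image[OF T(1) subspace_Grassmannian(1)[OF that], of z] T
      by (simp add: orthogonal_transformation_norm)
    then show ?thesis using measurable_space[OF m] by auto
  qed
  finally show ?thesis by simp
qed

text \<open>By invariance the probability below depends only on \<open>r / norm z\<close>; averaging over \<open>z\<close> in the
  unit ball reduces the estimate to the volume of slabs.\<close>

lemma emeasure_orth_proj_small:
  assumes d: "d \<ge> 1"
  shows "\<exists>C\<ge>1. \<forall>z r. z \<noteq> 0 \<longrightarrow> r > 0 \<longrightarrow>
    emeasure \<gamma> {V \<in> space \<gamma>. norm (orth_proj V z) < r} \<le> ennreal (C * (r / norm z) ^ d)"
proof -
  interpret prob_space \<gamma> by (rule prob_space_Grassmannian)
  interpret pair_sigma_finite \<gamma> "lborel :: (real ^ 'n) measure" ..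
  note [measurable] = orth_proj_measurable
  define W1 where "W1 = measure lborel (ball (0 :: real ^ 'n) 1)"
  have W1: "emeasure lborel (ball (0 :: real ^ 'n) 1) = ennreal W1"
    unfolding W1_def using emeasure_lborel_ball_finite[of "0 :: real ^ 'n" 1]
    by (intro emeasure_eq_ennreal_measure) (simp add: less_top)
  have "W1 > 0"
  proof -
    have "emeasure lborel (ball (0 :: real ^ 'n) 1) \<noteq> 0"
      using open_not_negligible[of "ball (0 :: real ^ 'n) 1"] by (auto simp: negligible_iff_null_sets null_sets_def emeasure_completion)
    then show ?thesis using W1 by (metis ennreal_eq_0_iff linorder_not_less)
  qed
  define W2 where "W2 = measure lborel (ball (0 :: real ^ 'n) 2)"
  define C where "C = max 1 (W2 * (4 * real d) ^ d / W1)"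
  have unit: "emeasure \<gamma> {V \<in> space \<gamma>. norm (orth_proj V e) < r} \<le> ennreal (C * r ^ d)"
    if e: "norm e = 1" and r: "r > 0" for e r
  proof -
    let ?A = "\<lambda>z. {V \<in> space \<gamma>. norm (orth_proj V z) < r}"
    let ?H = "emeasure \<gamma> (?A e)"
    let ?E = "{p :: (real ^ 'n) set \<times> (real ^ 'n). snd p \<in> ball 0 1 \<and> norm (orth_proj (fst p) (snd p)) < r}"
    let ?F = "?E \<inter> space (\<gamma> \<Otimes>\<^sub>M lborel)"
    have E: "?F \<in> sets (\<gamma> \<Otimes>\<^sub>M lborel)"
    proof -
      have snd: "snd \<in> borel_measurable (\<gamma> \<Otimes>\<^sub>M (lborel :: (real ^ 'n) measure))"
        using measurable_snd by (simp cong: measurable_cong_sets)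
      have [measurable]: "(\<lambda>p. orth_proj (fst p) (snd p)) \<in> borel_measurable (\<gamma> \<Otimes>\<^sub>M (lborel :: (real ^ 'n) measure))"
        by (rule orth_proj_measurable_pair[OF measurable_fst snd])
      note [measurable] = snd
      have "?F = {p \<in> space (\<gamma> \<Otimes>\<^sub>M lborel). norm (snd p) < 1 \<and> norm (orth_proj (fst p) (snd p)) < r}"
        by auto
      also have "\<dots> \<in> sets (\<gamma> \<Otimes>\<^sub>M lborel)" by measurable
      finally show ?thesis .
    qed
    \<comment> \<open>For \<open>z\<close> in the unit ball, the projection of \<open>z\<close> is
      no longer than that of its direction \<open>u\<close>, so the event for \<open>z\<close>
      contains the one for \<open>u\<close>, which by rotation is as probable as the one for
      \<open>e\<close>. Integrating over \<open>z\<close> bounds the double integral below.\<close>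
    have "?H * ennreal W1 = (\<integral>\<^sup>+z. ?H * indicator (ball 0 1) z \<partial>(lborel :: (real ^ 'n) measure))"
      by (subst nn_integral_cmult_indicator) (auto simp: W1)
    also have "\<dots> \<le> (\<integral>\<^sup>+z. \<integral>\<^sup>+V. indicator ?F (V, z) \<partial>\<gamma> \<partial>(lborel :: (real ^ 'n) measure))"
    proof (rule nn_integral_mono)
      fix z :: "real ^ 'n"
      show "?H * indicator (ball 0 1) z \<le> (\<integral>\<^sup>+V. indicator ?F (V, z) \<partial>\<gamma>)"
      proof (cases "norm z < 1")
        case True
        have "?H \<le> emeasure \<gamma> (?A z)"
        proof (cases "z = 0")
          case True
          have "orth_proj V 0 = 0" if "V \<in> space \<gamma>" for V
            using linear_0[OF linear_orth_proj[OF subspace_Grassmannian(1)[OF that]]] .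
          then have "?A z = space \<gamma>" using True r by auto
          then show ?thesis by (simp add: emeasure_space)
        next
          case False
          let ?u = "z /\<^sub>R norm z"
          have "?H = emeasure \<gamma> (?A ?u)"
            using False e by (intro emeasure_orth_proj_rotate) simp
          also have "\<dots> \<le> emeasure \<gamma> (?A z)"
          proof (rule emeasure_mono)
            show "?A ?u \<subseteq> ?A z"
            proof clarify
              fix V assume V: "V \<in> space \<gamma>" "norm (orth_proj V ?u) < r"
              have "orth_proj V z = norm z *\<^sub>R orth_proj V ?u"
                using linear_scale[OF linear_orth_proj[OF subspace_Grassmannian(1)[OF V(1)]], of "norm z" ?u] False by simp
              then have "norm (orth_proj V z) = norm z * norm (orth_proj V ?u)" by simp
              also have "\<dots> \<le> 1 * norm (orth_proj V ?u)"
                using \<open>norm z < 1\<close> by (intro mult_right_mono) auto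
              finally show "norm (orth_proj V z) < r" using V(2) by simp
            qed
          qed measurable
          finally show ?thesis .
        qed
        also have "\<dots> = (\<integral>\<^sup>+V. indicator (?A z) V \<partial>\<gamma>)"
          by (rule nn_integral_indicator[symmetric]) measurable
        also have "\<dots> = (\<integral>\<^sup>+V. indicator ?F (V, z) \<partial>\<gamma>)"
          using True by (intro nn_integral_cong) (auto simp: indicator_def space_pair_measure)
        finally show ?thesis using True by simp
      qed simp
    qed
    \<comment> \<open>In this order the inner integral is the volume of a slab, bounded uniformly in
      \<open>V\<close>.\<close>
    also have "\<dots> = (\<integral>\<^sup>+V. \<integral>\<^sup>+z. indicator ?F (V, z) \<partial>(lborel :: (real ^ 'n) measure) \<partial>\<gamma>)"
      by (rule Fubini') (use E in \<open>simp add: case_prod_unfold\<close>)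
    also have "\<dots> \<le> (\<integral>\<^sup>+V. ennreal (W2 * (4 * real d * r) ^ d) \<partial>\<gamma>)"
    proof (rule nn_integral_mono)
      fix V assume V: "V \<in> space \<gamma>"
      let ?S = "{z \<in> ball 0 1. norm (orth_proj V z) < r}"
      have "(\<integral>\<^sup>+z. indicator ?F (V, z) \<partial>lborel) = (\<integral>\<^sup>+z. indicator ?S z \<partial>lborel)"
        using V by (intro nn_integral_cong) (auto simp: indicator_def space_pair_measure)
      also have "\<dots> = emeasure lborel ?S"
      proof (rule nn_integral_indicator)
        have "?S = ball 0 1 \<inter> {z. norm (orth_proj V z) < r}" by auto
        moreover have "open {z. norm (orth_proj V z) < r}"
          by (intro open_Collect_less continuous_intros continuous_on_orth_proj subspace_Grassmannian(1)[OF V])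
        ultimately show "?S \<in> sets lborel" by auto
      qed
      also have "\<dots> \<le> ennreal (W2 * (4 * real d * r) ^ d)"
        using V d r unfolding W2_def by (intro emeasure_slab_le subspace_Grassmannian) auto
      finally show "(\<integral>\<^sup>+z. indicator ?F (V, z) \<partial>lborel)
          \<le> ennreal (W2 * (4 * real d * r) ^ d)" .
    qed
    also have "\<dots> = ennreal (W2 * (4 * real d * r) ^ d)"
      by (simp add: emeasure_space_1)
    finally have *: "?H * ennreal W1 \<le> ennreal (W2 * (4 * real d * r) ^ d)" .
    obtain h where h: "?H = ennreal h" "h \<ge> 0"
      using emeasure_eq_measure measure_nonneg by blast
    have "h * W1 \<le> W2 * (4 * real d * r) ^ d"
      using * h r \<open>W1 > 0\<close> by (simp add: W2_def ennreal_le_iff flip: ennreal_mult)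
    then have "h \<le> (W2 * (4 * real d) ^ d / W1) * r ^ d"
      using \<open>W1 > 0\<close> by (simp add: field_simps power_mult_distrib)
    also have "\<dots> \<le> C * r ^ d"
      unfolding C_def using r by (intro mult_right_mono) auto
    finally show ?thesis unfolding h(1) by (rule ennreal_leI)
  qed
  have "emeasure \<gamma> {V \<in> space \<gamma>. norm (orth_proj V z) < r} \<le> ennreal (C * (r / norm z) ^ d)"
    if z: "z \<noteq> 0" and r: "r > 0" for z r
  proof -
    let ?u = "z /\<^sub>R norm z"
    have "norm (orth_proj V z) < r \<longleftrightarrow> norm (orth_proj V ?u) < r / norm z" if V: "V \<in> space \<gamma>" for V
    proof -
      have "orth_proj V z = norm z *\<^sub>R orth_proj V ?u"
        using linear_scale[OF linear_orth_proj[OF subspace_Grassmannian(1)[OF V]], of "norm z" ?u] z by simp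
      then have "norm (orth_proj V z) = norm z * norm (orth_proj V ?u)" by simp
      then show ?thesis using z by (simp add: pos_less_divide_eq mult.commute)
    qed
    then have "{V \<in> space \<gamma>. norm (orth_proj V z) < r} = {V \<in> space \<gamma>. norm (orth_proj V ?u) < r / norm z}"
      by blast
    then show ?thesis using unit[of ?u "r / norm z"] z r by simp
  qed
  moreover have "C \<ge> 1" by (simp add: C_def)
  ultimately show ?thesis by blast
qed

end


section \<open>Energy of projections and dimension of subspaces\<close>

text \<open>Truncated at radius \<open>(1/2) ^ m\<close> and with explicit \<open>K\<close>, since a
  comparison of two measures at this scale carries no information on smaller balls.\<close>

definition frost_upto :: "'x::metric_space measure \<Rightarrow> real \<Rightarrow> real \<Rightarrow> nat \<Rightarrow> 'x set" where
  "frost_upto \<nu> K a m = {x. \<forall>j\<le>m. measure \<nu> (ball x ((1/2) ^ j)) \<le> K * a ^ j}"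

lemma frost_upto_sets:
  fixes \<nu> :: "'v::euclidean_space measure"
  assumes "finite_measure \<nu>" "sets \<nu> = sets borel"
  shows "frost_upto \<nu> K a m \<in> sets borel"
proof -
  note [measurable] = measure_ball_measurable[OF assms]
  have "frost_upto \<nu> K a m = {x \<in> space borel. \<forall>j\<in>{..m}. measure \<nu> (ball x ((1/2) ^ j)) \<le> K * a ^ j}"
    by (auto simp: frost_upto_def)
  also have "\<dots> \<in> sets borel" by measurable
  finally show ?thesis .
qed

definition slab_indicator :: "real \<Rightarrow> 'v::euclidean_space set \<Rightarrow> 'v \<Rightarrow> 'v \<Rightarrow> ennreal" where
  "slab_indicator r V x y = indicator {..<r} (norm (orth_proj V (x - y)))"

text \<open>A correlation integral at the single scale \<open>(1/2) ^ m\<close>: the product mass of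
  pairs with close projections, the first point being restricted to where \<nu> has controlled
  balls.\<close>

definition projection_energy ::
    "'v::euclidean_space measure \<Rightarrow> real \<Rightarrow> real \<Rightarrow> nat \<Rightarrow> 'v set \<Rightarrow> ennreal" where
  "projection_energy \<nu> K a m V = (\<integral>\<^sup>+x. indicator (frost_upto \<nu> K a m) x *
    (\<integral>\<^sup>+y. slab_indicator ((1/2) ^ m) V x y \<partial>\<nu>) \<partial>\<nu>)"

text \<open>Splitting into dyadic annuli around \<open>x\<close>, the probability that the projections of \<open>x\<close> and \<open>y\<close>
  are close is small on all but the inner annuli.\<close>

lemma nn_integral_slab_le:
  fixes \<nu> :: "(real ^ 'n) measure"
  assumes \<gamma>: "Grassmannian_invariant_measure d \<gamma>" and d: "d \<ge> 1"
    and \<nu>: "prob_space \<nu>" "sets \<nu> = sets borel" and a: "(1/2) ^ d < a" and K: "K \<ge> 0"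
  shows "\<exists>C\<ge>0. \<forall>m. \<forall>x\<in>frost_upto \<nu> K a m.
    (\<integral>\<^sup>+y. \<integral>\<^sup>+V. slab_indicator ((1/2) ^ m) V x y \<partial>\<gamma> \<partial>\<nu>) \<le> ennreal (C * a ^ m)"
proof -
  interpret \<nu>: prob_space \<nu> by fact
  interpret \<gamma>: prob_space \<gamma> by (rule prob_space_Grassmannian[OF \<gamma>])
  note [measurable] = orth_proj_measurable[OF \<gamma>]
  have [measurable_cong]: "sets \<nu> = sets borel" by fact
  obtain C where C: "C \<ge> 1" "\<And>z r. z \<noteq> 0 \<Longrightarrow> r > 0 \<Longrightarrow>
    emeasure \<gamma> {V \<in> space \<gamma>. norm (orth_proj V z) < r} \<le> ennreal (C * (r / norm z) ^ d)"
    using emeasure_orth_proj_small[OF \<gamma> d] by blast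
  define e :: real where "e = (1/2) ^ d"
  have e: "0 < e" "e < a" using a by (auto simp: e_def)
  \<comment> \<open>The factor \<open>2 ^ d\<close> pays for replacing a distance by a dyadic lower
    bound.\<close>
  define c where "c = C * 2 ^ d"
  have c: "c \<ge> 1" "C \<le> c"
    using C(1) mult_mono[of 1 C 1 "2 ^ d :: real"] mult_left_mono[of 1 "2 ^ d" C] by (auto simp: c_def)
  \<comment> \<open>A geometric series of ratio \<open>e / a\<close>, less than 1 because the
    exponent of \<open>a\<close> is below \<open>d\<close>, plus the contribution of points at
    distance at least 1.\<close>
  define C' where "C' = c * K / (1 - e / a) + c"
  have "C' \<ge> 0" using c K e by (simp add: C'_def)
  have "(\<integral>\<^sup>+y. \<integral>\<^sup>+V. slab_indicator ((1/2) ^ m) V x y \<partial>\<gamma> \<partial>\<nu>) \<le> ennreal (C' * a ^ m)"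
    if x: "x \<in> frost_upto \<nu> K a m" for m x
  proof -
    let ?s = "\<lambda>j. ball x ((1/2) ^ (m - j))"
    \<comment> \<open>The index \<open>j\<close> counts dyadic scales upwards from
      \<open>(1/2) ^ m\<close>: at distance about \<open>(1/2) ^ (m - j)\<close> the probability is
      at most \<open>c * e ^ j\<close>.\<close>
    let ?T = "\<lambda>y. \<Sum>j\<le>m. ennreal (c * e ^ j) * indicator (?s j) y"
    have "(\<integral>\<^sup>+V. slab_indicator ((1/2) ^ m) V x y \<partial>\<gamma>)
      \<le> ?T y + ennreal (c * e ^ m)" for y
    proof -
      let ?r = "(1/2) ^ m :: real"
      let ?I = "\<integral>\<^sup>+V. slab_indicator ?r V x y \<partial>\<gamma>"
      have "?I = (\<integral>\<^sup>+V. indicator {V \<in> space \<gamma>. norm (orth_proj V (x - y)) < ?r} V \<partial>\<gamma>)"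
        by (intro nn_integral_cong) (auto simp: slab_indicator_def indicator_def)
      also have "\<dots> = emeasure \<gamma> {V \<in> space \<gamma>. norm (orth_proj V (x - y)) < ?r}"
        by (rule nn_integral_indicator) measurable
      finally have eq: "?I = emeasure \<gamma> {V \<in> space \<gamma>. norm (orth_proj V (x - y)) < ?r}" .
      have bd: "?I \<le> ennreal (C * (?r / dist x y) ^ d)" if "x \<noteq> y"
        unfolding eq dist_norm using C(2)[of "x - y" ?r] that by simp
      have tm: "?I
        \<le> ?T y + ennreal (c * e ^ m)"
        if j: "?I \<le> ennreal (c * e ^ j)" "j \<le> m" "y \<in> ?s j" for j
      proof -
        have "ennreal (c * e ^ j) = ennreal (c * e ^ j) * indicator (?s j) y" using j(3) by simp
        also have "\<dots> \<le> ?T y"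
          using j(2) by (intro member_le_sum) auto
        also have "\<dots> \<le> ?T y + ennreal (c * e ^ m)"
          by (rule add_increasing2) simp_all
        finally show ?thesis using j(1) by (rule order_trans[rotated])
      qed
      show ?thesis
      proof (cases "dist x y \<ge> 1")
        case True
        then have "(?r / dist x y) ^ d \<le> (?r / 1) ^ d"
          by (intro power_mono divide_left_mono) auto
        also have "\<dots> = e ^ m" by (simp add: e_def flip: power_mult) (simp add: mult.commute)
        finally have "C * (?r / dist x y) ^ d \<le> c * e ^ m"
          using c C(1) by (intro mult_mono) auto
        moreover have "x \<noteq> y" using True by auto
        ultimately have "?I \<le> ennreal (c * e ^ m)"
          using bd by (meson ennreal_leI order_trans)
        then show ?thesis by (simp add: add_increasing)
      next
        case far: False
        show ?thesis
        proof (cases "dist x y < ?r")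
          case True
          have "?I \<le> 1"
            unfolding eq by (rule \<gamma>.emeasure_le_1)
          also have "\<dots> \<le> ennreal (c * e ^ 0)" using c by simp
          finally show ?thesis by (rule tm) (use True in auto)
        next
          case False
          then have "0 < dist x y"
            by (metis less_le_trans not_le zero_less_divide_1_iff zero_less_numeral zero_less_power)
          obtain i where i: "(1/2) ^ Suc i \<le> dist x y" "dist x y < (1/2) ^ i"
            using dyadic_scale[of "dist x y"] \<open>0 < dist x y\<close> far by auto
          have "i \<le> m"
          proof (rule ccontr)
            assume "\<not> i \<le> m"
            then have "(1/2 :: real) ^ i \<le> ?r" by (intro power_decreasing) auto
            then show False using i(2) False by linarith
          qed
          have "?r / dist x y \<le> ?r / (1/2) ^ Suc i"
            using i(1) \<open>0 < dist x y\<close> by (intro divide_left_mono) auto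
          also have "\<dots> = 2 * (1/2) ^ (m - i)"
            using \<open>i \<le> m\<close> by (simp add: power_diff field_simps)
          finally have "(?r / dist x y) ^ d \<le> (2 * (1/2) ^ (m - i)) ^ d"
            by (intro power_mono) auto
          also have "\<dots> = 2 ^ d * e ^ (m - i)"
            by (simp only: e_def power_mult_distrib power_mult[symmetric] mult.commute)
          finally have "C * (?r / dist x y) ^ d \<le> c * e ^ (m - i)"
            using C(1) by (simp add: c_def mult_left_mono)
          moreover have "x \<noteq> y" using \<open>0 < dist x y\<close> by auto
          ultimately have "?I \<le> ennreal (c * e ^ (m - i))"
            using bd by (meson ennreal_leI order_trans)
          then show ?thesis by (rule tm) (use i(2) \<open>i \<le> m\<close> in auto)
        qed
      qed
    qed
    then have "(\<integral>\<^sup>+y. \<integral>\<^sup>+V. slab_indicator ((1/2) ^ m) V x y \<partial>\<gamma> \<partial>\<nu>)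
      \<le> (\<integral>\<^sup>+y. ?T y + ennreal (c * e ^ m) \<partial>\<nu>)"
      by (rule nn_integral_mono)
    also have "\<dots> = (\<integral>\<^sup>+y. ?T y \<partial>\<nu>) + (\<integral>\<^sup>+y. ennreal (c * e ^ m) \<partial>\<nu>)"
      by (intro nn_integral_add borel_measurable_sum borel_measurable_times_ennreal borel_measurable_const
          borel_measurable_indicator) (auto simp: \<nu>(2))
    also have "(\<integral>\<^sup>+y. ennreal (c * e ^ m) \<partial>\<nu>) = ennreal (c * e ^ m)"
      by (simp add: \<nu>.emeasure_space_1)
    also have "(\<integral>\<^sup>+y. ?T y \<partial>\<nu>)
        = (\<Sum>j\<le>m. \<integral>\<^sup>+y. ennreal (c * e ^ j) * indicator (?s j) y \<partial>\<nu>)"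
      by (intro nn_integral_sum borel_measurable_times_ennreal borel_measurable_const
          borel_measurable_indicator) (auto simp: \<nu>(2))
    also have "\<dots> = (\<Sum>j\<le>m. ennreal (c * e ^ j) * emeasure \<nu> (?s j))"
      by (intro sum.cong refl nn_integral_cmult_indicator) (simp add: \<nu>(2))
    also have "\<dots> \<le> (\<Sum>j\<le>m. ennreal (c * K * a ^ m * (e / a) ^ j))"
    proof (rule sum_mono)
      fix j assume j: "j \<in> {..m}"
      have "measure \<nu> (?s j) \<le> K * a ^ (m - j)"
        using x by (simp add: frost_upto_def)
      then have "ennreal (c * e ^ j) * emeasure \<nu> (?s j) \<le> ennreal (c * e ^ j) * ennreal (K * a ^ (m - j))"
        unfolding \<nu>.emeasure_eq_measure by (intro mult_left_mono ennreal_leI) auto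
      also have "\<dots> = ennreal (c * e ^ j * (K * a ^ (m - j)))"
        using c e by (intro ennreal_mult'[symmetric]) auto
      also have "c * e ^ j * (K * a ^ (m - j)) = c * K * a ^ m * (e / a) ^ j"
        using j e by (simp add: power_diff power_divide)
      finally show "ennreal (c * e ^ j) * emeasure \<nu> (?s j) \<le> ennreal (c * K * a ^ m * (e / a) ^ j)" .
    qed
    also have "\<dots> = ennreal (\<Sum>j\<le>m. c * K * a ^ m * (e / a) ^ j)"
      using c K e by (intro sum_ennreal) auto
    also have "\<dots> + ennreal (c * e ^ m) \<le> ennreal (C' * a ^ m)"
    proof -
      have "(\<Sum>j\<le>m. (e / a) ^ j) \<le> 1 / (1 - e / a)"
        using sum_le_suminf[OF summable_geometric[of "e / a"], of "{..m}"] suminf_geometric[of "e / a"] e by simp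
      then have "c * K * a ^ m * (\<Sum>j\<le>m. (e / a) ^ j) \<le> c * K * a ^ m * (1 / (1 - e / a))"
        using c K e by (intro mult_left_mono) auto
      moreover have "c * e ^ m \<le> c * a ^ m"
        using c e by (intro mult_left_mono power_mono) auto
      ultimately have "(\<Sum>j\<le>m. c * K * a ^ m * (e / a) ^ j) + c * e ^ m \<le> C' * a ^ m"
        by (simp add: C'_def algebra_simps sum_distrib_left)
      moreover have "0 \<le> (\<Sum>j\<le>m. c * K * a ^ m * (e / a) ^ j)" "0 \<le> c * e ^ m"
        using c K e by (auto intro!: sum_nonneg)
      ultimately show ?thesis
        by (simp add: ennreal_leI flip: ennreal_plus)
    qed
    finally show ?thesis by (simp add: add_right_mono)
  qed
  with \<open>C' \<ge> 0\<close> show ?thesis by blast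
qed

text \<open>By Fubini the average over \<open>V\<close> is the slab estimate integrated over the
  good points \<open>x\<close>; the geometric bound then passes from the average to almost every
  \<open>V\<close>.\<close>

lemma AE_projection_energy:
  fixes \<nu> :: "(real ^ 'n) measure"
  assumes \<gamma>: "Grassmannian_invariant_measure d \<gamma>" and d: "d \<ge> 1"
    and \<nu>: "prob_space \<nu>" "sets \<nu> = sets borel" and a: "(1/2) ^ d < a" "a < a'" and K: "K \<ge> 0"
  shows "AE V in \<gamma>. \<exists>D\<ge>0. \<forall>m. projection_energy \<nu> K a m V \<le> ennreal (D * a' ^ m)"
proof -
  interpret \<nu>: prob_space \<nu> by fact
  interpret \<gamma>: prob_space \<gamma> by (rule prob_space_Grassmannian[OF \<gamma>])
  interpret pair_sigma_finite \<gamma> \<nu> ..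
  obtain C where C: "C \<ge> 0" "\<And>m x. x \<in> frost_upto \<nu> K a m \<Longrightarrow>
    (\<integral>\<^sup>+y. \<integral>\<^sup>+V. slab_indicator ((1/2) ^ m) V x y \<partial>\<gamma> \<partial>\<nu>) \<le> ennreal (C * a ^ m)"
    using nn_integral_slab_le[OF \<gamma> d \<nu> a(1) K] by blast
  have "0 < a" using a(1) by (meson less_trans zero_less_divide_1_iff zero_less_numeral zero_less_power)
  have S: "frost_upto \<nu> K a m \<in> sets \<nu>" for m
    using frost_upto_sets[OF \<nu>.finite_measure_axioms \<nu>(2)] \<nu>(2) by simp
  have id: "(\<lambda>x. x) \<in> borel_measurable \<nu>"
    using \<nu>(2) by (simp add: measurable_def sets_eq_imp_space_eq[OF \<nu>(2)])
  let ?M = "(\<gamma> \<Otimes>\<^sub>M \<nu>) \<Otimes>\<^sub>M \<nu>"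
  have m3: "(\<lambda>p. slab_indicator r (fst (fst p)) (snd (fst p)) (snd p)) \<in> borel_measurable ?M" for r
  proof -
    have "(\<lambda>p. snd (fst p)) \<in> borel_measurable ?M" "(\<lambda>p. snd p) \<in> borel_measurable ?M"
      by (intro measurable_compose[OF _ id]; measurable)+
    then have "(\<lambda>p. orth_proj (fst (fst p)) (snd (fst p) - snd p)) \<in> borel_measurable ?M"
      by (intro orth_proj_measurable_pair[OF \<gamma>] borel_measurable_diff
          measurable_compose[OF measurable_fst measurable_fst])
    then show ?thesis unfolding slab_indicator_def by measurable
  qed
  have m2: "(\<lambda>p. \<integral>\<^sup>+y. slab_indicator r (fst p) (snd p) y \<partial>\<nu>) \<in> borel_measurable (\<gamma> \<Otimes>\<^sub>M \<nu>)" for r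
    using m3[of r] by (intro \<nu>.borel_measurable_nn_integral) (simp add: case_prod_unfold)
  have m2': "(\<lambda>p. indicator (frost_upto \<nu> K a m) (snd p) * (\<integral>\<^sup>+y. slab_indicator r (fst p) (snd p) y \<partial>\<nu>))
      \<in> borel_measurable (\<gamma> \<Otimes>\<^sub>M \<nu>)" for r m
    using S by (intro borel_measurable_times_ennreal m2 measurable_compose[OF measurable_snd] borel_measurable_indicator)
  show ?thesis
    unfolding projection_energy_def
  proof (rule AE_geometric_bound[OF _ \<open>0 < a\<close> a(2)])
    fix m
    let ?A = "frost_upto \<nu> K a m" and ?f = "slab_indicator ((1/2) ^ m)"
    show "(\<lambda>V. \<integral>\<^sup>+x. indicator ?A x * (\<integral>\<^sup>+y. ?f V x y \<partial>\<nu>) \<partial>\<nu>) \<in> borel_measurable \<gamma>"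
      using m2'[of m "(1/2) ^ m"] by (intro \<nu>.borel_measurable_nn_integral) (simp add: case_prod_unfold)
    have "(\<integral>\<^sup>+V. \<integral>\<^sup>+x. indicator ?A x * (\<integral>\<^sup>+y. ?f V x y \<partial>\<nu>) \<partial>\<nu> \<partial>\<gamma>)
        = (\<integral>\<^sup>+x. \<integral>\<^sup>+V. indicator ?A x * (\<integral>\<^sup>+y. ?f V x y \<partial>\<nu>) \<partial>\<gamma> \<partial>\<nu>)"
      using m2'[of m "(1/2) ^ m"] by (intro Fubini'[symmetric]) (simp add: case_prod_unfold)
    also have "\<dots> \<le> (\<integral>\<^sup>+x. ennreal (C * a ^ m) \<partial>\<nu>)"
    proof (rule nn_integral_mono)
      fix x assume x: "x \<in> space \<nu>"
      have f: "(\<lambda>p. ?f (fst p) x (snd p)) \<in> borel_measurable (\<gamma> \<Otimes>\<^sub>M \<nu>)"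
      proof -
        have "(\<lambda>p. ((fst p, x), snd p)) \<in> measurable (\<gamma> \<Otimes>\<^sub>M \<nu>) ?M"
          using x by measurable
        from measurable_compose[OF this m3] show ?thesis by simp
      qed
      have "(\<integral>\<^sup>+V. indicator ?A x * (\<integral>\<^sup>+y. ?f V x y \<partial>\<nu>) \<partial>\<gamma>) = indicator ?A x * (\<integral>\<^sup>+V. \<integral>\<^sup>+y. ?f V x y \<partial>\<nu> \<partial>\<gamma>)"
        using f by (intro nn_integral_cmult \<nu>.borel_measurable_nn_integral) (simp add: case_prod_unfold)
      also have "(\<integral>\<^sup>+V. \<integral>\<^sup>+y. ?f V x y \<partial>\<nu> \<partial>\<gamma>) = (\<integral>\<^sup>+y. \<integral>\<^sup>+V. ?f V x y \<partial>\<gamma> \<partial>\<nu>)"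
        using f by (intro Fubini'[symmetric]) (simp add: case_prod_unfold)
      also have "indicator ?A x * \<dots> \<le> ennreal (C * a ^ m)"
        using C(2)[of x m] by (auto simp: indicator_def)
      finally show "(\<integral>\<^sup>+V. indicator ?A x * (\<integral>\<^sup>+y. ?f V x y \<partial>\<nu>) \<partial>\<gamma>) \<le> ennreal (C * a ^ m)" .
    qed
    also have "\<dots> = ennreal (C * a ^ m)" by (simp add: \<nu>.emeasure_space_1)
    finally show "(\<integral>\<^sup>+V. \<integral>\<^sup>+x. indicator ?A x * (\<integral>\<^sup>+y. ?f V x y \<partial>\<nu>) \<partial>\<nu> \<partial>\<gamma>) \<le> ennreal (C * a ^ m)" .
  qed
qed

text \<open>A bounded part of a subspace of dimension \<open>d\<close> is covered by about \<open>2 ^ (m * d)\<close> sets of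
  diameter less than \<open>2 ^ -m\<close>, namely cells of a grid with respect to an orthonormal basis.\<close>

lemma AE_not_frost:
  fixes \<nu> :: "'v::euclidean_space measure"
  assumes \<nu>: "finite_measure \<nu>" "sets \<nu> = sets borel" and V: "subspace V" "dim V = d"
    and supp: "AE x in \<nu>. x \<in> V \<and> norm x \<le> R" and a: "0 < a" "a < (1/2) ^ d"
  shows "AE x in \<nu>. \<not> frost \<nu> a x"
proof -
  interpret finite_measure \<nu> by fact
  note [measurable] = measure_ball_measurable[OF \<nu>]
  obtain B where B: "finite B" "card B = dim V" "\<And>b. b \<in> B \<Longrightarrow> b \<bullet> b = 1"
    "\<And>x. orth_proj V x = (\<Sum>b\<in>B. (x \<bullet> b) *\<^sub>R b)"
    using orth_proj_basis[OF V(1)] by metis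
  obtain N :: nat where N: "max R 1 \<le> real N" using real_arch_simple by blast
  \<comment> \<open>The \<open>(2 * N * M + 1) ^ d\<close> cells number at most
    \<open>(3 * N * M) ^ d\<close>, which equals \<open>q * (2 ^ d) ^ m\<close>.\<close>
  define q where "q = (3 * real N * real (Suc d)) ^ d"
  define S where "S k = {x. \<forall>m. measure \<nu> (ball x ((1/2) ^ m)) \<le> real k * a ^ m} \<inter> (V \<inter> cball 0 R)" for k :: nat
  have S: "S k \<in> sets \<nu>" for k
  proof -
    have "{x. \<forall>m. measure \<nu> (ball x ((1/2) ^ m)) \<le> real k * a ^ m}
        = {x \<in> space borel. \<forall>m. measure \<nu> (ball x ((1/2) ^ m)) \<le> real k * a ^ m}" by simp
    also have "\<dots> \<in> sets borel" by measurable
    finally show ?thesis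
      unfolding S_def \<nu>(2) using closed_subspace[OF V(1)] by (intro sets.Int) auto
  qed
  have bound: "measure \<nu> (S k) \<le> q * real k * (2 ^ d * a) ^ m" for k m
  proof -
    \<comment> \<open>\<open>Suc d\<close> instead of \<open>d\<close>: two points of a cell are at
      distance at most \<open>d / M\<close>, which has to be strictly less than
      \<open>(1/2) ^ m\<close>.\<close>
    define M where "M = Suc d * 2 ^ m"
    have "0 < M" by (simp add: M_def)
    define \<iota> where "\<iota> x = (\<lambda>b\<in>B. \<lfloor>(x \<bullet> b) * real M\<rfloor>)" for x :: 'v
    let ?G = "B \<rightarrow>\<^sub>E {- int (N * M)..int (N * M)}"
    have "\<iota> ` S k \<subseteq> ?G"
    proof (intro image_subsetI PiE_I)
      fix x b assume x: "x \<in> S k" and b: "b \<in> B"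
      have "\<bar>x \<bullet> b\<bar> \<le> norm x * norm b" by (rule Cauchy_Schwarz_ineq2)
      also have "norm b = 1" using B(3)[OF b] by (simp add: norm_eq_1)
      also have "norm x * 1 \<le> real N" using x N by (auto simp: S_def)
      finally have "\<bar>x \<bullet> b\<bar> * real M \<le> real N * real M" by (intro mult_right_mono) auto
      then have "\<bar>(x \<bullet> b) * real M\<bar> \<le> real (N * M)" by (simp add: abs_mult)
      then have "- real (N * M) \<le> (x \<bullet> b) * real M" "(x \<bullet> b) * real M \<le> real (N * M)" by linarith+
      then have "- int (N * M) \<le> \<lfloor>(x \<bullet> b) * real M\<rfloor>" "\<lfloor>(x \<bullet> b) * real M\<rfloor> \<le> int (N * M)"
        by (simp add: le_floor_iff, linarith)
      then show "\<iota> x b \<in> {- int (N * M)..int (N * M)}" using b by (simp add: \<iota>_def)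
    qed (simp add: \<iota>_def)
    moreover have "finite ?G" using B(1) by (intro finite_PiE) auto
    ultimately have fin: "finite (\<iota> ` S k)" and card: "card (\<iota> ` S k) \<le> card ?G"
      by (auto intro: finite_subset card_mono)
    have "card ?G = (2 * N * M + 1) ^ d"
      using B(1,2) V(2) by (simp add: card_PiE algebra_simps nat_add_distrib nat_mult_distrib)
    moreover have "1 \<le> N * M" using N \<open>0 < M\<close> by simp
    then have "1 \<le> real (N * M)" by linarith
    then have "real (2 * N * M + 1) \<le> 3 * real N * real M" by (simp add: mult.commute)
    then have "real ((2 * N * M + 1) ^ d) \<le> (3 * real N * real M) ^ d" by (simp add: power_mono)
    moreover have "(3 * real N * real M) ^ d = q * (2 ^ d) ^ m"
    proof -
      have "(3 * real N * real M) ^ d = (3 * real N * real (Suc d) * 2 ^ m) ^ d"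
        by (simp add: M_def mult.assoc distrib_right)
      also have "\<dots> = q * (2 ^ m) ^ d" unfolding q_def by (rule power_mult_distrib)
      also have "(2 ^ m) ^ d = ((2 :: real) ^ d) ^ m" by (simp add: mult.commute flip: power_mult)
      finally show ?thesis .
    qed
    ultimately have card': "real (card (\<iota> ` S k)) \<le> q * (2 ^ d) ^ m" using card by linarith
    \<comment> \<open>The centres are taken in \<open>S k\<close> itself, where the masses of small
      balls are controlled.\<close>
    define x where "x i = (SOME x. x \<in> S k \<and> \<iota> x = i)" for i
    have x: "x i \<in> S k" "\<iota> (x i) = i" if "i \<in> \<iota> ` S k" for i
      using someI_ex[of "\<lambda>x. x \<in> S k \<and> \<iota> x = i"] that by (auto simp: x_def)
    have cover: "S k \<subseteq> (\<Union>i\<in>\<iota> ` S k. ball (x i) ((1/2) ^ m))"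
    proof
      fix y assume y: "y \<in> S k"
      define z where "z = x (\<iota> y)"
      have z: "z \<in> S k" "\<iota> z = \<iota> y" using x y by (auto simp: z_def)
      have "orth_proj V z - orth_proj V y = (\<Sum>b\<in>B. ((z - y) \<bullet> b) *\<^sub>R b)"
        unfolding B(4) by (simp add: inner_diff_left scaleR_diff_left sum_subtractf)
      moreover have "orth_proj V z = z" "orth_proj V y = y"
        using y z(1) by (auto simp: S_def intro!: orth_proj_eqI[OF V(1)])
      ultimately have "z - y = (\<Sum>b\<in>B. ((z - y) \<bullet> b) *\<^sub>R b)" by simp
      then have "norm (z - y) = norm (\<Sum>b\<in>B. ((z - y) \<bullet> b) *\<^sub>R b)" by (rule arg_cong)
      also have "\<dots> \<le> (\<Sum>b\<in>B. norm (((z - y) \<bullet> b) *\<^sub>R b))" by (rule norm_sum)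
      also have "\<dots> \<le> (\<Sum>b\<in>B. 1 / real M)"
      proof (rule sum_mono)
        fix b assume b: "b \<in> B"
        have "\<lfloor>(z \<bullet> b) * real M\<rfloor> = \<lfloor>(y \<bullet> b) * real M\<rfloor>"
          using fun_cong[OF z(2), of b] b by (simp add: \<iota>_def)
        then have "\<bar>(z \<bullet> b) * real M - (y \<bullet> b) * real M\<bar> \<le> 1" by linarith
        then have "\<bar>(z - y) \<bullet> b\<bar> * real M \<le> 1"
          by (simp add: inner_diff_left abs_mult flip: left_diff_distrib)
        moreover have "norm b = 1" using B(3)[OF b] by (simp add: norm_eq_1)
        moreover have "real M > 0" using \<open>0 < M\<close> by simp
        ultimately show "norm (((z - y) \<bullet> b) *\<^sub>R b) \<le> 1 / real M" by (simp add: field_simps)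
      qed
      also have "\<dots> = real d / real M" using B(2) V(2) by simp
      also have "\<dots> < real (Suc d) / real M"
        using \<open>0 < M\<close> by (intro divide_strict_right_mono) auto
      also have "\<dots> = (1/2) ^ m"
        unfolding M_def of_nat_mult by (simp add: power_one_over del: of_nat_Suc)
      finally show "y \<in> (\<Union>i\<in>\<iota> ` S k. ball (x i) ((1/2) ^ m))"
        using y by (auto simp: z_def dist_norm)
    qed
    have "measure \<nu> (S k) \<le> measure \<nu> (\<Union>i\<in>\<iota> ` S k. ball (x i) ((1/2) ^ m))"
      using cover by (intro finite_measure_mono) (auto simp: \<nu>(2) intro!: borel_open)
    also have "\<dots> \<le> (\<Sum>i\<in>\<iota> ` S k. measure \<nu> (ball (x i) ((1/2) ^ m)))"
      using fin by (intro finite_measure_subadditive_finite) (auto simp: \<nu>(2))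
    also have "\<dots> \<le> (\<Sum>i\<in>\<iota> ` S k. real k * a ^ m)"
    proof (rule sum_mono)
      fix i assume "i \<in> \<iota> ` S k"
      then show "measure \<nu> (ball (x i) ((1/2) ^ m)) \<le> real k * a ^ m"
        using x(1) by (simp add: S_def)
    qed
    also have "\<dots> = real (card (\<iota> ` S k)) * (real k * a ^ m)" by simp
    also have "\<dots> \<le> q * (2 ^ d) ^ m * (real k * a ^ m)"
      using card' a by (intro mult_right_mono) auto
    finally show ?thesis by (simp add: power_mult_distrib mult_ac)
  qed
  have null: "emeasure \<nu> (S k) = 0" for k
  proof -
    have "2 ^ d * a < 1" using a by (simp add: field_simps)
    then have "(\<lambda>m. q * real k * (2 ^ d * a) ^ m) \<longlonglongrightarrow> q * real k * 0"
      using a by (intro tendsto_mult tendsto_const LIMSEQ_realpow_zero) auto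
    then have "measure \<nu> (S k) \<le> q * real k * 0"
      using bound by (intro LIMSEQ_le_const[of _ "q * real k * 0"]) auto
    then have "measure \<nu> (S k) = 0" using measure_nonneg[of \<nu> "S k"] by linarith
    then show ?thesis by (simp add: emeasure_eq_measure)
  qed
  then have "AE x in \<nu>. \<forall>k. x \<notin> S k"
    unfolding AE_all_countable using S by (auto intro!: AE_not_in simp: null_sets_def)
  with supp show ?thesis
  proof eventually_elim
    case (elim x)
    show ?case
    proof
      assume "frost \<nu> a x"
      then obtain K where K: "\<And>m. measure \<nu> (ball x ((1/2) ^ m)) \<le> K * a ^ m"
        unfolding frost_def by blast
      obtain k :: nat where "K \<le> real k" using real_arch_simple by blast
      then have "K * a ^ m \<le> real k * a ^ m" for m using a by (intro mult_right_mono) auto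
      then have "measure \<nu> (ball x ((1/2) ^ m)) \<le> real k * a ^ m" for m
        using K order_trans by blast
      then have "x \<in> S k" using elim(1) by (simp add: S_def)
      then show False using elim(2) by blast
    qed
  qed
qed


section \<open>Comparable measures\<close>

text \<open>A comparison blurred at scale \<open>(1/2) ^ m\<close>. Pairs of test functions, rather
  than sets, allow its use in both variables of a double integral, where \<open>h\<close> is itself
  an integral.\<close>

definition scale_dominated :: "real \<Rightarrow> real \<Rightarrow> ('v::euclidean_space) measure \<Rightarrow> 'v measure \<Rightarrow> bool" where
  "scale_dominated C b \<mu> \<nu> \<longleftrightarrow> (\<forall>m. \<forall>h\<in>borel_measurable borel. \<forall>h'\<in>borel_measurable borel.
     (\<forall>z z'. dist z z' < (1/2) ^ m \<longrightarrow> h z \<le> h' z') \<longrightarrow>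
     (\<integral>\<^sup>+z. h z \<partial>\<mu>) \<le> ennreal (C * b ^ m) * (\<integral>\<^sup>+z. h' z \<partial>\<nu>))"

lemma scale_dominatedD:
  assumes "scale_dominated C b \<mu> \<nu>" "h \<in> borel_measurable borel" "h' \<in> borel_measurable borel"
    and "\<And>z z'. dist z z' < (1/2) ^ m \<Longrightarrow> h z \<le> h' z'"
  shows "(\<integral>\<^sup>+z. h z \<partial>\<mu>) \<le> ennreal (C * b ^ m) * (\<integral>\<^sup>+z. h' z \<partial>\<nu>)"
  using assms unfolding scale_dominated_def by blast

lemma scale_dominated_measure:
  assumes "scale_dominated C b \<mu> \<nu>" "C > 0" "b > 0"
    and "finite_measure \<mu>" "finite_measure \<nu>" "sets \<mu> = sets borel" "sets \<nu> = sets borel"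
    and S: "S \<in> sets borel" "S' \<in> sets borel"
    and sub: "\<And>z z'. z \<in> S \<Longrightarrow> dist z z' < (1/2) ^ m \<Longrightarrow> z' \<in> S'"
  shows "measure \<mu> S \<le> C * b ^ m * measure \<nu> S'"
proof -
  interpret \<mu>: finite_measure \<mu> by fact
  interpret \<nu>: finite_measure \<nu> by fact
  have "(\<integral>\<^sup>+z. indicator S z \<partial>\<mu>) \<le> ennreal (C * b ^ m) * (\<integral>\<^sup>+z. indicator S' z \<partial>\<nu>)"
    by (rule scale_dominatedD[OF assms(1)]) (use S sub in \<open>auto simp: indicator_def\<close>)
  then have "ennreal (measure \<mu> S) \<le> ennreal (C * b ^ m) * ennreal (measure \<nu> S')"
    using S assms(6,7) by (simp add: \<mu>.emeasure_eq_measure \<nu>.emeasure_eq_measure)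
  then show ?thesis
    using assms(2,3) by (simp add: ennreal_le_iff flip: ennreal_mult)
qed

lemma scale_dominated_ball:
  assumes "scale_dominated C b \<mu> \<nu>" "C > 0" "b > 0"
    and "finite_measure \<mu>" "finite_measure \<nu>" "sets \<mu> = sets borel" "sets \<nu> = sets borel"
  shows "measure \<mu> (ball x ((1/2) ^ m)) \<le> C * b ^ m * measure \<nu> (ball x (2 * (1/2) ^ m))"
proof (rule scale_dominated_measure[OF assms])
  fix z z' assume "z \<in> ball x ((1/2) ^ m)" "dist z z' < (1/2) ^ m"
  then show "z' \<in> ball x (2 * (1/2) ^ m)"
    using dist_triangle[of x z' z] by simp
qed auto

section \<open>Relative dimension of comparable measures\<close>

definition log_ratio :: "'x::metric_space measure \<Rightarrow> 'x measure \<Rightarrow> 'x \<Rightarrow> real \<Rightarrow> ereal" where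
  "log_ratio \<mu> \<nu> x r =
     elog_quotient (measure \<mu> (ball x r)) (measure \<nu> (ball x r)) / ereal (ln r)"

text \<open>The definition of \<open>relative_dim\<close> also demands \<open>lo \<le> hi\<close>;
  this holds because the filters behind the limits are proper, the almost-everywhere filter since
  \<mu> is a probability measure.\<close>

lemma relative_dim_le:
  assumes "prob_space \<mu>" and \<epsilon>: "0 < \<epsilon>" "\<epsilon> < \<epsilon>'"
    and AE: "AE x in \<mu>. \<forall>\<^sub>F r in at_right 0. - ereal \<epsilon> \<le> log_ratio \<mu> \<nu> x r \<and>
      log_ratio \<mu> \<nu> x r \<le> ereal \<epsilon>"
  shows "relative_dim \<mu> \<nu> \<le> ereal \<epsilon>'"
proof -
  have bot: "ae_filter \<mu> \<noteq> bot" using assms(1) by (rule prob_space.ae_filter_bot)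
  let ?lo = "\<lambda>x. Liminf (at_right 0) (log_ratio \<mu> \<nu> x)"
  let ?hi = "\<lambda>x. Limsup (at_right 0) (log_ratio \<mu> \<nu> x)"
  have lo: "- ereal \<epsilon> \<le> ess_inf \<mu> ?lo"
    unfolding ess_inf_def
  proof (rule Liminf_bounded)
    show "AE x in \<mu>. - ereal \<epsilon> \<le> Liminf (at_right 0) (log_ratio \<mu> \<nu> x)"
      using AE by eventually_elim (auto intro!: Liminf_bounded elim: eventually_mono)
  qed
  have hi: "ess_sup \<mu> ?hi \<le> ereal \<epsilon>"
    unfolding ess_sup_def
  proof (rule Limsup_bounded)
    show "AE x in \<mu>. Limsup (at_right 0) (log_ratio \<mu> \<nu> x) \<le> ereal \<epsilon>"
      using AE by eventually_elim (auto intro!: Limsup_bounded elim: eventually_mono)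
  qed
  have "ess_inf \<mu> ?lo \<le> ess_inf \<mu> ?hi"
    unfolding ess_inf_def by (intro Liminf_mono always_eventually allI Liminf_le_Limsup) simp
  also have "\<dots> \<le> ess_sup \<mu> ?hi"
    unfolding ess_inf_def ess_sup_def by (rule Liminf_le_Limsup[OF bot])
  finally have mid: "ess_inf \<mu> ?lo \<le> ess_sup \<mu> ?hi" .
  have less: "- ereal \<epsilon>' < - ereal \<epsilon>" "ereal \<epsilon> < ereal \<epsilon>'" using \<epsilon> by auto
  have "- ereal \<epsilon>' < ess_inf \<mu> ?lo"
      "ess_sup \<mu> ?hi < ereal \<epsilon>'"
    by (rule less_le_trans[OF less(1) lo], rule le_less_trans[OF hi less(2)])
  with mid \<epsilon> show ?thesis
    unfolding relative_dim_def Let_def log_ratio_def[symmetric] by (intro Inf_lower) auto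
qed

text \<open>Each domination doubles the radius. The almost sure doubling of \<mu> alone repairs both
  directions: it shrinks the ball before \<mu> is dominated by \<nu>, and after \<nu> has been
  dominated by \<mu>.\<close>

lemma relative_dim_scale_dominated:
  fixes \<mu> \<nu> :: "'v::euclidean_space measure"
  assumes \<mu>: "prob_space \<mu>" "sets \<mu> = sets borel" and \<nu>: "prob_space \<nu>" "sets \<nu> = sets borel"
    and pos: "AE x in \<mu>. \<forall>r>0. measure \<mu> (ball x r) > 0 \<and> measure \<nu> (ball x r) > 0"
    and C: "C > 0" and \<epsilon>: "\<epsilon> > 0" and b: "b = 2 powr \<epsilon>"
    and dom: "scale_dominated C b \<mu> \<nu>" "scale_dominated C b \<nu> \<mu>"
  shows "relative_dim \<mu> \<nu> \<le> ereal (4 * \<epsilon>)"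
proof -
  interpret \<mu>: prob_space \<mu> by fact
  interpret \<nu>: prob_space \<nu> by fact
  have b1: "b > 1" using \<epsilon> by (simp add: b)
  then have b0: "b > 0" by simp
  note fin = \<mu>.finite_measure_axioms \<nu>.finite_measure_axioms
  note d1 = scale_dominated_ball[OF dom(1) C b0 fin \<mu>(2) \<nu>(2)]
  note d2 = scale_dominated_ball[OF dom(2) C b0 fin(2,1) \<nu>(2) \<mu>(2)]
  have m1: "measure \<mu> (ball x r) \<le> measure \<mu> (ball x r')" if "r \<le> r'" for x r r'
    using that by (intro \<mu>.finite_measure_mono) (auto simp: \<mu>(2))
  have m2: "measure \<nu> (ball x r) \<le> measure \<nu> (ball x r')" if "r \<le> r'" for x r r'
    using that by (intro \<nu>.finite_measure_mono) (auto simp: \<nu>(2))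
  show ?thesis
  \<comment> \<open>Domination and doubling each lose about \<open>b ^ m\<close>, together
    \<open>2 * \<epsilon>\<close> in the exponent; the third \<epsilon> absorbs the constant
    \<open>L\<close>.\<close>
  proof (rule relative_dim_le[OF \<mu>(1), of "3 * \<epsilon>"])
    show "AE x in \<mu>. \<forall>\<^sub>F r in at_right 0. - ereal (3 * \<epsilon>) \<le> log_ratio \<mu> \<nu> x r \<and>
      log_ratio \<mu> \<nu> x r \<le> ereal (3 * \<epsilon>)"
      using AE_doubling[OF fin(1) \<mu>(2) b1] pos
    proof eventually_elim
      case (elim x)
      then obtain K where K: "K \<ge> 0"
        "\<And>m. measure \<mu> (ball x (4 * (1/2) ^ m)) \<le> K * b ^ m * measure \<mu> (ball x ((1/2) ^ m))"
        by blast
      have pos: "measure \<mu> (ball x r) > 0" "measure \<nu> (ball x r) > 0" if "r > 0" for r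
        using elim(2) that by auto
      define L where "L = K * C * b ^ 4 + 1"
      have L: "L \<ge> 1" using K C b0 by (simp add: L_def)
      have ratio: "measure \<mu> (ball x r) \<le> L * r powr (- 2 * \<epsilon>) * measure \<nu> (ball x r)"
          "measure \<nu> (ball x r) \<le> L * r powr (- 2 * \<epsilon>) * measure \<mu> (ball x r)"
        if r: "0 < r" "r < 1" for r
      proof -
        obtain m where m: "(1/2) ^ Suc m \<le> r" "r < (1/2) ^ m"
          using dyadic_scale[OF r] .
        have "b ^ (2 * m) = ((1/2 :: real) ^ m) powr (- 2 * \<epsilon>)"
        proof -
          have "((1/2 :: real) ^ m) powr (- 2 * \<epsilon>) = (2 powr (- real m)) powr (- 2 * \<epsilon>)"
            by (simp add: powr_minus powr_realpow power_one_over inverse_eq_divide)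
          also have "\<dots> = (2 powr \<epsilon>) powr (real (2 * m))"
            by (simp add: powr_powr mult_ac)
          also have "\<dots> = b ^ (2 * m)" unfolding b by (rule powr_realpow) simp
          finally show ?thesis ..
        qed
        also have "\<dots> \<le> r powr (- 2 * \<epsilon>)"
          using m r \<epsilon> by (intro powr_mono2') auto
        finally have bm: "b ^ (2 * m) \<le> r powr (- 2 * \<epsilon>)" .
        have conv: "K * C * b ^ j * b ^ (2 * m) * t \<le> L * r powr (- 2 * \<epsilon>) * t" if "j \<le> 4" "t \<ge> 0" for j t
        proof -
          have "b ^ j \<le> b ^ 4" using b1 that by (intro power_increasing) auto
          then have "K * C * b ^ j \<le> L"
            using K C mult_left_mono[of "b ^ j" "b ^ 4" "K * C"] by (simp add: L_def)
          then show ?thesis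
            using bm that L b0 by (intro mult_right_mono mult_mono) auto
        qed
        \<comment> \<open>With \<open>m + 2\<close>, four times the dyadic radius still exceeds
          \<open>r\<close> while twice that radius is at most \<open>r\<close>.\<close>
        have "measure \<mu> (ball x r) \<le> measure \<mu> (ball x (4 * (1/2) ^ (m + 2)))"
          using m by (intro m1) (simp add: power_add)
        also have "\<dots> \<le> K * b ^ (m + 2) * measure \<mu> (ball x ((1/2) ^ (m + 2)))" by (rule K(2))
        also have "\<dots> \<le> K * b ^ (m + 2) * (C * b ^ (m + 2) * measure \<nu> (ball x (2 * (1/2) ^ (m + 2))))"
          using K(1) b0 by (intro mult_left_mono d1) auto
        also have "\<dots> \<le> K * b ^ (m + 2) * (C * b ^ (m + 2) * measure \<nu> (ball x r))"
          using K(1) b0 C m by (intro mult_left_mono m2) (auto simp: power_add)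
        also have "\<dots> = K * C * b ^ 4 * b ^ (2 * m) * measure \<nu> (ball x r)"
          by (simp add: power_add mult_2 mult_2_right power2_eq_square power4_eq_xxxx mult_ac)
        also have "\<dots> \<le> L * r powr (- 2 * \<epsilon>) * measure \<nu> (ball x r)"
          by (rule conv) auto
        finally show "measure \<mu> (ball x r) \<le> L * r powr (- 2 * \<epsilon>) * measure \<nu> (ball x r)" .
        have "measure \<nu> (ball x r) \<le> measure \<nu> (ball x ((1/2) ^ m))"
          using m by (intro m2) auto
        also have "\<dots> \<le> C * b ^ m * measure \<mu> (ball x (2 * (1/2) ^ m))" by (rule d2)
        also have "\<dots> = C * b ^ m * measure \<mu> (ball x (4 * (1/2) ^ Suc m))" by simp
        also have "\<dots> \<le> C * b ^ m * (K * b ^ Suc m * measure \<mu> (ball x ((1/2) ^ Suc m)))"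
          using C b0 by (intro mult_left_mono K(2)) auto
        also have "\<dots> \<le> C * b ^ m * (K * b ^ Suc m * measure \<mu> (ball x r))"
          using K(1) b0 C m by (intro mult_left_mono m1) auto
        also have "\<dots> = K * C * b ^ 1 * b ^ (2 * m) * measure \<mu> (ball x r)"
          by (simp add: power_add mult_2 mult_2_right mult_ac)
        also have "\<dots> \<le> L * r powr (- 2 * \<epsilon>) * measure \<mu> (ball x r)"
          by (rule conv) auto
        finally show "measure \<nu> (ball x r) \<le> L * r powr (- 2 * \<epsilon>) * measure \<mu> (ball x r)" .
      qed
      show ?case
        using eventually_const_div_ln[OF \<epsilon>, of "ln L"] eventually_at_right_0_unit
      proof eventually_elim
        case (elim r)
        then have r: "0 < r" "r < 1" and ln: "ln r < 0" by auto
        let ?u = "measure \<mu> (ball x r)" and ?v = "measure \<nu> (ball x r)"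
        have uv: "?u > 0" "?v > 0" using pos r by auto
        have lnL: "ln (L * r powr (- 2 * \<epsilon>) * t) = ln L - 2 * \<epsilon> * ln r + ln t" if "t > 0" for t
          using L r that by (simp add: ln_mult ln_powr)
        have "ln ?u \<le> ln (L * r powr (- 2 * \<epsilon>) * ?v)" "ln ?v \<le> ln (L * r powr (- 2 * \<epsilon>) * ?u)"
          using ratio[OF r] uv by (auto intro!: ln_mono)
        then have "ln ?u - ln ?v \<le> ln L - 2 * \<epsilon> * ln r" "ln ?v - ln ?u \<le> ln L - 2 * \<epsilon> * ln r"
          using lnL uv by auto
        moreover have "ln L \<le> - \<epsilon> * ln r"
        proof -
          have "\<bar>ln L\<bar> < \<epsilon> * \<bar>ln r\<bar>"
            using elim(1) ln unfolding abs_divide by (subst (asm) pos_divide_less_eq) auto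
          then show ?thesis using ln by simp
        qed
        ultimately have "ln ?u - ln ?v \<le> - 3 * \<epsilon> * ln r" "ln ?v - ln ?u \<le> - 3 * \<epsilon> * ln r"
          by simp_all
        then have "- (3 * \<epsilon>) \<le> (ln ?u - ln ?v) / ln r" "(ln ?u - ln ?v) / ln r \<le> 3 * \<epsilon>"
          using ln by (simp_all add: neg_le_divide_eq neg_divide_le_eq)
        moreover have "log_ratio \<mu> \<nu> x r = ereal ((ln ?u - ln ?v) / ln r)"
          using uv ln divide_pos_pos[OF uv] by (simp add: log_ratio_def elog_quotient_def elog_def ln_div not_le[symmetric])
        ultimately show ?case by simp
      qed
    qed
  qed (use \<epsilon> in auto)
qed

text \<open>Rational exponents suffice by density, so only countably many null sets are
  collected.\<close>

lemma AE_lower_local_dim_eq: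
  fixes \<nu> :: "'v::euclidean_space measure"
  assumes \<nu>: "finite_measure \<nu>" "sets \<nu> = sets borel"
    and lo: "\<And>u. ereal u < s \<Longrightarrow> AE x in \<nu>. frost \<nu> (2 powr - u) x"
    and hi: "\<And>u. s < ereal u \<Longrightarrow> AE x in \<nu>. \<not> frost \<nu> (2 powr - u) x"
  shows "AE x in \<nu>. lower_local_dim \<nu> x = s"
proof -
  have "AE x in \<nu>. \<forall>u :: rat. (ereal (of_rat u) < s \<longrightarrow> frost \<nu> (2 powr - of_rat u) x) \<and>
      (s < ereal (of_rat u) \<longrightarrow> \<not> frost \<nu> (2 powr - of_rat u) x)"
    unfolding AE_all_countable
  proof
    fix u :: rat
    show "AE x in \<nu>. (ereal (of_rat u) < s \<longrightarrow> frost \<nu> (2 powr - of_rat u) x) \<and>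
      (s < ereal (of_rat u) \<longrightarrow> \<not> frost \<nu> (2 powr - of_rat u) x)"
      using lo[of "of_rat u"] hi[of "of_rat u"]
      by (cases "ereal (of_rat u)" s rule: linorder_cases) (auto elim: eventually_mono)
  qed
  then show ?thesis
  proof eventually_elim
    case (elim x)
    show ?case
    proof (rule antisym)
      show "lower_local_dim \<nu> x \<le> s"
      proof (rule ccontr)
        assume "\<not> lower_local_dim \<nu> x \<le> s"
        then have "s < lower_local_dim \<nu> x" by simp
        from ereal_dense3[OF this] obtain u :: rat
          where "s < ereal (of_rat u)" "ereal (of_rat u) < lower_local_dim \<nu> x" by blast
        then show False using elim lower_local_dim_imp_frost by blast
      qed
      show "s \<le> lower_local_dim \<nu> x"
      proof (rule ccontr)
        assume "\<not> s \<le> lower_local_dim \<nu> x"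
        then have "lower_local_dim \<nu> x < s" by simp
        from ereal_dense3[OF this] obtain u :: rat
          where "lower_local_dim \<nu> x < ereal (of_rat u)" "ereal (of_rat u) < s" by blast
        then show False
          using elim frost_imp_lower_local_dim[OF \<nu>, of "of_rat u" x] by (meson leD)
      qed
    qed
  qed
qed

text \<open>The energy bound for \<open>\<nu>\<close> along \<open>V\<close> carries over to every measure that is comparable to
  \<open>\<nu>\<close> up to small exponential errors; thus \<open>V\<close> may be chosen before \<open>\<mu>\<close>.\<close>

lemma AE_frost_projection:
  fixes \<mu> \<nu> :: "'v::euclidean_space measure"
  assumes \<mu>: "prob_space \<mu>" "sets \<mu> = sets borel" and \<nu>: "prob_space \<nu>" "sets \<nu> = sets borel"
    and V: "subspace V" and C: "C > 0" and b: "b > 1"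
    and dom: "scale_dominated C b \<mu> \<nu>" "scale_dominated C b \<nu> \<mu>"
    and a: "0 < a0" "a0 * b \<le> a" "0 < a'" "b ^ 2 * a' < a1"
    and energy: "\<And>k :: nat. \<exists>D\<ge>0. \<forall>m. projection_energy \<nu> (real k) a m V \<le> ennreal (D * a' ^ m)"
    and frost: "AE x in \<mu>. frost \<mu> a0 x"
  shows "AE x in \<mu>. frost (distr \<mu> borel (orth_proj V)) a1 (orth_proj V x)"
proof -
  interpret \<mu>: prob_space \<mu> by fact
  interpret \<nu>: prob_space \<nu> by fact
  note fin = \<mu>.finite_measure_axioms \<nu>.finite_measure_axioms
  have b0: "b > 0" using b by simp
  have "a > 0" using a(1,2) b0 by (meson less_le_trans mult_pos_pos)
  have "a1 > 0" using a(3,4) b0 by (meson less_trans mult_pos_pos zero_less_power)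
  have cont: "continuous_on UNIV (orth_proj V)" by (rule continuous_on_orth_proj[OF V])
  note P\<mu> = borel_measurable_orth_proj[OF V \<mu>(2)]
  have slab1: "slab_indicator r V x \<in> borel_measurable borel" for r x
  proof -
    have "(\<lambda>y. norm (orth_proj V (x - y))) \<in> borel_measurable borel"
      by (intro borel_measurable_continuous_onI continuous_intros continuous_on_compose2[OF cont]) auto
    then show ?thesis unfolding slab_indicator_def by measurable
  qed
  have slab2: "(\<lambda>x. \<integral>\<^sup>+y. slab_indicator r V x y \<partial>M) \<in> borel_measurable borel"
    if "prob_space M" "sets M = sets (borel :: 'v measure)" for M r
  proof -
    interpret M: prob_space M by fact
    have "(\<lambda>p :: 'v \<times> 'v. norm (orth_proj V (fst p - snd p))) \<in> borel_measurable borel"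
      by (intro borel_measurable_continuous_onI continuous_intros continuous_on_compose2[OF cont]) auto
    then have "(\<lambda>p. slab_indicator r V (fst p) (snd p)) \<in> borel_measurable (borel :: ('v \<times> 'v) measure)"
      unfolding slab_indicator_def by measurable
    moreover have "sets (borel \<Otimes>\<^sub>M M) = sets (borel :: ('v \<times> 'v) measure)"
      unfolding borel_prod[symmetric] using that(2) by (intro sets_pair_measure_cong) auto
    ultimately have "(\<lambda>p. slab_indicator r V (fst p) (snd p)) \<in> borel_measurable (borel \<Otimes>\<^sub>M M)"
      using measurable_cong_sets by blast
    then show ?thesis
      by (intro M.borel_measurable_nn_integral) (simp add: case_prod_unfold)
  qed
  have slab_mono: "slab_indicator r V x y \<le> slab_indicator (2 * r) V x' y'"
    if "dist x x' + dist y y' < r" for r x y x' y'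
  proof -
    have lin: "linear (orth_proj V)" by (rule linear_orth_proj[OF V])
    have "norm (orth_proj V (x' - y')) \<le> norm (orth_proj V (x - y)) + norm (orth_proj V ((x' - y') - (x - y)))"
      using norm_triangle_ineq[of "orth_proj V (x - y)" "orth_proj V ((x' - y') - (x - y))"]
      by (simp flip: linear_add[OF lin])
    also have "norm (orth_proj V ((x' - y') - (x - y))) \<le> norm ((x' - x) - (y' - y))"
      using norm_orth_proj_le[OF V, of "(x' - x) - (y' - y)"] by (simp add: algebra_simps)
    also have "\<dots> \<le> dist x x' + dist y y'"
      using norm_triangle_ineq4[of "x' - x" "y' - y"] by (simp add: dist_norm norm_minus_commute)
    finally show ?thesis using that by (auto simp: slab_indicator_def indicator_def)
  qed
  \<comment> \<open>These sets exhaust the points satisfying \<open>frost\<close>, and on each of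
    them the transfer to \<nu> has uniform constants.\<close>
  define A where "A k = {x. \<forall>m. measure \<mu> (ball x ((1/2) ^ m)) \<le> real k * a0 ^ m}" for k :: nat
  have A: "A k \<in> sets borel" for k
  proof -
    note [measurable] = measure_ball_measurable[OF fin(1) \<mu>(2)]
    have "A k = {x \<in> space borel. \<forall>m. measure \<mu> (ball x ((1/2) ^ m)) \<le> real k * a0 ^ m}"
      by (simp add: A_def)
    also have "\<dots> \<in> sets borel" by measurable
    finally show ?thesis .
  qed
  define h where "h k m x = indicator (A k) x * (\<integral>\<^sup>+y. slab_indicator ((1/2) ^ m) V x y \<partial>\<mu>)" for k m x
  have h: "h k m \<in> borel_measurable borel" for k m
    unfolding h_def using A slab2[OF \<mu>] by (intro borel_measurable_times_ennreal borel_measurable_indicator)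
  have AEh: "AE x in \<mu>. \<exists>D\<ge>0. \<forall>m. h k (m + 2) x \<le> ennreal (D * a1 ^ m)" for k
  proof -
    \<comment> \<open>The summands 1 and \<open>1 / a\<close> make the bound trivial at the scales
      \<open>j = 0\<close> and \<open>j = 1\<close>; the first summand handles
      \<open>j \<ge> 2\<close>, where two scales are lost.\<close>
    obtain K :: nat where K: "C * real k / a0 ^ 2 + 1 + 1 / a \<le> real K"
      using real_arch_simple by blast
    have K1: "C * real k / a0 ^ 2 \<le> real K" "1 \<le> real K" "1 / a \<le> real K"
    proof -
      have "C * real k / a0 ^ 2 \<ge> 0" "1 / a \<ge> 0" using C a(1) \<open>a > 0\<close> by auto
      then show "C * real k / a0 ^ 2 \<le> real K" "1 \<le> real K" "1 / a \<le> real K" using K by linarith+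
    qed
    obtain D where D: "D \<ge> 0" "\<And>m. projection_energy \<nu> (real K) a m V \<le> ennreal (D * a' ^ m)"
      using energy[of K] by blast
    \<comment> \<open>A good point \<open>x\<close> for \<mu> makes all nearby \<open>x'\<close>
      good for \<nu> down to scale \<open>m\<close>: the doubled ball about \<open>x'\<close> lies
      in the ball about \<open>x\<close> two scales up.\<close>
    have upto: "x' \<in> frost_upto \<nu> (real K) a m" if x: "x \<in> A k" and xx': "dist x x' < (1/2) ^ (m + 2)" for x x' m
      unfolding frost_upto_def mem_Collect_eq
    proof (intro allI impI)
      fix j assume "j \<le> m"
      show "measure \<nu> (ball x' ((1/2) ^ j)) \<le> real K * a ^ j"
      proof (cases "j < 2")
        case True
        then have "j = 0 \<or> j = 1" by auto
        then have "1 \<le> real K * a ^ j" using K1 \<open>a > 0\<close> by (auto simp: field_simps)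
        then show ?thesis using \<nu>.prob_le_1[of "ball x' ((1/2) ^ j)"] by linarith
      next
        case False
        define i where "i = j - 2"
        have j: "j = i + 2" using False by (simp add: i_def)
        have "(1/2 :: real) ^ (m + 2) \<le> (1/2) ^ j" using \<open>j \<le> m\<close> by (intro power_decreasing) auto
        then have "dist x x' < (1/2) ^ j" using xx' by linarith
        have sub: "ball x' (2 * (1/2) ^ j) \<subseteq> ball x ((1/2) ^ i)"
        proof
          fix z assume "z \<in> ball x' (2 * (1/2) ^ j)"
          then have "dist x z < 3 * (1/2) ^ j"
            using \<open>dist x x' < (1/2) ^ j\<close> dist_triangle[of x z x'] by simp
          also have "\<dots> \<le> (1/2) ^ i" by (simp add: j power_add)
          finally show "z \<in> ball x ((1/2) ^ i)" by simp
        qed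
        have "measure \<nu> (ball x' ((1/2) ^ j)) \<le> C * b ^ j * measure \<mu> (ball x' (2 * (1/2) ^ j))"
          by (rule scale_dominated_ball[OF dom(2) C b0 fin(2,1) \<nu>(2) \<mu>(2)])
        also have "\<dots> \<le> C * b ^ j * measure \<mu> (ball x ((1/2) ^ i))"
          using sub C b0 by (intro mult_left_mono \<mu>.finite_measure_mono) (auto simp: \<mu>(2))
        also have "\<dots> \<le> C * b ^ j * (real k * a0 ^ i)"
          using x C b0 by (intro mult_left_mono) (auto simp: A_def)
        also have "\<dots> = C * real k / a0 ^ 2 * (a0 * b) ^ j"
          using a(1) by (simp add: j power_add power_mult_distrib power2_eq_square field_simps)
        also have "\<dots> \<le> real K * a ^ j"
          using K1(1) a(1,2) b0 C by (intro mult_mono power_mono) auto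
        finally show ?thesis .
      qed
    qed
    show ?thesis
    \<comment> \<open>The domination acts twice, on the inner and on the outer integral, hence
      \<open>b ^ 2\<close> in the base.\<close>
    proof (rule AE_geometric_bound[where a = "b ^ 2 * a'" and C = "C * b ^ 2 * (C * b ^ 2 * D)"])
      show "h k (m + 2) \<in> borel_measurable \<mu>" for m
        using h measurable_cong_sets[OF \<mu>(2) refl] by blast
      show "0 < b ^ 2 * a'" using b0 a(3) by simp
      fix m
      define g where "g x = indicator (frost_upto \<nu> (real K) a m) x *
          (\<integral>\<^sup>+y. slab_indicator ((1/2) ^ m) V x y \<partial>\<nu>)" for x
      have g: "g \<in> borel_measurable borel"
        unfolding g_def using frost_upto_sets[OF fin(2) \<nu>(2)] slab2[OF \<nu>]
        by (intro borel_measurable_times_ennreal borel_measurable_indicator)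
      let ?c = "ennreal (C * b ^ (m + 2))"
      \<comment> \<open>The slab of width \<open>(1/2) ^ (m + 2)\<close> is first widened to
        \<open>(1/2) ^ (m + 1)\<close> and doubles once more when both points move by less than
        \<open>(1/2) ^ (m + 2)\<close>.\<close>
      have hg: "h k (m + 2) x \<le> ?c * g x'" if xx': "dist x x' < (1/2) ^ (m + 2)" for x x'
      proof (cases "x \<in> A k")
        case True
        have "(\<integral>\<^sup>+y. slab_indicator ((1/2) ^ (m + 2)) V x y \<partial>\<mu>)
            \<le> ?c * (\<integral>\<^sup>+y. slab_indicator ((1/2) ^ m) V x' y \<partial>\<nu>)"
        proof -
          have "slab_indicator ((1/2) ^ (m + 2)) V x z \<le> slab_indicator ((1/2) ^ m) V x' z'"
            if "dist z z' < (1/2) ^ (m + 2)" for z z'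
          proof -
            have "slab_indicator ((1/2) ^ (m + 2)) V x z \<le> slab_indicator ((1/2) ^ (m + 1)) V x z"
            proof -
              have "(1/2 :: real) ^ (m + 2) \<le> (1/2) ^ (m + 1)" by simp
              then show ?thesis
                unfolding slab_indicator_def by (intro indicator_leI) (metis lessThan_iff less_le_trans)
            qed
            also have "\<dots> \<le> slab_indicator (2 * (1/2) ^ (m + 1)) V x' z'"
              using xx' that by (intro slab_mono) (simp add: power_add)
            finally show ?thesis by simp
          qed
          then show ?thesis
            by (rule scale_dominatedD[OF dom(1) slab1 slab1])
        qed
        then show ?thesis using True upto[OF True xx'] by (simp add: h_def g_def)
      qed (simp add: h_def)
      have "(\<integral>\<^sup>+x. h k (m + 2) x \<partial>\<mu>) \<le> ?c * (\<integral>\<^sup>+x. ?c * g x \<partial>\<nu>)"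
        by (rule scale_dominatedD[OF dom(1) h _ hg]) (use g in measurable)
      also have "(\<integral>\<^sup>+x. ?c * g x \<partial>\<nu>) = ?c * (\<integral>\<^sup>+x. g x \<partial>\<nu>)"
        using g measurable_cong_sets[OF \<nu>(2) refl] by (intro nn_integral_cmult) blast
      also have "\<dots> \<le> ?c * ennreal (D * a' ^ m)"
        using D(2)[of m] unfolding g_def projection_energy_def by (intro mult_left_mono) auto
      also have "?c * (?c * ennreal (D * a' ^ m)) = ennreal (C * b ^ (m + 2) * (C * b ^ (m + 2) * (D * a' ^ m)))"
        using C b0 D(1) a(3) by (simp add: ennreal_mult)
      also have "C * b ^ (m + 2) * (C * b ^ (m + 2) * (D * a' ^ m)) = C * b ^ 2 * (C * b ^ 2 * D) * (b ^ 2 * a') ^ m"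
        by (simp add: power_add power_mult_distrib power2_eq_square mult_ac)
      finally show "(\<integral>\<^sup>+x. h k (m + 2) x \<partial>\<mu>) \<le> ennreal (C * b ^ 2 * (C * b ^ 2 * D) * (b ^ 2 * a') ^ m)"
        by (auto simp: mult_left_mono)
    qed (use a in auto)
  qed
  then have "AE x in \<mu>. \<forall>k. \<exists>D\<ge>0. \<forall>m. h k (m + 2) x \<le> ennreal (D * a1 ^ m)"
    by (simp add: AE_all_countable)
  with frost show ?thesis
  proof eventually_elim
    case (elim x)
    obtain K where K: "\<And>m. measure \<mu> (ball x ((1/2) ^ m)) \<le> K * a0 ^ m"
      using elim(1) unfolding frost_def by blast
    obtain k :: nat where "K \<le> real k" using real_arch_simple by blast
    then have "K * a0 ^ m \<le> real k * a0 ^ m" for m using a(1) by (intro mult_right_mono) auto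
    then have x: "x \<in> A k" using K order_trans unfolding A_def by blast
    obtain D where D: "D \<ge> 0" "\<And>m. h k (m + 2) x \<le> ennreal (D * a1 ^ m)"
      using elim(2) by blast
    have meas: "h k m x = ennreal (measure (distr \<mu> borel (orth_proj V)) (ball (orth_proj V x) ((1/2) ^ m)))" for m
    proof -
      let ?B = "ball (orth_proj V x) ((1/2) ^ m)"
      have "h k m x = (\<integral>\<^sup>+y. indicator ?B (orth_proj V y) \<partial>\<mu>)"
        using x linear_diff[OF linear_orth_proj[OF V]]
        by (auto simp: h_def slab_indicator_def indicator_def dist_norm intro!: nn_integral_cong)
      also have "\<dots> = (\<integral>\<^sup>+y. indicator ?B y \<partial>distr \<mu> borel (orth_proj V))"
        by (rule nn_integral_distr[symmetric, OF P\<mu>]) (intro borel_measurable_indicator, simp)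
      also have "\<dots> = emeasure (distr \<mu> borel (orth_proj V)) ?B"
        by (rule nn_integral_indicator) simp
      finally show ?thesis
        using finite_measure.emeasure_eq_measure[OF \<mu>.finite_measure_distr[OF P\<mu>]] by simp
    qed
    show ?case
    proof (rule frostI[where ?m0.0 = 2 and K = "D / a1 ^ 2"])
      fix m :: nat assume "2 \<le> m"
      define i where "i = m - 2"
      have m: "m = i + 2" using \<open>2 \<le> m\<close> by (simp add: i_def)
      have "measure (distr \<mu> borel (orth_proj V)) (ball (orth_proj V x) ((1/2) ^ m)) \<le> D * a1 ^ i"
        using D(2)[of i] D(1) \<open>a1 > 0\<close> unfolding m[symmetric] meas by (simp add: ennreal_le_iff)
      also have "\<dots> = D / a1 ^ 2 * a1 ^ m" using \<open>a1 > 0\<close> by (simp add: m power2_eq_square)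
      finally show "measure (distr \<mu> borel (orth_proj V)) (ball (orth_proj V x) ((1/2) ^ m)) \<le> D / a1 ^ 2 * a1 ^ m" .
    qed (rule \<open>a1 > 0\<close>)
  qed
qed


section \<open>Gibbs measures on the attractor\<close>

context
  fixes V0 :: "('v::euclidean_space) set" and f :: "'a::finite \<Rightarrow> 'v \<Rightarrow> 'v"
  assumes ifs: "conformal_IFS V0 f"
begin

abbreviation coding :: "(nat \<Rightarrow> 'a) \<Rightarrow> 'v" where "coding \<equiv> coding_map V0 f"

lemma coding_map_measurable_gibbs: "\<mu> \<in> gibbs_class \<Longrightarrow> coding \<in> borel_measurable \<mu>"
  using coding_map_measurable[OF ifs] measurable_cong_sets[OF gibbs_classD(1) refl] by blast

lemma prob_space_coding: "\<mu> \<in> gibbs_class \<Longrightarrow> prob_space (distr \<mu> borel coding)"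
  using gibbs_classD(2) coding_map_measurable_gibbs by (auto intro: prob_space.prob_space_distr)

lemma measure_coding:
  assumes "\<mu> \<in> gibbs_class" "S \<in> sets borel"
  shows "measure (distr \<mu> borel coding) S = measure \<mu> (coding -` S)"
  using measure_distr[OF coding_map_measurable_gibbs[OF assms(1)] assms(2)]
    sets_eq_imp_space_eq[OF gibbs_classD(1)[OF assms(1)]] by simp

lemma AE_coding_in_attractor:
  assumes "\<mu> \<in> gibbs_class"
  shows "AE x in distr \<mu> borel coding. x \<in> attractor V0 f"
proof -
  have "{x \<in> space borel. x \<in> attractor V0 f} \<in> sets borel"
    using compact_attractor[OF ifs] by (auto intro: borel_closed compact_imp_closed)
  then show ?thesis
    using AE_distr_iff[OF coding_map_measurable_gibbs[OF assms]] by (simp add: attractor_def)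
qed

lemma measure_ball_attractor_pos:
  assumes \<mu>: "\<mu> \<in> gibbs_class" and "x \<in> attractor V0 f" "r > 0"
  shows "measure (distr \<mu> borel coding) (ball x r) > 0"
proof -
  interpret prob_space \<mu> using gibbs_classD[OF \<mu>] by simp
  obtain \<omega> where x: "x = coding \<omega>" using assms(2) by (auto simp: attractor_def)
  then obtain n where n: "cylinder \<omega> n \<subseteq> coding -` ball x r"
    using coding_map_vimage_open[OF ifs, of "ball x r" \<omega>] assms(3) by auto
  have "0 < measure \<mu> (cylinder \<omega> n)" by (rule gibbs_class_full_support[OF \<mu>])
  also have "\<dots> \<le> measure \<mu> (coding -` ball x r)"
    using n measurable_sets[OF coding_map_measurable_gibbs[OF \<mu>], of "ball x r"]
      sets_eq_imp_space_eq[OF gibbs_classD(1)[OF \<mu>]]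
    by (intro finite_measure_mono) auto
  finally show ?thesis using measure_coding[OF \<mu>] by simp
qed

text \<open>Points of one cylinder of length \<open>p * m + q\<close> have images closer than
  \<open>(1/2) ^ m\<close>, however the images of different cylinders overlap, so test functions can
  be compared cylinder by cylinder. The loss splits as \<open>b ^ q * (b ^ p) ^ m\<close>.\<close>

lemma scale_dominated_coding:
  fixes p q :: nat
  assumes pq: "\<And>m \<omega> \<tau>. \<tau> \<in> cylinder \<omega> (p * m + q) \<Longrightarrow> dist (coding \<omega>) (coding \<tau>) < (1/2) ^ m"
    and \<mu>: "\<mu> \<in> gibbs_class" and \<nu>: "\<nu> \<in> gibbs_class" and c: "c > 0" and b: "b \<ge> 1" "b ^ p \<le> b'"
    and le: "\<And>\<omega> n. measure \<mu> (cylinder \<omega> n) \<le> c * b ^ n * measure \<nu> (cylinder \<omega> n)"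
  shows "scale_dominated (c * b ^ q) b' (distr \<mu> borel coding) (distr \<nu> borel coding)"
  unfolding scale_dominated_def
proof (intro allI ballI impI)
  interpret \<mu>: prob_space \<mu> using gibbs_classD[OF \<mu>] by simp
  interpret \<nu>: prob_space \<nu> using gibbs_classD[OF \<nu>] by simp
  fix m and h h' :: "'v \<Rightarrow> ennreal"
  assume h: "h \<in> borel_measurable borel" "h' \<in> borel_measurable borel"
    and hh': "\<forall>z z'. dist z z' < (1/2) ^ m \<longrightarrow> h z \<le> h' z'"
  have "c * b ^ (p * m + q) \<le> c * b ^ q * b' ^ m"
  proof -
    have "(b ^ p) ^ m \<le> b' ^ m" using b by (intro power_mono) auto
    then have "c * b ^ q * (b ^ p) ^ m \<le> c * b ^ q * b' ^ m"
      using c b by (intro mult_left_mono) auto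
    then show ?thesis by (simp add: power_add power_mult mult.assoc mult.commute[of "b ^ q"])
  qed
  then have "measure \<mu> (cylinder \<omega> (p * m + q)) \<le> c * b ^ q * b' ^ m * measure \<nu> (cylinder \<omega> (p * m + q))" for \<omega>
    by (intro order_trans[OF le] mult_right_mono) auto
  then have "emeasure \<mu> (cylinder \<omega> (p * m + q)) \<le> ennreal (c * b ^ q * b' ^ m) * emeasure \<nu> (cylinder \<omega> (p * m + q))" for \<omega>
    unfolding \<mu>.emeasure_eq_measure \<nu>.emeasure_eq_measure
    by (subst ennreal_mult''[symmetric]) (auto intro: ennreal_leI)
  then have "(\<integral>\<^sup>+\<omega>. h (coding \<omega>) \<partial>\<mu>) \<le> ennreal (c * b ^ q * b' ^ m) * (\<integral>\<^sup>+\<omega>. h' (coding \<omega>) \<partial>\<nu>)"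
    by (intro nn_integral_cylinder_le gibbs_classD(1) \<mu> \<nu>) (use hh' pq in auto)
  then show "(\<integral>\<^sup>+z. h z \<partial>distr \<mu> borel coding) \<le> ennreal (c * b ^ q * b' ^ m) * (\<integral>\<^sup>+z. h' z \<partial>distr \<nu> borel coding)"
    using h coding_map_measurable_gibbs \<mu> \<nu> by (simp add: nn_integral_distr)
qed

lemma gibbs_measures_separable:
  "\<exists>N \<subseteq> (gibbs_class :: (nat \<Rightarrow> 'a) measure set). countable N \<and> (\<forall>\<mu>\<in>gibbs_class. \<forall>b>1. \<exists>\<nu>\<in>N. \<exists>C>0.
     scale_dominated C b (distr \<mu> borel coding) (distr \<nu> borel coding) \<and>
     scale_dominated C b (distr \<nu> borel coding) (distr \<mu> borel coding))"
proof -
  obtain N :: "(nat \<Rightarrow> 'a) measure set" where N: "N \<subseteq> gibbs_class" "countable N"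
    "\<And>\<mu> b. \<mu> \<in> gibbs_class \<Longrightarrow> b > 1 \<Longrightarrow> \<exists>\<nu>\<in>N. cylinder_comparable b \<mu> \<nu>"
    using gibbs_class_separable by meson
  obtain p q where pq: "\<And>m \<omega> \<tau>. \<tau> \<in> cylinder \<omega> (p * m + q) \<Longrightarrow> dist (coding \<omega>) (coding \<tau>) < (1/2) ^ m"
    using coding_map_fine_cylinders[OF ifs] by blast
  have "\<exists>\<nu>\<in>N. \<exists>C>0. scale_dominated C b (distr \<mu> borel coding) (distr \<nu> borel coding) \<and>
     scale_dominated C b (distr \<nu> borel coding) (distr \<mu> borel coding)" if \<mu>: "\<mu> \<in> gibbs_class" and b: "b > 1" for \<mu> b
  proof -
    \<comment> \<open>Cylinders lose \<open>b0 ^ p\<close> per dyadic scale, so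
      \<open>b0 ^ p \<le> b\<close> is wanted; \<open>Suc p\<close> covers the case
      \<open>p = 0\<close>.\<close>
    define b0 where "b0 = root (Suc p) b"
    have b0: "b0 > 1" using b by (simp add: b0_def)
    have "b0 ^ p \<le> b0 ^ Suc p" using b0 by (intro power_increasing) auto
    also have "\<dots> = b" using b unfolding b0_def by (intro real_root_pow_pos2) auto
    finally have bp: "b0 ^ p \<le> b" .
    obtain \<nu> where \<nu>: "\<nu> \<in> N" "cylinder_comparable b0 \<mu> \<nu>" using N(3)[OF \<mu> b0] by blast
    obtain c where c: "c > 0" "\<And>\<omega> n. measure \<mu> (cylinder \<omega> n) \<le> c * b0 ^ n * measure \<nu> (cylinder \<omega> n)"
      "\<And>\<omega> n. measure \<nu> (cylinder \<omega> n) \<le> c * b0 ^ n * measure \<mu> (cylinder \<omega> n)"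
      using \<nu>(2) unfolding cylinder_comparable_def by blast
    have \<nu>': "\<nu> \<in> gibbs_class" using \<nu>(1) N(1) by blast
    have "c * b0 ^ q > 0" using c(1) b0 by simp
    then show ?thesis
      using \<nu>(1) scale_dominated_coding[OF pq \<mu> \<nu>' c(1) _ bp c(2)] scale_dominated_coding[OF pq \<nu>' \<mu> c(1) _ bp c(3)] b0
      by (intro bexI[of _ \<nu>] exI[of _ "c * b0 ^ q"]) auto
  qed
  with N(1,2) show ?thesis by blast
qed

text \<open>Since \<open>\<mu> (i A) \<ge> c * \<mu> A\<close> and the maps do not expand small distances, the property \<open>frost\<close>
  at \<open>coding \<omega>\<close> passes to \<open>coding (shift \<omega>)\<close>; ergodicity then gives a zero-one law.\<close>

lemma frost_zero_one:
  assumes \<mu>: "\<mu> \<in> gibbs_class" and a: "a > 0"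
  defines "\<nu> \<equiv> distr \<mu> borel coding"
  shows "(AE x in \<nu>. frost \<nu> a x) \<or> (AE x in \<nu>. \<not> frost \<nu> a x)"
proof -
  interpret \<mu>: prob_space \<mu> using gibbs_classD[OF \<mu>] by simp
  interpret \<nu>: prob_space \<nu> unfolding \<nu>_def by (rule prob_space_coding[OF \<mu>])
  note sets = gibbs_classD(1)[OF \<mu>]
  have space: "space \<mu> = UNIV" using sets_eq_imp_space_eq[OF sets] by simp
  have [simp]: "sets \<nu> = sets borel" by (simp add: \<nu>_def)
  have F: "{x. frost \<nu> a x} \<in> sets borel"
    by (rule frost_sets[OF \<nu>.finite_measure_axioms _ a]) simp
  note coding = coding_map_measurable_gibbs[OF \<mu>]
  define A where "A = coding -` {x. frost \<nu> a x}"
  have A: "A \<in> sets seq_space"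
    using measurable_sets[OF coding F] sets by (simp add: A_def space)
  obtain \<delta> \<rho> where \<delta>: "\<delta> > 0" and \<rho>: "0 < \<rho>" "\<rho> < 1"
    and f: "\<And>i x y. x \<in> V0 \<Longrightarrow> y \<in> V0 \<Longrightarrow> dist x y < \<delta> \<Longrightarrow> dist (f i x) (f i y) \<le> \<rho> * dist x y"
    using conformal_IFS_locally_contracting[OF ifs] by blast
  have "A \<subseteq> shift -` A"
  proof
    fix \<omega> assume "\<omega> \<in> A"
    then obtain K where K: "\<And>m. measure \<nu> (ball (coding \<omega>) ((1/2) ^ m)) \<le> K * a ^ m"
      unfolding A_def frost_def by blast
    obtain C where C: "C > 0" "\<And>B. (\<forall>\<tau>\<in>B. \<exists>n. cylinder \<tau> n \<subseteq> B) \<Longrightarrow>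
        measure \<mu> B \<le> C * measure \<mu> {\<tau>. \<tau> 0 = \<omega> 0 \<and> shift \<tau> \<in> B}"
      using gibbs_class_prepend[OF \<mu>] by blast
    \<comment> \<open>Below this scale the maps contract, so the prefixed ball stays within the same
      radius; \<open>frostI\<close> ignores the coarser scales.\<close>
    obtain m0 where m0: "(1/2) ^ m0 < \<delta>" using real_arch_pow_inv[OF \<delta>, of "1/2"] by auto
    have "frost \<nu> a (coding (shift \<omega>))"
    proof (rule frostI[OF a, where ?m0.0 = m0 and K = "C * K"])
      fix m assume "m0 \<le> m"
      then have "(1/2 :: real) ^ m \<le> (1/2) ^ m0" by (intro power_decreasing) auto
      then have small: "(1/2) ^ m < \<delta>" using m0 by linarith
      let ?B = "coding -` ball (coding (shift \<omega>)) ((1/2) ^ m)"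
      have "measure \<nu> (ball (coding (shift \<omega>)) ((1/2) ^ m)) = measure \<mu> ?B"
        unfolding \<nu>_def by (rule measure_coding[OF \<mu>]) simp
      also have "\<dots> \<le> C * measure \<mu> {\<tau>. \<tau> 0 = \<omega> 0 \<and> shift \<tau> \<in> ?B}"
        using coding_map_vimage_open[OF ifs, of "ball (coding (shift \<omega>)) ((1/2) ^ m)"]
        by (intro C(2)) auto
      also have "\<dots> \<le> C * measure \<mu> (coding -` ball (coding \<omega>) ((1/2) ^ m))"
      proof (intro mult_left_mono \<mu>.finite_measure_mono subsetI)
        show "coding -` ball (coding \<omega>) ((1/2) ^ m) \<in> \<mu>.events"
          using measurable_sets[OF coding, of "ball (coding \<omega>) ((1/2) ^ m)"] by (simp add: space)
        fix \<tau> assume "\<tau> \<in> {\<tau>. \<tau> 0 = \<omega> 0 \<and> shift \<tau> \<in> ?B}"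
        then have \<tau>: "\<tau> 0 = \<omega> 0" "dist (coding (shift \<omega>)) (coding (shift \<tau>)) < (1/2) ^ m" by auto
        have "dist (coding \<omega>) (coding \<tau>) \<le> \<rho> * dist (coding (shift \<omega>)) (coding (shift \<tau>))"
          unfolding coding_map_shift[OF ifs, of \<omega>] coding_map_shift[OF ifs, of \<tau>] \<tau>(1)
          using \<tau>(2) small by (intro f coding_map_in[OF ifs]) auto
        also have "\<dots> \<le> 1 * dist (coding (shift \<omega>)) (coding (shift \<tau>))"
          using \<rho> by (intro mult_right_mono) auto
        finally show "\<tau> \<in> coding -` ball (coding \<omega>) ((1/2) ^ m)" using \<tau>(2) by simp
      qed (use C in auto)
      also have "\<dots> = C * measure \<nu> (ball (coding \<omega>) ((1/2) ^ m))"
        unfolding \<nu>_def by (simp add: measure_coding[OF \<mu>])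
      also have "\<dots> \<le> C * (K * a ^ m)"
        using C(1) by (intro mult_left_mono K) auto
      finally show "measure \<nu> (ball (coding (shift \<omega>)) ((1/2) ^ m)) \<le> C * K * a ^ m" by simp
    qed
    then show "\<omega> \<in> shift -` A" by (simp add: A_def)
  qed
  then have "measure \<mu> A = 0 \<or> measure \<mu> A = 1"
    by (rule gibbs_class_subinvariant[OF \<mu> A])
  moreover have "measure \<nu> {x. frost \<nu> a x} = measure \<mu> A"
    unfolding A_def using measure_coding[OF \<mu> F] by (simp add: \<nu>_def)
  ultimately have "\<nu>.prob {x. frost \<nu> a x} = 0 \<or> \<nu>.prob {x. frost \<nu> a x} = 1" by simp
  then show ?thesis
    using F \<nu>.prob_eq_0[of "{x. frost \<nu> a x}"] \<nu>.prob_eq_1[of "{x. frost \<nu> a x}"] by auto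
qed

text \<open>Each exponent \<open>u\<close> has \<open>frost\<close> almost everywhere or almost
  nowhere, and by monotonicity the former persists for smaller \<open>u\<close>; the supremum
  \<open>s\<close> is the cut.\<close>

lemma lower_local_dim_constant:
  assumes \<mu>: "\<mu> \<in> gibbs_class"
  defines "\<nu> \<equiv> distr \<mu> borel coding"
  shows "\<exists>s. (\<forall>u. ereal u < s \<longrightarrow> (AE x in \<nu>. frost \<nu> (2 powr - u) x)) \<and>
    (\<forall>u. s < ereal u \<longrightarrow> (AE x in \<nu>. \<not> frost \<nu> (2 powr - u) x))"
proof -
  define S where "S = {u. AE x in \<nu>. frost \<nu> (2 powr - u) x}"
  show ?thesis
  proof (intro exI[of _ "SUP u\<in>S. ereal u"] conjI allI impI)
    fix u assume "ereal u < (SUP u\<in>S. ereal u)"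
    then obtain u' where "u' \<in> S" "u < u'" by (auto simp: less_SUP_iff)
    then show "AE x in \<nu>. frost \<nu> (2 powr - u) x"
      unfolding S_def mem_Collect_eq by (auto elim!: eventually_mono frost_mono)
  next
    fix u assume u: "(SUP u\<in>S. ereal u) < ereal u"
    have "u \<notin> S"
      using u SUP_upper[of u S ereal] by (auto simp: not_le[symmetric])
    then show "AE x in \<nu>. \<not> frost \<nu> (2 powr - u) x"
      using frost_zero_one[OF \<mu>, of "2 powr - u", folded \<nu>_def] by (simp add: S_def)
  qed
qed

end

text \<open>The projection is 1-Lipschitz, so the ball about \<open>x\<close> lies in the preimage
  of the ball about its projection. This keeps the dimension of the projection below that of
  \<mu>.\<close>

lemma frost_orth_projD:
  fixes \<mu> :: "'v::euclidean_space measure"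
  assumes \<mu>: "finite_measure \<mu>" "sets \<mu> = sets borel" and V: "subspace V"
    and "frost (distr \<mu> borel (orth_proj V)) a (orth_proj V x)"
  shows "frost \<mu> a x"
proof -
  interpret finite_measure \<mu> by fact
  note P = borel_measurable_orth_proj[OF V \<mu>(2)]
  have "measure \<mu> (ball x r) \<le> measure (distr \<mu> borel (orth_proj V)) (ball (orth_proj V x) r)" for r
  proof -
    have "measure \<mu> (ball x r) \<le> measure \<mu> (orth_proj V -` ball (orth_proj V x) r \<inter> space \<mu>)"
    proof (rule finite_measure_mono)
      show "ball x r \<subseteq> orth_proj V -` ball (orth_proj V x) r \<inter> space \<mu>"
        using sets_eq_imp_space_eq[OF \<mu>(2)] by (auto intro: le_less_trans[OF orth_proj_lipschitz[OF V]])
    qed (use P in \<open>auto intro: measurable_sets\<close>)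
    then show ?thesis using P by (simp add: measure_distr)
  qed
  then show ?thesis using assms(4) order_trans unfolding frost_def by blast
qed

text \<open>The two upper bounds hold for every \<open>V\<close>, by the Lipschitz property and by
  counting cells in \<open>V\<close>; the hypothesis \<open>proj\<close> isolates the lower bound,
  the one place where \<open>V\<close> has to be generic.\<close>

lemma has_dim_H_projection:
  fixes \<nu> :: "'v::euclidean_space measure"
  assumes \<nu>: "prob_space \<nu>" "sets \<nu> = sets borel" "AE x in \<nu>. norm x \<le> R"
    and V: "subspace V" "dim V = d"
    and s: "\<And>u. ereal u < s \<Longrightarrow> AE x in \<nu>. frost \<nu> (2 powr - u) x"
      "\<And>u. s < ereal u \<Longrightarrow> AE x in \<nu>. \<not> frost \<nu> (2 powr - u) x"
    and proj: "\<And>a0 a1. (1/2) ^ d < a0 \<Longrightarrow> a0 < a1 \<Longrightarrow> AE x in \<nu>. frost \<nu> a0 x \<Longrightarrow>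
      AE x in \<nu>. frost (distr \<nu> borel (orth_proj V)) a1 (orth_proj V x)"
  shows "has_dim_H (distr \<nu> borel (orth_proj V)) (min (ereal (real d)) s)"
proof -
  interpret \<nu>: prob_space \<nu> by fact
  define \<pi> where "\<pi> = distr \<nu> borel (orth_proj V)"
  note P = borel_measurable_orth_proj[OF V(1) \<nu>(2)]
  interpret \<pi>: prob_space \<pi> unfolding \<pi>_def by (rule \<nu>.prob_space_distr[OF P])
  have \<pi>s: "sets \<pi> = sets borel" by (simp add: \<pi>_def)
  have F: "{y. frost \<pi> a y} \<in> sets borel" if "a > 0" for a
    by (rule frost_sets[OF \<pi>.finite_measure_axioms \<pi>s that])
  have AE1: "AE y in \<pi>. frost \<pi> a y" if "a > 0" "AE x in \<nu>. frost \<pi> a (orth_proj V x)" for a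
    using that F[of a] unfolding \<pi>_def by (subst AE_distr_iff[OF P]) auto
  have AE2: "AE y in \<pi>. \<not> frost \<pi> a y" if "a > 0" "AE x in \<nu>. \<not> frost \<pi> a (orth_proj V x)" for a
  proof -
    have "{y. \<not> frost \<pi> a y} \<in> sets borel"
      using sets.compl_sets[OF F[OF that(1)]] by (simp add: set_diff_eq)
    then show ?thesis using that unfolding \<pi>_def by (subst AE_distr_iff[OF P]) auto
  qed
  have half: "(2 :: real) powr - real d = (1/2) ^ d"
    by (simp add: powr_minus powr_realpow power_one_over inverse_eq_divide)
  have "AE y in \<pi>. lower_local_dim \<pi> y = min (ereal (real d)) s"
  proof (rule AE_lower_local_dim_eq[OF \<pi>.finite_measure_axioms \<pi>s])
    fix u assume u: "ereal u < min (ereal (real d)) s"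
    \<comment> \<open>A second exponent leaves room for the loss from \<open>a0\<close> to
      \<open>a1\<close>.\<close>
    then obtain u' where u': "ereal u < ereal u'" "ereal u' < min (ereal (real d)) s"
      using ereal_dense2 by blast
    have "AE x in \<nu>. frost \<nu> (2 powr - u') x" using u' by (intro s(1)) auto
    moreover have "(1/2) ^ d < 2 powr - u'" using u' by (simp flip: half)
    ultimately have "AE x in \<nu>. frost \<pi> (2 powr - u) (orth_proj V x)"
      unfolding \<pi>_def using u' by (intro proj) auto
    then show "AE y in \<pi>. frost \<pi> (2 powr - u) y" by (intro AE1) auto
  next
    fix u assume "min (ereal (real d)) s < ereal u"
    then consider "s < ereal u" | "real d < u" by (auto simp: min_less_iff_disj)
    then show "AE y in \<pi>. \<not> frost \<pi> (2 powr - u) y"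
    proof cases
      case 1
      then have "AE x in \<nu>. \<not> frost \<nu> (2 powr - u) x" by (rule s(2))
      then have "AE x in \<nu>. \<not> frost \<pi> (2 powr - u) (orth_proj V x)"
        by eventually_elim
          (use frost_orth_projD[OF \<nu>.finite_measure_axioms \<nu>(2) V(1)] in \<open>auto simp: \<pi>_def\<close>)
      then show ?thesis by (intro AE2) auto
    next
      case 2
      have "AE y in \<pi>. y \<in> V \<and> norm y \<le> R"
      proof -
        have "{y \<in> space borel. y \<in> V \<and> norm y \<le> R} = V \<inter> cball 0 R" by auto
        then have "{y \<in> space borel. y \<in> V \<and> norm y \<le> R} \<in> sets borel"
          using closed_subspace[OF V(1)] by auto
        moreover have "AE x in \<nu>. orth_proj V x \<in> V \<and> norm (orth_proj V x) \<le> R"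
          using \<nu>(3) by eventually_elim
            (use orth_proj_props(1)[OF V(1)] norm_orth_proj_le[OF V(1)] in \<open>auto intro: order_trans\<close>)
        ultimately show ?thesis unfolding \<pi>_def by (subst AE_distr_iff[OF P]) auto
      qed
      moreover have "2 powr - u < (1/2) ^ d" using 2 by (simp flip: half)
      ultimately show ?thesis
        by (intro AE_not_frost[OF \<pi>.finite_measure_axioms \<pi>s V]) auto
    qed
  qed
  then show ?thesis
    unfolding \<pi>_def[symmetric] by (rule has_dim_HI[OF \<pi>.prob_space_axioms])
qed

section \<open>Separability and projections for the whole family of Gibbs measures\<close>

lemma gibbs_measures_on_attractor_eq:
  "gibbs_measures_on_attractor V0 f = (\<lambda>\<mu>. distr \<mu> borel (coding_map V0 f)) ` gibbs_class"
  by (auto simp: gibbs_measures_on_attractor_def gibbs_class_def)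

lemma relative_dimension_separable_gibbs:
  assumes ifs: "conformal_IFS V0 f"
  shows "relative_dimension_separable (attractor V0 f) (gibbs_measures_on_attractor V0 f)"
proof -
  let ?d = "\<lambda>\<mu>. distr \<mu> borel (coding_map V0 f)"
  obtain N where N: "N \<subseteq> gibbs_class" "countable N" "\<And>\<mu> b. \<mu> \<in> gibbs_class \<Longrightarrow> b > 1 \<Longrightarrow>
      \<exists>\<nu>\<in>N. \<exists>C>0. scale_dominated C b (?d \<mu>) (?d \<nu>) \<and> scale_dominated C b (?d \<nu>) (?d \<mu>)"
    using gibbs_measures_separable[OF ifs] by meson
  have sub: "?d ` gibbs_class \<subseteq> finite_borel_measures_on (attractor V0 f)"
    using prob_space_coding[OF ifs] AE_coding_in_attractor[OF ifs]
    by (auto simp: finite_borel_measures_on_def prob_space_def)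
  have "\<exists>\<nu>\<in>?d ` N. relative_dim (?d \<mu>) \<nu> < ereal \<epsilon>" if \<mu>: "\<mu> \<in> gibbs_class" and \<epsilon>: "\<epsilon> > 0" for \<mu> \<epsilon>
  proof -
    \<comment> \<open>The general bound is four times the exponent of \<open>b\<close>, here
      \<open>\<epsilon> / 2\<close>.\<close>
    have b: "2 powr (\<epsilon> / 8) > 1" using \<epsilon> by simp
    obtain \<nu> C where \<nu>: "\<nu> \<in> N" "C > 0" "scale_dominated C (2 powr (\<epsilon> / 8)) (?d \<mu>) (?d \<nu>)"
      "scale_dominated C (2 powr (\<epsilon> / 8)) (?d \<nu>) (?d \<mu>)"
      using N(3)[OF \<mu> b] by blast
    have \<nu>': "\<nu> \<in> gibbs_class" using \<nu>(1) N(1) by blast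
    have "AE x in ?d \<mu>. \<forall>r>0. measure (?d \<mu>) (ball x r) > 0 \<and> measure (?d \<nu>) (ball x r) > 0"
      using AE_coding_in_attractor[OF ifs \<mu>]
      by eventually_elim (use measure_ball_attractor_pos[OF ifs] \<mu> \<nu>' in blast)
    then have "relative_dim (?d \<mu>) (?d \<nu>) \<le> ereal (4 * (\<epsilon> / 8))"
      using \<nu> \<epsilon> by (intro relative_dim_scale_dominated[OF prob_space_coding[OF ifs \<mu>] _ prob_space_coding[OF ifs \<nu>']]) auto
    also have "\<dots> < ereal \<epsilon>" using \<epsilon> by simp
    finally show ?thesis using \<nu>(1) by blast
  qed
  moreover have "?d ` N \<subseteq> finite_borel_measures_on (attractor V0 f)"
    using sub N(1) by blast
  ultimately show ?thesis
    unfolding relative_dimension_separable_def gibbs_measures_on_attractor_eq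
    using sub N(2) by (intro conjI exI[of _ "?d ` N"]) auto
qed

text \<open>Natural and rational parameters make the conditions on \<open>V\<close> countable, so
  one null set serves for all of them, fixed before any particular \<mu> is considered.\<close>

lemma AE_energy_countable:
  fixes N :: "(real ^ 'n) measure set"
  assumes \<gamma>: "Grassmannian_invariant_measure d \<gamma>" and d: "d \<ge> 1"
    and N: "countable N" "\<forall>\<nu>\<in>N. prob_space \<nu> \<and> sets \<nu> = sets borel"
  shows "AE V in \<gamma>. \<forall>\<nu>\<in>N. \<forall>(k :: nat) (a :: rat) (a' :: rat). (1/2) ^ d < real_of_rat a \<longrightarrow>
    a < a' \<longrightarrow> (\<exists>D\<ge>0. \<forall>m. projection_energy \<nu> (real k) (real_of_rat a) m V \<le> ennreal (D * real_of_rat a' ^ m))"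
  unfolding AE_ball_countable[OF N(1)] AE_all_countable
proof (intro ballI allI)
  fix \<nu> k a a' assume \<nu>: "\<nu> \<in> N"
  show "AE V in \<gamma>. (1/2) ^ d < real_of_rat a \<longrightarrow>
    a < a' \<longrightarrow> (\<exists>D\<ge>0. \<forall>m. projection_energy \<nu> (real k) (real_of_rat a) m V \<le> ennreal (D * real_of_rat a' ^ m))"
  proof (cases "(1/2) ^ d < real_of_rat a \<and> a < a'")
    case True
    then have "real_of_rat a < real_of_rat a'" by (simp add: of_rat_less)
    with True bspec[OF N(2) \<nu>] show ?thesis
      using AE_projection_energy[OF \<gamma> d, of \<nu> "real_of_rat a" "real_of_rat a'" "real k"] by simp
  qed auto
qed

lemma AE_has_dim_H_projection_gibbs:
  fixes V0 :: "(real ^ 'n) set" and f :: "'a::finite \<Rightarrow> real ^ 'n \<Rightarrow> real ^ 'n"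
  assumes ifs: "conformal_IFS V0 f" and \<gamma>: "Grassmannian_invariant_measure d \<gamma>" and d: "d \<ge> 1"
  shows "AE V in \<gamma>. \<forall>\<mu> \<in> gibbs_measures_on_attractor V0 f.
    \<exists>s. has_dim_H \<mu> s \<and> has_dim_H (distr \<mu> borel (orth_proj V)) (min (ereal (real d)) s)"
proof -
  let ?d = "\<lambda>\<mu>. distr \<mu> borel (coding_map V0 f)"
  obtain N where N: "N \<subseteq> gibbs_class" "countable N" "\<And>\<mu> b. \<mu> \<in> gibbs_class \<Longrightarrow> b > 1 \<Longrightarrow>
      \<exists>\<nu>\<in>N. \<exists>C>0. scale_dominated C b (?d \<mu>) (?d \<nu>) \<and> scale_dominated C b (?d \<nu>) (?d \<mu>)"
    using gibbs_measures_separable[OF ifs] by meson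
  have "compact (attractor V0 f)" by (rule compact_attractor[OF ifs])
  then obtain R where R: "\<And>x. x \<in> attractor V0 f \<Longrightarrow> norm x \<le> R"
    using compact_imp_bounded bounded_iff by metis
  have N': "countable (?d ` N)" "\<forall>\<nu>\<in>?d ` N. prob_space \<nu> \<and> sets \<nu> = sets borel"
    using N(1,2) prob_space_coding[OF ifs] by auto
  show ?thesis
    using AE_space AE_energy_countable[OF \<gamma> d N']
  proof eventually_elim
    case (elim V)
    have V: "subspace V" "dim V = d"
      using subspace_Grassmannian[OF \<gamma> elim(1)] by auto
    show ?case
      unfolding gibbs_measures_on_attractor_eq
    proof
      fix \<mu>' assume "\<mu>' \<in> ?d ` gibbs_class"
      then obtain \<mu> where \<mu>: "\<mu> \<in> gibbs_class" and \<mu>': "\<mu>' = ?d \<mu>" by blast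
      note prob = prob_space_coding[OF ifs \<mu>]
      obtain s where s: "\<And>u. ereal u < s \<Longrightarrow> AE x in ?d \<mu>. frost (?d \<mu>) (2 powr - u) x"
        "\<And>u. s < ereal u \<Longrightarrow> AE x in ?d \<mu>. \<not> frost (?d \<mu>) (2 powr - u) x"
        using lower_local_dim_constant[OF ifs \<mu>] by blast
      have "has_dim_H (?d \<mu>) s"
        using s by (intro has_dim_HI[OF prob] AE_lower_local_dim_eq prob_space.finite_measure[OF prob]) auto
      moreover have "has_dim_H (distr (?d \<mu>) borel (orth_proj V)) (min (ereal (real d)) s)"
      proof (rule has_dim_H_projection[OF prob _ _ V s])
        show "AE x in ?d \<mu>. norm x \<le> R"
          using AE_coding_in_attractor[OF ifs \<mu>] by eventually_elim (rule R)
        fix a0 a1 :: real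
        assume a: "(1/2) ^ d < a0" "a0 < a1" and frost: "AE x in ?d \<mu>. frost (?d \<mu>) a0 x"
        have "(0 :: real) < (1/2) ^ d" by simp
        then have "a0 > 0" using a(1) by linarith
        \<comment> \<open>Room for three losses: from \<open>a0\<close> to \<open>a\<close> when
          good points pass from \<mu> to \<nu>, from \<open>a\<close> to \<open>a'\<close> in the
          energy bound, from \<open>a'\<close> to \<open>a1\<close> when the energy passes back to
          \<mu>. The choice of \<open>V\<close> covers rational \<open>a\<close> and
          \<open>a'\<close>.\<close>
        obtain a where a2: "a0 < real_of_rat a" "real_of_rat a < a1" using of_rat_dense[OF a(2)] by blast
        obtain a' where a3: "real_of_rat a < real_of_rat a'" "real_of_rat a' < a1"
          using of_rat_dense[OF a2(2)] by blast
        obtain a'' where a4: "real_of_rat a' < a''" "a'' < a1" using dense[OF a3(2)] by blast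
        \<comment> \<open>The first term gives \<open>a0 * b \<le> a\<close>, the second
          \<open>b ^ 2 * a' \<le> a''\<close>.\<close>
        define b where "b = min (real_of_rat a / a0) (sqrt (a'' / real_of_rat a'))"
        have a'0: "real_of_rat a' > 0" using \<open>a0 > 0\<close> a2 a3 by linarith
        have b: "b > 1" using \<open>a0 > 0\<close> a'0 a2 a4 by (simp add: b_def)
        have ab: "a0 * b \<le> real_of_rat a"
          using \<open>a0 > 0\<close> mult_left_mono[of b "real_of_rat a / a0" a0] by (simp add: b_def)
        have "b ^ 2 \<le> sqrt (a'' / real_of_rat a') ^ 2"
          using b by (intro power_mono) (auto simp: b_def)
        also have "\<dots> = a'' / real_of_rat a'"
        proof -
          have "0 < a''" using a'0 a4 by linarith
          then show ?thesis using a'0 by simp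
        qed
        finally have "b ^ 2 * real_of_rat a' \<le> a''" using a'0 by (simp add: field_simps)
        then have ba: "b ^ 2 * real_of_rat a' < a1" using a4 by linarith
        \<comment> \<open>\<open>V\<close> is already fixed: \<nu> depends on \<mu> and
          \<open>b\<close>, but lies in the countable family for which \<open>V\<close> is
          good.\<close>
        obtain \<nu> C where \<nu>: "\<nu> \<in> N" "C > 0" "scale_dominated C b (?d \<mu>) (?d \<nu>)"
          "scale_dominated C b (?d \<nu>) (?d \<mu>)"
          using N(3)[OF \<mu> b] by blast
        have \<nu>': "\<nu> \<in> gibbs_class" using \<nu>(1) N(1) by blast
        show "AE x in ?d \<mu>. frost (distr (?d \<mu>) borel (orth_proj V)) a1 (orth_proj V x)"
        proof (rule AE_frost_projection[OF prob _ prob_space_coding[OF ifs \<nu>'] _ V(1) \<nu>(2) b \<nu>(3,4)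
              \<open>a0 > 0\<close> ab a'0 ba _ frost])
          show "\<exists>D\<ge>0. \<forall>m. projection_energy (?d \<nu>) (real k) (real_of_rat a) m V \<le> ennreal (D * real_of_rat a' ^ m)" for k
          proof -
            have "(1/2) ^ d < real_of_rat a" "a < a'"
              using a(1) a2(1) a3(1) by (auto simp: of_rat_less)
            then show ?thesis using elim(2) \<nu>(1) by blast
          qed
        qed auto
      qed auto
      ultimately show "\<exists>s. has_dim_H \<mu>' s \<and> has_dim_H (distr \<mu>' borel (orth_proj V)) (min (ereal (real d)) s)"
        unfolding \<mu>' by blast
    qed
  qed
qed

theorem theorem3p6:
  fixes V0 :: "(real ^ 'n) set" and f :: "'a::finite \<Rightarrow> real ^ 'n \<Rightarrow> real ^ 'n"
  assumes "conformal_IFS V0 f"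
  shows "relative_dimension_separable (attractor V0 f) (gibbs_measures_on_attractor V0 f) \<and>
    (\<forall>d (\<gamma> :: (real ^ 'n) set measure).
       1 \<le> d \<and> d < CARD('n) \<and> Grassmannian_invariant_measure d \<gamma> \<longrightarrow>
       (AE V in \<gamma>. \<forall>\<mu> \<in> gibbs_measures_on_attractor V0 f.
          \<exists>s. has_dim_H \<mu> s \<and>
              has_dim_H (distr \<mu> borel (orth_proj V)) (min (ereal (real d)) s)))"
  using relative_dimension_separable_gibbs[OF assms] AE_has_dim_H_projection_gibbs[OF assms] by blast

end
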